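(* Let $a,b\in\mathbb{Z}\setminus\{0\}$ and let $S(t)$ be the linear propagator on $\mathbb{T}^2=(\mathbb{R}/2\pi\mathbb{Z})^2$ with $\widehat{S(t)\phi}(k)=e^{-it(ak_1^2+bk_2^2)}\widehat\phi(k)$, $k\in\mathbb{Z}^2$. For $N\ge 2$ set $$\Theta(N)=\begin{cases}N, & -ab \text{ is a square (i.e. } -ab=h^2 \text{ for some } h\in\mathbb{Z}),\\ \log N, & -ab\text{ is not a square.}\end{cases}$$ Then there is a constant $K=K(a,b)>0$ such that for every dyadic $N\ge 2$ and every $\phi\in L^2(\mathbb{T}^2)$, $$\|S(t)P_{\le N}\phi\|_{L^4([0,2\pi]\times\mathbb{T}^2)}\le K\,\Theta(N)^{1/4}\|\phi\|_{L^2(\mathbb{T}^2)}.$$ Moreover, in both cases the loss $\Theta(N)^{1/4}$ is sharp up to constants depending only on $a,b$: there is $\kappa=\kappa(a,b)>0$ such that for every dyadic $N\ge2$ there exists a nonzero $\phi_N\in L^2(\mathbb{T}^2)$ with $$\|S(t)P_{\le N}\phi_N\|_{L^4([0,2\pi]\times\mathbb{T}^2)}\ge \kappa\,\Theta(N)^{1/4}\|\phi_N\|_{L^2(\mathbb{T}^2)}.$$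
   Context: Fourier convention on $\mathbb{T}^2=(\mathbb{R}/2\pi\mathbb{Z})^2$: $f(x)=\sum_{k\in\mathbb{Z}^2}\widehat f(k)e^{ik\cdot x}$, $\widehat f(k)=(2\pi)^{-2}\int_{\mathbb{T}^2}f(x)e^{-ik\cdot x}\,dx$. $P_{\le N}$ is the sharp Fourier projection onto frequencies in $[-N,N]^2\cap\mathbb{Z}^2$. Dyadic numbers are those of the form $2^j$, $j\in\mathbb{Z}_{\ge0}$. *)

theory Defs
  imports "HOL-Analysis.Analysis"
begin

text \<open>
  Functions on the torus are functions on the plane that are \<open>2\<pi>\<close>-periodic in each variable;
  integrals over the torus are taken over the period square, whose boundary has measure zero.
\<close>

definition torus :: "(real \<times> real) measure" where
  "torus = restrict_space lborel ({0..2 * pi} \<times> {0..2 * pi})"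

definition spacetime :: "(real \<times> (real \<times> real)) measure" where
  "spacetime = restrict_space lborel {0..2 * pi} \<Otimes>\<^sub>M torus"

definition torus_periodic :: "(real \<times> real \<Rightarrow> complex) \<Rightarrow> bool" where
  "torus_periodic f \<longleftrightarrow> (\<forall>x y. f (x + 2 * pi, y) = f (x, y) \<and> f (x, y + 2 * pi) = f (x, y))"

text \<open>
  Elements of \<open>Lp\<close> are functions, not classes modulo null sets. The number \<open>Lp_norm\<close> is the
  norm only on members of \<open>Lp\<close>, because the Bochner integral of a non-integrable function is 0.
\<close>

definition Lp :: "real \<Rightarrow> 'a measure \<Rightarrow> ('a \<Rightarrow> complex) set" where
  "Lp p M = {f \<in> borel_measurable M. integrable M (\<lambda>x. cmod (f x) powr p)}"

definition Lp_norm :: "real \<Rightarrow> 'a measure \<Rightarrow> ('a \<Rightarrow> complex) \<Rightarrow> real" where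
  "Lp_norm p M f = (LINT x|M. cmod (f x) powr p) powr (1 / p)"

definition L2_torus :: "(real \<times> real \<Rightarrow> complex) set" where
  "L2_torus = {f \<in> Lp 2 torus. torus_periodic f}"

definition character :: "int \<times> int \<Rightarrow> real \<times> real \<Rightarrow> complex" where
  "character k x = cis (of_int (fst k) * fst x + of_int (snd k) * snd x)"

definition fourier_coeff :: "(real \<times> real \<Rightarrow> complex) \<Rightarrow> int \<times> int \<Rightarrow> complex" where
  "fourier_coeff f k = (LINT x|torus. f x * character (- k) x) / of_real ((2 * pi)\<^sup>2)"

definition freq_box :: "nat \<Rightarrow> (int \<times> int) set" where
  "freq_box N = {- int N..int N} \<times> {- int N..int N}"

definition proj_le :: "nat \<Rightarrow> (real \<times> real \<Rightarrow> complex) \<Rightarrow> real \<times> real \<Rightarrow> complex" where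
  "proj_le N f x = (\<Sum>k\<in>freq_box N. fourier_coeff f k * character k x)"

text \<open>
  The function with Fourier coefficients \<open>exp (-it(a k\<^sub>1\<^sup>2 + b k\<^sub>2\<^sup>2))\<close> times those of \<open>f\<close> is written
  as the pointwise limit of its square partial sums. For \<open>f\<close> in \<open>L\<^sup>2\<close> these converge almost
  everywhere to that function (Carleson, Fefferman); for a trigonometric polynomial \<open>f\<close>
  the partial sums are eventually constant at every point.
\<close>

definition propagator ::
    "int \<Rightarrow> int \<Rightarrow> real \<Rightarrow> (real \<times> real \<Rightarrow> complex) \<Rightarrow> real \<times> real \<Rightarrow> complex" where
  "propagator a b t f x = lim (\<lambda>n. \<Sum>k\<in>freq_box n.
     cis (- t * of_int (a * (fst k)\<^sup>2 + b * (snd k)\<^sup>2)) * fourier_coeff f k * character k x)"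

definition Theta :: "int \<Rightarrow> int \<Rightarrow> nat \<Rightarrow> real" where
  "Theta a b N = (if \<exists>h::int. - (a * b) = h\<^sup>2 then real N else ln (real N))"

definition dyadic :: "nat \<Rightarrow> bool" where
  "dyadic N \<longleftrightarrow> (\<exists>j. N = 2 ^ j)"

end

theory Submission imports Defs begin

text \<open>
  Expanding the fourth power of the modulus, the \<open>L\<^sup>4\<close> norm counts, with weights given by the
  Fourier coefficients, the quadruples with \<open>k\<^sub>1 + k\<^sub>2 = k\<^sub>3 + k\<^sub>4\<close> and
  \<open>Q k\<^sub>1 + Q k\<^sub>2 = Q k\<^sub>3 + Q k\<^sub>4\<close>. If \<open>-ab\<close> is a square, two given opposite corners
  \<open>k\<^sub>1, k\<^sub>2\<close> leave at most two choices of \<open>k\<^sub>3\<close> in each column, and an isotropic line shows that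
  this is sharp. Otherwise \<open>Q\<close> is anisotropic and the nondegenerate quadruples are rectangles for the
  bilinear form of \<open>Q\<close>. As in the work of Herr and Kwak, these are counted with the
  Szemeredi-Trotter theorem, obtained here from the crossing number inequality: the lattice points are
  sorted into dyadic levels by decreasing coefficient; a corner is rich if one of its two sides
  lies on a line with more than about the square root of the expected number of points up to its level.
  Each level has few rich incidences, which settles the rectangles with rich corners, and the remaining ones
  are counted by right-angled triangles after dropping the corner with the smallest coefficient. The
  number of levels is of order \<open>log N\<close>, which is the loss. For the lower bound one takes all
  frequencies in the box and counts rectangles by the direction \<open>(p, q)\<close>, \<open>p\<close> and \<open>q\<close> coprime, of a side.
\<close>

section \<open>Plane graphs with straight edges\<close>

text \<open>Estimating the rectangles over each fixed diagonal separately, as the divisor bound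
  does, loses more than a logarithm. The count has to be done on average and for arbitrary
  coefficients, and incidence bounds control such averages. Two logarithms threaten: the number of
  levels, and a harmonic sum over the richness \<open>u\<close> of lines. They do not multiply,
  because the free parameter of the incidence bound is tuned to each pair of levels
  \<open>i\<close>, \<open>j\<close>: after weighting, the harmonic term decays geometrically in the
  distance of \<open>i\<close> and \<open>j\<close>, so for each \<open>j\<close> it is felt by
  boundedly many \<open>i\<close> only, while the remaining terms are bounded and cost one factor
  for the number of levels. Dropping the corner of smallest coefficient works because three corners
  determine the fourth and its coefficient is at most a product of two square roots, one for each
  leg of the remaining right angle. The crossing inequality is proved without faces or Euler's
  formula: vertices have distinct abscissae, so edges run from left to right and can be charged
  directly to vertices.\<close>

definition height :: "('v \<Rightarrow> real) \<Rightarrow> ('v \<Rightarrow> real) \<Rightarrow> 'v \<times> 'v \<Rightarrow> real \<Rightarrow> real" where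
  "height X Y e x = Y (fst e) + (Y (snd e) - Y (fst e)) / (X (snd e) - X (fst e)) * (x - X (fst e))"

lemma height_fst [simp]: "height X Y e (X (fst e)) = Y (fst e)"
  by (simp add: height_def)

lemma height_snd [simp]: "X (fst e) < X (snd e) \<Longrightarrow> height X Y e (X (snd e)) = Y (snd e)"
  by (simp add: height_def)

text \<open>A strict change of sign would put the zero of the affine function strictly between
  \<open>x\<close> and \<open>y\<close>, hence inside the open interval where it is
  excluded.\<close>

lemma affine_sign_propagates:
  fixes p q x0 x1 x :: real
  assumes nz: "\<And>y. \<lbrakk>x0 < y; y < x1\<rbrakk> \<Longrightarrow> p + q * y \<noteq> 0"
    and "x0 < x1" "x0 \<le> x" "x \<le> x1" "p + q * x > 0" "x0 \<le> y" "y \<le> x1"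
  shows "p + q * y \<ge> 0"
proof (rule ccontr)
  assume neg: "\<not> p + q * y \<ge> 0"
  have q: "q \<noteq> 0" using neg assms(5) by auto
  define z where "z = - p / q"
  have z0: "p + q * z = 0" using q by (simp add: z_def)
  have "z \<noteq> x" "z \<noteq> y" using z0 neg assms(5) by auto
  have "q * (x - z) > 0" using z0 assms(5) by (simp add: algebra_simps)
  moreover have "q * (y - z) < 0" using z0 neg by (simp add: algebra_simps)
  ultimately have "(y < z \<and> z < x) \<or> (x < z \<and> z < y)"
    by (cases "q > 0") (auto simp: mult_less_0_iff zero_less_mult_iff)
  then show False using nz[of z] z0 assms by auto
qed

lemma height_affine: "height X Y e y =
   (Y (fst e) - (Y (snd e) - Y (fst e)) / (X (snd e) - X (fst e)) * X (fst e))
   + (Y (snd e) - Y (fst e)) / (X (snd e) - X (fst e)) * y"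
  unfolding height_def right_diff_distrib by simp

text \<open>Edges are straight and point to the right. Both exclusions concern open ranges of
  abscissae only, so that edges may share end points.\<close>

locale plane_graph =
  fixes V :: "'v set" and X Y :: "'v \<Rightarrow> real" and E :: "('v \<times> 'v) set"
  assumes finV: "finite V" and injX: "inj_on X V"
    and EV: "\<And>e. e \<in> E \<Longrightarrow> fst e \<in> V \<and> snd e \<in> V \<and> X (fst e) < X (snd e)"
    and no_vertex: "\<And>e z. \<lbrakk>e \<in> E; z \<in> V; X (fst e) < X z; X z < X (snd e)\<rbrakk> \<Longrightarrow> Y z \<noteq> height X Y e (X z)"
    and noncrossing: "\<And>e e' x. \<lbrakk>e \<in> E; e' \<in> E; e \<noteq> e'; X (fst e) < x; X (fst e') < x; x < X (snd e); x < X (snd e')\<rbrakk>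
         \<Longrightarrow> height X Y e x \<noteq> height X Y e' x"
begin

abbreviation "ht \<equiv> height X Y"

lemma E_finite: "finite E"
proof -
  have "E \<subseteq> V \<times> V" using EV by (auto simp: mem_Times_iff)
  then show ?thesis using finV by (meson finite_SigmaI finite_subset)
qed

text \<open>Two edges can exchange their vertical order only by crossing. The conclusion is weak
  since they may meet at a common end.\<close>

lemma order_preserved:
  assumes e: "e \<in> E" "e' \<in> E"
    and x: "X (fst e) \<le> x" "X (fst e') \<le> x" "x \<le> X (snd e)" "x \<le> X (snd e')" "ht e x < ht e' x"
    and y: "X (fst e) \<le> y" "X (fst e') \<le> y" "y \<le> X (snd e)" "y \<le> X (snd e')"
  shows "ht e y \<le> ht e' y"
proof (cases "x = y")
  case False
  define x0 where "x0 = max (X (fst e)) (X (fst e'))"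
  define x1 where "x1 = min (X (snd e)) (X (snd e'))"
  define s where "s e = (Y (snd e) - Y (fst e)) / (X (snd e) - X (fst e))" for e
  define k where "k e = Y (fst e) - s e * X (fst e)" for e
  have h: "ht e y = k e + s e * y" for e y
    unfolding height_affine k_def s_def by simp
  have ne: "e \<noteq> e'" using x by auto
  have "(k e' - k e) + (s e' - s e) * y \<ge> 0"
  proof (rule affine_sign_propagates[where x = x and ?x0.0 = x0 and ?x1.0 = x1])
    fix y assume "x0 < y" "y < x1"
    then have "ht e y \<noteq> ht e' y" using noncrossing[OF e ne, of y] by (auto simp: x0_def x1_def)
    then show "(k e' - k e) + (s e' - s e) * y \<noteq> 0" by (simp add: h algebra_simps)
  next
    show "x0 < x1" using False x y unfolding x0_def x1_def by linarith
    show "(k e' - k e) + (s e' - s e) * x > 0" using x(5) by (simp add: h algebra_simps)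
  qed (use x y in \<open>auto simp: x0_def x1_def\<close>)
  then show ?thesis by (simp add: h algebra_simps)
qed (use x in auto)

definition slope :: "'v \<times> 'v \<Rightarrow> real" where
  "slope e = (Y (snd e) - Y (fst e)) / (X (snd e) - X (fst e))"

lemma ht_slope: "ht e x = Y (fst e) + slope e * (x - X (fst e))"
  by (simp add: height_def slope_def)

lemma slope_inj:
  assumes "e \<in> E" "e' \<in> E" "fst e = fst e'" "slope e = slope e'"
  shows "e = e'"
proof (rule ccontr)
  assume "e \<noteq> e'"
  define x where "x = (X (fst e) + min (X (snd e)) (X (snd e'))) / 2"
  have "X (fst e) < x" "x < X (snd e)" "x < X (snd e')"
    using EV[OF assms(1)] EV[OF assms(2)] assms(3) by (auto simp: x_def min_def)
  then show False using noncrossing[OF assms(1,2) \<open>e \<noteq> e'\<close>, of x] assms by (simp add: ht_slope)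
qed

text \<open>The region between two edges with a common left end, cut off where the shorter one
  stops. The apex is excluded but the boundary is not, so the nearer right end always belongs to
  it.\<close>

definition wedge :: "'v \<times> 'v \<Rightarrow> 'v \<times> 'v \<Rightarrow> 'v set" where
  "wedge e' e = {z \<in> V. X (fst e) < X z \<and> X z \<le> X (snd e) \<and> X z \<le> X (snd e') \<and>
                   ht e' (X z) \<le> Y z \<and> Y z \<le> ht e (X z)}"

definition adjacent :: "'v \<times> 'v \<Rightarrow> 'v \<times> 'v \<Rightarrow> bool" where
  "adjacent e' e \<longleftrightarrow> e' \<in> E \<and> e \<in> E \<and> fst e' = fst e \<and> slope e' < slope e \<and>
     (\<forall>g\<in>E. fst g = fst e \<longrightarrow> slope g \<le> slope e' \<or> slope e \<le> slope g)"

definition first :: "'v \<Rightarrow> 'v set \<Rightarrow> bool" where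
  "first z A \<longleftrightarrow> z \<in> A \<and> (\<forall>y\<in>A. X z \<le> X y)"

lemma wedge_nonempty:
  assumes "adjacent e' e"
  shows "wedge e' e \<noteq> {}"
proof -
  have e: "e' \<in> E" "e \<in> E" "fst e' = fst e" "slope e' < slope e"
    using assms by (auto simp: adjacent_def)
  have le: "ht e' x \<le> ht e x" if "X (fst e) \<le> x" for x
    using e that by (simp add: ht_slope mult_right_mono)
  show ?thesis
  proof (cases "X (snd e) \<le> X (snd e')")
    case True
    then have "snd e \<in> wedge e' e" using EV[OF e(2)] le[of "X (snd e)"] by (auto simp: wedge_def)
    then show ?thesis by auto
  next
    case False
    then have "snd e' \<in> wedge e' e" using EV[OF e(1)] le[of "X (snd e')"] e(3) by (auto simp: wedge_def)
    then show ?thesis by auto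
  qed
qed

lemma first_exists:
  assumes "adjacent e' e" shows "\<exists>z. first z (wedge e' e)"
proof -
  have "finite (wedge e' e)" using finV by (auto simp: wedge_def)
  then show ?thesis using wedge_nonempty[OF assms] unfolding first_def
    by (meson ex_min_if_finite arg_min_if_finite(1,2) linorder_not_less)
qed

text \<open>Followed to the left, such an edge would have to begin inside the wedge, before \<open>z\<close>.\<close>

lemma no_edge_before_first:
  assumes adj: "adjacent e' e" and z: "first z (wedge e' e)" and g: "g \<in> E"
    and x: "X (fst g) < X z" "X z \<le> X (snd g)" "ht e' (X z) < ht g (X z)" "ht g (X z) < ht e (X z)"
  shows False
proof -
  have e: "e' \<in> E" "e \<in> E" "fst e' = fst e" "slope e' < slope e"
    using adj by (auto simp: adjacent_def)
  have zw: "z \<in> V" "X (fst e) < X z" "X z \<le> X (snd e)" "X z \<le> X (snd e')"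
    using z by (auto simp: first_def wedge_def)
  have V: "fst g \<in> V" "fst e \<in> V" using EV[OF g] EV[OF e(2)] by auto
  consider "X (fst g) = X (fst e)" | "X (fst e) < X (fst g)" | "X (fst g) < X (fst e)" by linarith
  then show False
  proof cases
    case 1
    then have "fst g = fst e" using V injX by (auto simp: inj_on_def)
    then have "slope e' < slope g" "slope g < slope e"
      using x(3,4) zw(2) e(3) by (auto simp: ht_slope)
    then show False using adj g \<open>fst g = fst e\<close> by (force simp: adjacent_def)
  next
    case 2
    have "ht e' (X (fst g)) \<le> ht g (X (fst g))"
      using order_preserved[OF e(1) g _ _ _ _ x(3), of "X (fst g)"] 2 x zw e by auto
    moreover have "ht g (X (fst g)) \<le> ht e (X (fst g))"
      using order_preserved[OF g e(2) _ _ _ _ x(4), of "X (fst g)"] 2 x zw e by auto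
    ultimately have "fst g \<in> wedge e' e" using 2 x zw V by (auto simp: wedge_def)
    then show False using z x by (force simp: first_def)
  next
    \<comment> \<open>The edge \<open>g\<close> passes over the apex; squeezed between the two edges
      that meet there, it would contain the apex in its interior.\<close>
    case 3
    have "ht e' (X (fst e)) \<le> ht g (X (fst e))"
      using order_preserved[OF e(1) g _ _ _ _ x(3), of "X (fst e)"] 3 x zw e by auto
    moreover have "ht g (X (fst e)) \<le> ht e (X (fst e))"
      using order_preserved[OF g e(2) _ _ _ _ x(4), of "X (fst e)"] 3 x zw e by auto
    moreover have "ht e' (X (fst e)) = Y (fst e)" using e(3) height_fst[of X Y e'] by simp
    ultimately have "ht g (X (fst e)) = Y (fst e)" by simp
    then show False using no_vertex[OF g V(2)] 3 zw x by auto
  qed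
qed

definition lower :: "'v \<times> 'v \<Rightarrow> 'v \<times> 'v" where
  "lower e = (SOME e'. adjacent e' e)"

definition target :: "'v \<times> 'v \<Rightarrow> 'v" where
  "target e = (SOME z. first z (wedge (lower e) e))"

definition lowest :: "'v \<times> 'v \<Rightarrow> bool" where
  "lowest e \<longleftrightarrow> (\<forall>g\<in>E. fst g = fst e \<longrightarrow> slope e \<le> slope g)"

lemma lower_adjacent:
  assumes "e \<in> E" "\<not> lowest e"
  shows "adjacent (lower e) e"
proof -
  define A where "A = {g \<in> E. fst g = fst e \<and> slope g < slope e}"
  have "finite A" "A \<noteq> {}" using assms E_finite by (auto simp: A_def lowest_def not_le)
  then have "Max (slope ` A) \<in> slope ` A" by (intro Max_in) auto
  then obtain g where g: "g \<in> A" "slope g = Max (slope ` A)" by auto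
  then have g: "g \<in> A" "\<forall>g'\<in>A. slope g' \<le> slope g" using \<open>finite A\<close> by auto
  then have "adjacent g e" using assms unfolding adjacent_def A_def by force
  then show ?thesis unfolding lower_def by (rule someI)
qed

lemma target_first:
  assumes "e \<in> E" "\<not> lowest e"
  shows "first (target e) (wedge (lower e) e)"
  using first_exists[OF lower_adjacent[OF assms]] unfolding target_def by (rule someI_ex)

text \<open>An edge that is not the lowest one at its left end is charged to the first vertex in the wedge
  between it and the next lower edge. Only three edges can be charged to the same vertex.\<close>

definition charge :: "'v \<times> 'v \<Rightarrow> 'v \<times> nat" where
  "charge e = (if lowest e then (fst e, 0) else (target e, if target e = snd e then 1 else 2))"

text \<open>This and the next lemma turn the weak bounds of the wedge into the strict ones that
  \<open>no_edge_before_first\<close> needs: a vertex never lies in the interior of an edge.\<close>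

lemma below_or_end:
  assumes "e \<in> E" "\<not> lowest e" "target e \<noteq> snd e"
  shows "X (target e) < X (snd e)" "Y (target e) < ht e (X (target e))"
proof -
  have t: "target e \<in> V" "X (fst e) < X (target e)" "X (target e) \<le> X (snd e)" "Y (target e) \<le> ht e (X (target e))"
    using target_first[OF assms(1,2)] by (auto simp: first_def wedge_def)
  have "X (target e) \<noteq> X (snd e)" using t EV[OF assms(1)] injX assms(3) by (auto simp: inj_on_def)
  then show 1: "X (target e) < X (snd e)" using t by simp
  show "Y (target e) < ht e (X (target e))" using t no_vertex[OF assms(1) t(1) t(2) 1] by simp
qed

lemma not_lower_end:
  assumes "e \<in> E" "\<not> lowest e" "target e = snd e"
  shows "X (target e) < X (snd (lower e))" "ht (lower e) (X (target e)) < Y (target e)"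
proof -
  have adj: "adjacent (lower e) e" by (rule lower_adjacent[OF assms(1,2)])
  then have l: "lower e \<in> E" "fst (lower e) = fst e" "slope (lower e) < slope e" by (auto simp: adjacent_def)
  have t: "target e \<in> V" "X (fst e) < X (target e)" "X (target e) \<le> X (snd (lower e))"
    using target_first[OF assms(1,2)] by (auto simp: first_def wedge_def)
  have "ht (lower e) (X (target e)) < ht e (X (target e))"
    using l t by (simp add: ht_slope)
  then show 1: "ht (lower e) (X (target e)) < Y (target e)"
    using assms EV[OF assms(1)] by simp
  have "ht (lower e) (X (snd (lower e))) = Y (snd (lower e))" using EV[OF l(1)] by (intro height_snd) auto
  then have "snd (lower e) \<noteq> target e" using 1 by (intro notI) simp
  then have "X (target e) \<noteq> X (snd (lower e))" using t(1) EV[OF l(1)] inj_onD[OF injX] by metis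
  then show "X (target e) < X (snd (lower e))" using t by simp
qed

text \<open>Suppose two edges have the same target \<open>z\<close>. With label 2 both pass strictly
  above \<open>z\<close>, and the lower of them would enter the wedge of the other before its first
  vertex. With label 1 both end at \<open>z\<close>; the same argument applied to their lower
  neighbours shows that these coincide, so the two edges share both ends.\<close>

lemma charge_inj: "inj_on charge E"
proof (rule inj_onI)
  fix e1 e2 assume e: "e1 \<in> E" "e2 \<in> E" and eq: "charge e1 = charge e2"
  show "e1 = e2"
  proof (cases "lowest e1")
    case True
    then have l2: "lowest e2" "fst e1 = fst e2" using eq by (auto simp: charge_def split: if_splits)
    then have "slope e1 = slope e2" using True e by (auto simp: lowest_def intro!: antisym)
    then show ?thesis using slope_inj e l2 by blast
  next
    case False
    note n1 = False
    have n2: "\<not> lowest e2" using eq n1 by (auto simp: charge_def split: if_splits)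
    have t: "target e1 = target e2" using eq n1 n2 by (auto simp: charge_def)
    define z where "z = target e1"
    note a1 = lower_adjacent[OF e(1) n1] and a2 = lower_adjacent[OF e(2) n2]
    note f1 = target_first[OF e(1) n1] and f2 = target_first[OF e(2) n2]
    have w: "X (fst e1) < X z" "X (fst e2) < X z" "ht (lower e1) (X z) \<le> Y z" "ht (lower e2) (X z) \<le> Y z"
      using f1 f2 t by (auto simp: first_def wedge_def z_def)
    show ?thesis
    proof (cases "target e1 = snd e1")
      case False
      have F2: "target e2 \<noteq> snd e2" using eq n1 n2 False by (auto simp: charge_def split: if_splits)
      note b1 = below_or_end[OF e(1) n1 False] and b2 = below_or_end[OF e(2) n2 F2]
      show ?thesis
      proof (rule ccontr)
        assume "e1 \<noteq> e2"
        then have "ht e1 (X z) \<noteq> ht e2 (X z)"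
          using noncrossing[OF e] b1 b2 w t by (auto simp: z_def)
        then consider "ht e1 (X z) < ht e2 (X z)" | "ht e2 (X z) < ht e1 (X z)" by linarith
        then show False
        proof cases
          case 1
          then show False using no_edge_before_first[OF a2 f2 e(1)] b1 w t by (auto simp: z_def)
        next
          case 2
          then show False using no_edge_before_first[OF a1 f1 e(2)] b2 w t by (auto simp: z_def)
        qed
      qed
    next
      case True
      have F2: "target e2 = snd e2" using eq n1 n2 True by (auto simp: charge_def split: if_splits)
      note b1 = not_lower_end[OF e(1) n1 True] and b2 = not_lower_end[OF e(2) n2 F2]
      have l: "lower e1 \<in> E" "lower e2 \<in> E" "fst (lower e1) = fst e1" "fst (lower e2) = fst e2"
        using a1 a2 by (auto simp: adjacent_def)
      have top: "ht e1 (X z) = Y z" "ht e2 (X z) = Y z"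
        using True F2 t EV[OF e(1)] EV[OF e(2)] height_snd[of X e1 Y] height_snd[of X e2 Y] by (auto simp: z_def)
      have "lower e1 = lower e2"
      proof (rule ccontr)
        assume "lower e1 \<noteq> lower e2"
        then have "ht (lower e1) (X z) \<noteq> ht (lower e2) (X z)"
          using noncrossing[OF l(1,2)] b1 b2 w t l by (auto simp: z_def)
        then consider "ht (lower e1) (X z) < ht (lower e2) (X z)" | "ht (lower e2) (X z) < ht (lower e1) (X z)" by linarith
        then show False
        proof cases
          case 1
          then show False using no_edge_before_first[OF a1 f1 l(2)] b1 b2 w t l top by (auto simp: z_def)
        next
          case 2
          then show False using no_edge_before_first[OF a2 f2 l(1)] b1 b2 w t l top by (auto simp: z_def)
        qed
      qed
      then show ?thesis using l t True F2 by (metis prod.collapse)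
    qed
  qed
qed

text \<open>Each vertex receives at most one charge with each of three labels. This is the linear
  bound for planar graphs up to its additive constant.\<close>

theorem edges_le: "card E \<le> 3 * card V"
proof -
  have "charge ` E \<subseteq> V \<times> {0, 1, 2}"
  proof
    fix c assume "c \<in> charge ` E"
    then obtain e where e: "e \<in> E" "c = charge e" by auto
    show "c \<in> V \<times> {0, 1, 2}"
    proof (cases "lowest e")
      case True then show ?thesis using e EV by (auto simp: charge_def)
    next
      case False
      then show ?thesis using target_first[OF e(1) False] e by (auto simp: charge_def first_def wedge_def)
    qed
  qed
  then have "card E \<le> card (V \<times> {0, 1, 2::nat})"
    using charge_inj finV by (intro card_inj_on_le[of charge]) auto
  then show ?thesis by (simp add: card_cartesian_product)
qed

end

section \<open>Crossings\<close>

text \<open>A random subset of density \<open>1 / m\<close> is the zero class of a uniform colouring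
  with \<open>m\<close> colours, so that probabilities become cardinalities.\<close>

lemma card_colourings:
  assumes "finite V" "A \<subseteq> V" "m > 0"
  shows "card {c \<in> (V \<rightarrow>\<^sub>E {..<m}). \<forall>v\<in>A. c v = 0} = m ^ (card V - card A)"
proof -
  have "{c \<in> (V \<rightarrow>\<^sub>E {..<m}). \<forall>v\<in>A. c v = 0} = (\<Pi>\<^sub>E v\<in>V. if v \<in> A then {0} else {..<m})" (is "?L = ?R")
  proof (intro set_eqI iffI)
    fix c assume "c \<in> ?R"
    then have "c \<in> extensional V" "\<And>v. v \<in> V \<Longrightarrow> c v \<in> (if v \<in> A then {0} else {..<m})"
      by (auto simp: PiE_iff)
    then show "c \<in> ?L" using assms by (force simp: PiE_iff split: if_splits)
  qed (use assms in \<open>auto simp: PiE_iff\<close>)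
  then have "card {c \<in> (V \<rightarrow>\<^sub>E {..<m}). \<forall>v\<in>A. c v = 0} = (\<Prod>v\<in>V. if v \<in> A then 1 else m)"
    using assms(1) by (simp add: card_PiE if_distrib[of card] cong: if_cong)
  also have "\<dots> = m ^ card (V - A)"
    using assms by (simp add: prod.If_cases Int_absorb1 Diff_eq[symmetric])
  finally show ?thesis using assms by (simp add: card_Diff_subset finite_subset)
qed

text \<open>Averages a linear inequality over random subsets of \<open>V\<close> in which each vertex is kept with
  probability \<open>1 / m\<close>.\<close>

lemma sampling_inequality:
  fixes V :: "'v set" and E :: "'e set" and F :: "'f set"
  assumes fin: "finite V" "finite E" "finite F" and m: "m > 0"
    and E: "\<And>e. e \<in> E \<Longrightarrow> ends e \<subseteq> V \<and> card (ends e) = 2"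
    and F: "\<And>e. e \<in> F \<Longrightarrow> corners e \<subseteq> V \<and> card (corners e) = 4"
    and ineq: "\<And>W. W \<subseteq> V \<Longrightarrow> card {e \<in> E. ends e \<subseteq> W} \<le> 3 * card W + card {e \<in> F. corners e \<subseteq> W}"
  shows "card E * m ^ 2 \<le> 3 * card V * m ^ 3 + card F"
proof -
  define C where "C = (V \<rightarrow>\<^sub>E {..<m})"
  define W where "W c = {v \<in> V. c v = (0::nat)}" for c
  define n where "n = card V"
  have finC: "finite C" using fin by (simp add: C_def finite_PiE)
  have double: "(\<Sum>c\<in>C. card {e \<in> D. g e \<subseteq> W c}) = card D * m ^ (n - k)"
    if "finite D" "\<And>e. e \<in> D \<Longrightarrow> g e \<subseteq> V \<and> card (g e) = k" for D :: "'z set" and g k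
  proof -
    have "(\<Sum>c\<in>C. card {e \<in> D. g e \<subseteq> W c}) = (\<Sum>c\<in>C. \<Sum>e\<in>D. if g e \<subseteq> W c then 1 else 0)"
      using that(1) by (simp add: sum.If_cases Int_def)
    also have "\<dots> = (\<Sum>e\<in>D. \<Sum>c\<in>C. if g e \<subseteq> W c then 1 else 0)" by (rule sum.swap)
    also have "\<dots> = (\<Sum>e\<in>D. m ^ (n - k))"
    proof (rule sum.cong[OF refl])
      fix e assume e: "e \<in> D"
      have "(\<Sum>c\<in>C. if g e \<subseteq> W c then 1 else 0) = card {c \<in> C. g e \<subseteq> W c}"
        using finC by (simp add: sum.If_cases Int_def)
      also have "{c \<in> C. g e \<subseteq> W c} = {c \<in> (V \<rightarrow>\<^sub>E {..<m}). \<forall>v\<in>g e. c v = 0}"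
        using that(2)[OF e] by (auto simp: C_def W_def)
      also have "card \<dots> = m ^ (n - k)" using card_colourings[OF fin(1) _ m] that(2)[OF e] by (simp add: n_def)
      finally show "(\<Sum>c\<in>C. if g e \<subseteq> W c then 1 else 0) = m ^ (n - k)" .
    qed
    finally show ?thesis by simp
  qed
  have "(\<Sum>c\<in>C. card {e \<in> E. ends e \<subseteq> W c}) \<le> (\<Sum>c\<in>C. 3 * card (W c) + card {e \<in> F. corners e \<subseteq> W c})"
    by (intro sum_mono ineq) (auto simp: W_def)
  also have "\<dots> = 3 * (\<Sum>c\<in>C. card {v \<in> V. {v} \<subseteq> W c}) + (\<Sum>c\<in>C. card {e \<in> F. corners e \<subseteq> W c})"
    by (simp add: sum.distrib sum_distrib_left W_def cong: conj_cong)
  finally have main: "card E * m ^ (n - 2) \<le> 3 * (n * m ^ (n - 1)) + card F * m ^ (n - 4)"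
    using double[OF fin(2) E] double[OF fin(3) F] double[OF fin(1), of "\<lambda>v. {v}" 1] by (simp add: n_def)
  show ?thesis
  proof (cases "card E = 0")
    case False
    then have "E \<noteq> {}" by auto
    then obtain e where "e \<in> E" by auto
    then have n2: "n \<ge> 2" using E card_mono[OF fin(1), of "ends e"] by (auto simp: n_def)
    \<comment> \<open>The exponents are truncated differences. Multiplying by \<open>m ^ 4\<close>
      removes them, since an edge forces \<open>n \<ge> 2\<close> and a member of \<open>F\<close>
      forces \<open>n \<ge> 4\<close>.\<close>
    have "card E * m ^ (n - 2) * m ^ 4 \<le> (3 * (n * m ^ (n - 1)) + card F * m ^ (n - 4)) * m ^ 4"
      using main by simp
    also have "\<dots> = 3 * n * m ^ 3 * m ^ n + card F * (m ^ (n - 4) * m ^ 4)"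
    proof -
      have "m ^ (n - 1) * m ^ 4 = m ^ 3 * m ^ n" using n2 by (simp flip: power_add)
      then show ?thesis by (simp add: algebra_simps)
    qed
    also have "card F * (m ^ (n - 4) * m ^ 4) = card F * m ^ n"
    proof (cases "F = {}")
      case False
      then obtain e where "e \<in> F" by auto
      then have "n \<ge> 4" using F card_mono[OF fin(1), of "corners e"] by (auto simp: n_def)
      then show ?thesis by (simp flip: power_add)
    qed simp
    finally have "card E * m ^ (n - 2) * m ^ 4 \<le> (3 * n * m ^ 3 + card F) * m ^ n" by (simp add: algebra_simps)
    moreover have "m ^ (n - 2) * m ^ 4 = m ^ 2 * m ^ n" using n2 by (simp flip: power_add)
    ultimately have "(card E * m ^ 2) * m ^ n \<le> (3 * n * m ^ 3 + card F) * m ^ n" by (simp add: algebra_simps)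
    then show ?thesis using m by (simp add: n_def)
  qed simp
qed

text \<open>Ordered pairs, so every geometric crossing occurs twice; this fits the later comparison
  with \<open>L \<times> L\<close>.\<close>

definition crossings :: "('v \<Rightarrow> real) \<Rightarrow> ('v \<Rightarrow> real) \<Rightarrow> ('v \<times> 'v) set \<Rightarrow> (('v \<times> 'v) \<times> ('v \<times> 'v)) set" where
  "crossings X Y E = {(e, e') \<in> E \<times> E. e \<noteq> e' \<and>
     (\<exists>x. X (fst e) < x \<and> X (fst e') < x \<and> x < X (snd e) \<and> x < X (snd e') \<and> height X Y e x = height X Y e' x)}"

text \<open>Removing every edge that takes part in a crossing leaves a plane graph.\<close>

lemma edges_le_crossings:
  fixes X Y :: "'v \<Rightarrow> real"
  assumes "finite V" "inj_on X V"
    and EV: "\<And>e. e \<in> E \<Longrightarrow> fst e \<in> V \<and> snd e \<in> V \<and> X (fst e) < X (snd e)"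
    and nv: "\<And>e z. \<lbrakk>e \<in> E; z \<in> V; X (fst e) < X z; X z < X (snd e)\<rbrakk> \<Longrightarrow> Y z \<noteq> height X Y e (X z)"
  shows "card E \<le> 3 * card V + card (crossings X Y E)"
proof -
  let ?E = "E - fst ` crossings X Y E"
  have "E \<subseteq> V \<times> V" using EV by (auto simp: mem_Times_iff)
  then have fE: "finite E" using assms(1) finite_subset by blast
  interpret plane_graph V X Y ?E
  proof
    fix e e' x assume *: "e \<in> ?E" "e' \<in> ?E" "e \<noteq> e'" "X (fst e) < x" "X (fst e') < x" "x < X (snd e)" "x < X (snd e')"
    show "height X Y e x \<noteq> height X Y e' x"
    proof
      assume "height X Y e x = height X Y e' x"
      then have "(e, e') \<in> crossings X Y E" using * by (auto simp: crossings_def)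
      then have "e \<in> fst ` crossings X Y E" by force
      then show False using * by auto
    qed
  qed (use assms in auto)
  have "finite (crossings X Y E)"
    by (rule finite_subset[of _ "E \<times> E"]) (use fE in \<open>auto simp: crossings_def\<close>)
  then have "card (fst ` crossings X Y E) \<le> card (crossings X Y E)" by (rule card_image_le)
  moreover have "card E - card (fst ` crossings X Y E) \<le> card ?E"
    using \<open>finite (crossings X Y E)\<close> by (intro diff_card_le_card_Diff finite_imageI)
  ultimately show ?thesis using edges_le by linarith
qed

text \<open>A sampled vertex set keeps an edge with probability \<open>m ^ -2\<close> and a crossing
  with \<open>m ^ -4\<close>, as disjointness gives a crossing four distinct corners. The parameter
  \<open>m\<close> stays free instead of being optimised here.\<close>

lemma crossing_inequality:
  fixes X Y :: "'v \<Rightarrow> real"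
  assumes fin: "finite V" and inj: "inj_on X V" and m: "m > 0"
    and EV: "\<And>e. e \<in> E \<Longrightarrow> fst e \<in> V \<and> snd e \<in> V \<and> X (fst e) < X (snd e)"
    and nv: "\<And>e z. \<lbrakk>e \<in> E; z \<in> V; X (fst e) < X z; X z < X (snd e)\<rbrakk> \<Longrightarrow> Y z \<noteq> height X Y e (X z)"
    and disj: "\<And>e e'. (e, e') \<in> crossings X Y E \<Longrightarrow> {fst e, snd e} \<inter> {fst e', snd e'} = {}"
  shows "card E * m ^ 2 \<le> 3 * card V * m ^ 3 + card (crossings X Y E)"
proof (rule sampling_inequality[OF fin _ _ m])
  have "E \<subseteq> V \<times> V" using EV by (auto simp: mem_Times_iff)
  then show fE: "finite E" using fin finite_subset by blast
  show "finite (crossings X Y E)"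
    by (rule finite_subset[of _ "E \<times> E"]) (use fE in \<open>auto simp: crossings_def\<close>)
  show "{fst e, snd e} \<subseteq> V \<and> card {fst e, snd e} = 2" if "e \<in> E" for e
    using EV[OF that] by (auto simp: card_insert_if)
  show "(\<lambda>(e, e'). {fst e, snd e} \<union> {fst e', snd e'}) c \<subseteq> V \<and>
      card ((\<lambda>(e, e'). {fst e, snd e} \<union> {fst e', snd e'}) c) = 4" if "c \<in> crossings X Y E" for c
  proof -
    obtain e e' where c: "c = (e, e')" by (cases c)
    then have e: "e \<in> E" "e' \<in> E" using that by (auto simp: crossings_def)
    have "card {fst e, snd e} = 2" "card {fst e', snd e'} = 2"
      using EV[OF e(1)] EV[OF e(2)] by (auto simp: card_insert_if)
    then have "card ({fst e, snd e} \<union> {fst e', snd e'}) = 4"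
      using disj[of e e'] that c by (subst card_Un_disjoint) auto
    then show ?thesis using c EV[OF e(1)] EV[OF e(2)] by simp
  qed
  fix W assume W: "W \<subseteq> V"
  let ?E = "{e \<in> E. {fst e, snd e} \<subseteq> W}"
  have "card ?E \<le> 3 * card W + card (crossings X Y ?E)"
    by (rule edges_le_crossings) (use W fin inj EV nv in \<open>auto intro: finite_subset inj_on_subset\<close>)
  also have "crossings X Y ?E = {c \<in> crossings X Y E. (\<lambda>(e, e'). {fst e, snd e} \<union> {fst e', snd e'}) c \<subseteq> W}"
    by (auto simp: crossings_def)
  finally show "card ?E \<le> 3 * card W + card {c \<in> crossings X Y E. (\<lambda>(e, e'). {fst e, snd e} \<union> {fst e', snd e'}) c \<subseteq> W}" .
qed

section \<open>Incidences of points and lines\<close>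

definition on_line :: "('v \<Rightarrow> real) \<Rightarrow> ('v \<Rightarrow> real) \<Rightarrow> 'v set \<Rightarrow> real \<times> real \<Rightarrow> 'v set" where
  "on_line X Y P l = {p \<in> P. Y p = fst l * X p + snd l}"

definition consecutive :: "('v \<Rightarrow> real) \<Rightarrow> 'v set \<Rightarrow> ('v \<times> 'v) set" where
  "consecutive X A = {(v, w). v \<in> A \<and> w \<in> A \<and> X v < X w \<and> (\<forall>z\<in>A. \<not> (X v < X z \<and> X z < X w))}"

lemma card_consecutive:
  assumes "finite A" "inj_on X A"
  shows "card A \<le> card (consecutive X A) + 1"
proof (cases "A = {}")
  case False
  define s where "s v = (SOME w. (v, w) \<in> consecutive X A)" for v
  obtain t where t: "t \<in> A" "X t = Max (X ` A)"
    using Max_in[of "X ` A"] assms False by (metis (no_types, lifting) finite_imageI image_iff image_is_empty)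
  have s: "(v, s v) \<in> consecutive X A" if v: "v \<in> A - {t}" for v
  proof -
    define B where "B = {w \<in> A. X v < X w}"
    have "X v \<le> X t" using v t assms by simp
    moreover have "X v \<noteq> X t" using v t inj_onD[OF assms(2), of v t] by auto
    ultimately have "t \<in> B" using t by (simp add: B_def)
    then have "Min (X ` B) \<in> X ` B" using assms by (intro Min_in) (auto simp: B_def)
    then obtain w where w: "w \<in> B" "X w = Min (X ` B)" by auto
    have "X w \<le> X z" if "z \<in> B" for z using that assms w by (simp add: B_def)
    then have "(v, w) \<in> consecutive X A" using v w by (force simp: consecutive_def B_def)
    then show ?thesis unfolding s_def by (rule someI)
  qed
  have "card (A - {t}) \<le> card (consecutive X A)"
  proof (rule card_inj_on_le[of "\<lambda>v. (v, s v)"])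
    show "finite (consecutive X A)"
      by (rule finite_subset[of _ "A \<times> A"]) (use assms in \<open>auto simp: consecutive_def\<close>)
  qed (use s in \<open>auto simp: inj_on_def\<close>)
  then show ?thesis using assms t by simp
qed simp

text \<open>Szekely's argument. Joining consecutive points on each line gives a graph whose edges
  number at least the incidences minus \<open>card L\<close>, and two distinct lines account for at
  most one crossing.\<close>

theorem szemeredi_trotter:
  fixes X Y :: "'v \<Rightarrow> real"
  assumes finP: "finite P" and inj: "inj_on X P" and finL: "finite L" and m: "m > 0"
  shows "(\<Sum>l\<in>L. card (on_line X Y P l)) * m ^ 2 \<le> card L * m ^ 2 + 3 * card P * m ^ 3 + (card L) ^ 2"
proof -
  let ?on = "on_line X Y P"
  define E where "E = (\<Union>l\<in>L. consecutive X (?on l))"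
  have meet: "l = l'" if "p \<in> ?on l" "q \<in> ?on l" "p \<in> ?on l'" "q \<in> ?on l'" "X p \<noteq> X q" for l l' p q
  proof -
    have "fst l * (X p - X q) = fst l' * (X p - X q)"
      using that by (simp add: on_line_def algebra_simps)
    then have "fst l = fst l'" using that(5) by simp
    then show ?thesis using that by (auto simp: on_line_def prod_eq_iff)
  qed
  have ht: "height X Y e x = fst l * x + snd l" if "e \<in> consecutive X (?on l)" for e l x
  proof -
    have "X (snd e) - X (fst e) \<noteq> 0" "Y (snd e) - Y (fst e) = fst l * (X (snd e) - X (fst e))" "Y (fst e) = fst l * X (fst e) + snd l"
      using that by (auto simp: consecutive_def on_line_def algebra_simps)
    then have "height X Y e x = (fst l * X (fst e) + snd l) + fst l * (x - X (fst e))" by (simp add: height_def)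
    then show ?thesis by (simp add: algebra_simps)
  qed
  have con: "fst e \<in> ?on l" "snd e \<in> ?on l" "X (fst e) < X (snd e)" "\<And>z. z \<in> ?on l \<Longrightarrow> X (fst e) < X z \<Longrightarrow> X z < X (snd e) \<Longrightarrow> False"
    if "e \<in> consecutive X (?on l)" for e l
    using that by (auto simp: consecutive_def)
  have onP: "?on l \<subseteq> P" for l by (auto simp: on_line_def)
  \<comment> \<open>On one line, at most one consecutive pair spans a given abscissa.\<close>
  have same: "e = e'" if e: "e \<in> consecutive X (?on l)" "e' \<in> consecutive X (?on l)"
    and x: "X (fst e) < x" "X (fst e') < x" "x < X (snd e)" "x < X (snd e')" for e e' l x
  proof -
    note c = con[OF e(1)] and c' = con[OF e(2)]
    have "\<not> X (fst e) < X (fst e')" using c(4)[OF c'(1)] x by (intro notI) linarith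
    moreover have "\<not> X (fst e') < X (fst e)" using c'(4)[OF c(1)] x by (intro notI) linarith
    ultimately have 1: "X (fst e) = X (fst e')" by simp
    have "\<not> X (snd e) < X (snd e')" using c'(4)[OF c(2)] x by (intro notI) linarith
    moreover have "\<not> X (snd e') < X (snd e)" using c(4)[OF c'(2)] x by (intro notI) linarith
    ultimately have 2: "X (snd e) = X (snd e')" by simp
    have "fst e = fst e'" using inj_onD[OF inj 1] c(1) c'(1) onP by blast
    moreover have "snd e = snd e'" using inj_onD[OF inj 2] c(2) c'(2) onP by blast
    ultimately show ?thesis by (simp add: prod_eq_iff)
  qed
  have crossD: "\<exists>l l' x. l \<in> L \<and> l' \<in> L \<and> l \<noteq> l' \<and> e \<in> consecutive X (?on l) \<and> e' \<in> consecutive X (?on l') \<and>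
      X (fst e) < x \<and> X (fst e') < x \<and> x < X (snd e) \<and> x < X (snd e') \<and> fst l * x + snd l = fst l' * x + snd l'"
    if "(e, e') \<in> crossings X Y E" for e e'
  proof -
    obtain x l l' where *: "l \<in> L" "l' \<in> L" "e \<in> consecutive X (?on l)" "e' \<in> consecutive X (?on l')" "e \<noteq> e'"
      "X (fst e) < x" "X (fst e') < x" "x < X (snd e)" "x < X (snd e')" "height X Y e x = height X Y e' x"
      using \<open>(e, e') \<in> crossings X Y E\<close> by (auto simp: crossings_def E_def)
    moreover have "l \<noteq> l'" using same * by blast
    ultimately show ?thesis using ht by metis
  qed
  have lines_meet: "x = y" if "fst l * x + snd l = fst l' * x + snd l'" "fst l * y + snd l = fst l' * y + snd l'" "l \<noteq> l'"
    for x y and l l' :: "real \<times> real"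
  proof (rule ccontr)
    assume "x \<noteq> y"
    have "fst l * (x - y) = fst l' * (x - y)" using that by (simp add: algebra_simps)
    then show False using \<open>x \<noteq> y\<close> that by (auto simp: prod_eq_iff)
  qed
  have finE: "finite E"
    by (rule finite_subset[of _ "P \<times> P"]) (use finP onP in \<open>force simp: E_def consecutive_def\<close>)+
  have "card E * m ^ 2 \<le> 3 * card P * m ^ 3 + card (crossings X Y E)"
  proof (rule crossing_inequality[OF finP inj m])
    show "fst e \<in> P \<and> snd e \<in> P \<and> X (fst e) < X (snd e)" if "e \<in> E" for e
      using that onP by (force simp: E_def consecutive_def)
    show "Y z \<noteq> height X Y e (X z)" if e: "e \<in> E" and z: "z \<in> P" "X (fst e) < X z" "X z < X (snd e)" for e z
    proof
      assume a: "Y z = height X Y e (X z)"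
      obtain l where l: "e \<in> consecutive X (?on l)" using e unfolding E_def by blast
      then have "z \<in> ?on l" using ht[OF l] a z by (simp add: on_line_def)
      then show False using con(4)[OF l] z by blast
    qed
    fix e e' assume "(e, e') \<in> crossings X Y E"
    then obtain l l' x where *: "l \<noteq> l'" "e \<in> consecutive X (?on l)" "e' \<in> consecutive X (?on l')"
      "X (fst e) < x" "X (fst e') < x" "x < X (snd e)" "x < X (snd e')" "fst l * x + snd l = fst l' * x + snd l'"
      using crossD by blast
    have "X p = x" if "p \<in> ?on l" "p \<in> ?on l'" for p
      by (rule lines_meet[OF _ *(8,1)]) (use that in \<open>auto simp: on_line_def\<close>)
    moreover have "X p \<noteq> x" if "p \<in> {fst e, snd e}" for p using that *(4-7) by auto
    moreover have "p \<in> ?on l" if "p \<in> {fst e, snd e}" for p using that con(1,2)[OF *(2)] by blast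
    moreover have "p \<in> ?on l'" if "p \<in> {fst e', snd e'}" for p using that con(1,2)[OF *(3)] by blast
    ultimately show "{fst e, snd e} \<inter> {fst e', snd e'} = {}" by (meson disjoint_iff)
  qed
  \<comment> \<open>A crossing is recovered from its pair of lines: the lines fix the abscissa where
    they meet, and the abscissa fixes the edge on each line.\<close>
  moreover have "card (crossings X Y E) \<le> card (L \<times> L)"
  proof -
    define cr where "cr c k x \<longleftrightarrow> fst k \<in> L \<and> snd k \<in> L \<and> fst k \<noteq> snd k \<and>
      fst c \<in> consecutive X (?on (fst k)) \<and> snd c \<in> consecutive X (?on (snd k)) \<and>
      X (fst (fst c)) < x \<and> X (fst (snd c)) < x \<and> x < X (snd (fst c)) \<and> x < X (snd (snd c)) \<and>
      fst (fst k) * x + snd (fst k) = fst (snd k) * x + snd (snd k)" for c k x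
    have "\<exists>k x. cr c k x" if "c \<in> crossings X Y E" for c
      using crossD[of "fst c" "snd c"] that unfolding cr_def by (metis fst_conv snd_conv prod.collapse)
    then obtain g h where g: "\<And>c. c \<in> crossings X Y E \<Longrightarrow> cr c (g c) (h c)" by metis
    have "inj_on g (crossings X Y E)"
    proof (rule inj_onI)
      fix c d assume "c \<in> crossings X Y E" "d \<in> crossings X Y E" and eq: "g c = g d"
      then have c: "cr c (g c) (h c)" and d: "cr d (g c) (h d)" using g[of c] g[of d] by simp_all
      have "h c = h d"
        by (rule lines_meet[of "fst (g c)" _ "snd (g c)"]) (use c d in \<open>simp_all add: cr_def\<close>)
      then have d: "cr d (g c) (h c)" using d by simp
      have "fst c = fst d" by (rule same[of _ "fst (g c)" _ "h c"]) (use c d in \<open>simp_all add: cr_def\<close>)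
      moreover have "snd c = snd d" by (rule same[of _ "snd (g c)" _ "h c"]) (use c d in \<open>simp_all add: cr_def\<close>)
      ultimately show "c = d" by (simp add: prod_eq_iff)
    qed
    moreover have "g ` crossings X Y E \<subseteq> L \<times> L"
    proof
      fix k assume "k \<in> g ` crossings X Y E"
      then obtain c where "c \<in> crossings X Y E" "k = g c" by blast
      then show "k \<in> L \<times> L" using g[of c] by (simp add: cr_def mem_Times_iff)
    qed
    ultimately show ?thesis using finL by (intro card_inj_on_le) auto
  qed
  ultimately have 1: "card E * m ^ 2 \<le> 3 * card P * m ^ 3 + (card L) ^ 2"
    by (simp add: card_cartesian_product power2_eq_square)
  have "card E = (\<Sum>l\<in>L. card (consecutive X (?on l)))"
    unfolding E_def
  proof (rule card_UN_disjoint[OF finL])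
    show "\<forall>l\<in>L. finite (consecutive X (?on l))"
      using finE finL by (auto simp: E_def)
    show "\<forall>l\<in>L. \<forall>l'\<in>L. l \<noteq> l' \<longrightarrow> consecutive X (?on l) \<inter> consecutive X (?on l') = {}"
    proof (intro ballI impI, rule ccontr)
      fix l l' assume "l \<noteq> l'" "consecutive X (?on l) \<inter> consecutive X (?on l') \<noteq> {}"
      then obtain e where "e \<in> consecutive X (?on l)" "e \<in> consecutive X (?on l')" by auto
      then show False using con(1-3) meet[of "fst e" l "snd e" l'] \<open>l \<noteq> l'\<close> by (metis less_irrefl)
    qed
  qed
  then have "(\<Sum>l\<in>L. card (?on l)) \<le> card E + card L"
  proof -
    have "(\<Sum>l\<in>L. card (?on l)) \<le> (\<Sum>l\<in>L. card (consecutive X (?on l)) + 1)"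
      by (intro sum_mono card_consecutive) (use finP onP inj in \<open>auto intro: finite_subset inj_on_subset\<close>)
    also have "\<dots> = card E + card L" unfolding \<open>card E = _\<close> by (subst sum.distrib) simp
    finally show ?thesis .
  qed
  then have "(\<Sum>l\<in>L. card (?on l)) * m ^ 2 \<le> (card E + card L) * m ^ 2" by simp
  then show ?thesis using 1 by (simp add: algebra_simps)
qed

section \<open>Lines of the integer lattice\<close>

definition line :: "int \<times> int \<Rightarrow> int \<times> int \<Rightarrow> (int \<times> int) set" where
  "line x y = {z. (fst y - fst x) * (snd z - snd x) = (snd y - snd x) * (fst z - fst x)}"

text \<open>A line is the set of its lattice points and contains two of them, so equality of lines
  is equality of sets.\<close>

definition lines :: "(int \<times> int) set set" where
  "lines = {line x y | x y. x \<noteq> y}"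

lemma in_line [simp]: "x \<in> line x y" "y \<in> line x y"
  by (auto simp: line_def algebra_simps)

lemma line_in_lines [simp]: "x \<noteq> y \<Longrightarrow> line x y \<in> lines"
  unfolding lines_def by blast

lemma parallel_trans:
  fixes a1 a2 b1 b2 c1 c2 :: int
  assumes "a1 * b2 = a2 * b1" "a1 * c2 = a2 * c1" "(a1, a2) \<noteq> (0, 0)"
  shows "b1 * c2 = b2 * c1"
proof -
  have "a1 * (b1 * c2) = a1 * (b2 * c1)" "a2 * (b1 * c2) = a2 * (b2 * c1)"
    using assms(1,2) by algebra+
  then show ?thesis using assms(3) by auto
qed

lemma line_subset:
  assumes "u \<in> line x y" "v \<in> line x y" "x \<noteq> y" "w \<in> line x y"
  shows "w \<in> line u v"
proof -
  have nz: "(fst y - fst x, snd y - snd x) \<noteq> (0, 0)" using assms(3) by (auto simp: prod_eq_iff)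
  have 1: "(fst y - fst x) * (snd v - snd u) = (snd y - snd x) * (fst v - fst u)"
    using assms(1,2) by (simp add: line_def algebra_simps)
  have 2: "(fst y - fst x) * (snd w - snd u) = (snd y - snd x) * (fst w - fst u)"
    using assms(1,4) by (simp add: line_def algebra_simps)
  show ?thesis using parallel_trans[OF 1 2 nz] by (simp add: line_def)
qed

lemma line_unique:
  assumes "l \<in> lines" "u \<in> l" "v \<in> l" "u \<noteq> v"
  shows "l = line u v"
proof -
  obtain x y where l: "l = line x y" "x \<noteq> y" using assms unfolding lines_def by blast
  have "x \<in> line u v" "y \<in> line u v" using line_subset[of u x y v x] line_subset[of u x y v y] l assms(2,3) by simp_all
  then have "line u v \<subseteq> l" using line_subset[of x u v y] assms(4) l by blast
  moreover have "l \<subseteq> line u v" using line_subset[of u x y v] l assms by blast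
  ultimately show ?thesis by blast
qed

lemma ex_irrational: "\<exists>x::real. x \<notin> \<rat>"
  using uncountable_UNIV_real countable_rat by (metis UNIV_eq_I)

text \<open>A projection along an irrational direction separates all integer points and makes no integer
  line vertical.\<close>

theorem szemeredi_trotter_int:
  assumes finP: "finite P" and finL: "finite L" and L: "L \<subseteq> lines" and m: "m > 0"
  shows "(\<Sum>l\<in>L. card (P \<inter> l)) * m ^ 2 \<le> card L * m ^ 2 + 3 * card P * m ^ 3 + (card L) ^ 2"
proof -
  obtain \<theta> :: real where \<theta>: "\<theta> \<notin> \<rat>" using ex_irrational by blast
  have indep: "i = 0 \<and> j = 0" if "of_int i + \<theta> * of_int j = 0" for i j :: int
  proof (cases "j = 0")
    case False
    then have "\<theta> = of_int (- i) / of_int j" using that by (simp add: field_simps)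
    then show ?thesis using \<theta> by (metis Rats_divide Rats_of_int)
  qed (use that in auto)
  define X Y :: "int \<times> int \<Rightarrow> real" where "X z = of_int (fst z) + \<theta> * of_int (snd z)"
    and "Y z = of_int (snd z)" for z
  have inj: "inj X"
  proof (rule injI)
    fix z w assume "X z = X w"
    then have "of_int (fst z - fst w) + \<theta> * of_int (snd z - snd w) = 0" by (simp add: X_def algebra_simps)
    from indep[OF this] show "z = w" by (simp add: prod_eq_iff)
  qed
  have "\<exists>k. l = {z. Y z = fst k * X z + snd k}" if l: "l \<in> lines" for l
  proof -
    obtain x y where xy: "l = line x y" "x \<noteq> y" using l unfolding lines_def by blast
    define d where "d = X y - X x"
    define s where "s = (Y y - Y x) / d"
    have d0: "d \<noteq> 0" using injD[OF inj, of y x] xy(2) by (auto simp: d_def)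
    have "z \<in> line x y \<longleftrightarrow> Y z = s * X z + (Y x - s * X x)" for z
    proof -
      have "Y z = s * X z + (Y x - s * X x) \<longleftrightarrow> Y z - Y x = s * (X z - X x)" by (auto simp: algebra_simps)
      also have "s * (X z - X x) = (Y y - Y x) * (X z - X x) / d" by (simp add: s_def)
      also have "Y z - Y x = (Y y - Y x) * (X z - X x) / d \<longleftrightarrow> (Y z - Y x) * d = (Y y - Y x) * (X z - X x)"
        using d0 by (simp add: eq_divide_eq)
      also have "\<dots> \<longleftrightarrow> real_of_int ((fst y - fst x) * (snd z - snd x)) = of_int ((snd y - snd x) * (fst z - fst x))"
        by (simp add: d_def X_def Y_def algebra_simps)
      also have "\<dots> \<longleftrightarrow> z \<in> line x y" unfolding of_int_eq_iff by (simp add: line_def)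
      finally show ?thesis by simp
    qed
    then show ?thesis using xy by (intro exI[of _ "(s, Y x - s * X x)"]) auto
  qed
  then obtain k where k: "\<And>l. l \<in> lines \<Longrightarrow> l = {z. Y z = fst (k l) * X z + snd (k l)}" by metis
  have injk: "inj_on k L"
  proof (rule inj_onI)
    fix l l' assume l: "l \<in> L" "l' \<in> L" "k l = k l'"
    have "l = {z. Y z = fst (k l) * X z + snd (k l)}" using k l L by blast
    also have "\<dots> = {z. Y z = fst (k l') * X z + snd (k l')}" using l by simp
    also have "\<dots> = l'" using k[of l'] l L by blast
    finally show "l = l'" .
  qed
  have "(\<Sum>l\<in>k ` L. card (on_line X Y P l)) * m ^ 2 \<le> card (k ` L) * m ^ 2 + 3 * card P * m ^ 3 + (card (k ` L)) ^ 2"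
    using finP finL m inj by (intro szemeredi_trotter) (auto intro: inj_on_subset)
  moreover have "(\<Sum>l\<in>k ` L. card (on_line X Y P l)) = (\<Sum>l\<in>L. card (P \<inter> l))"
  proof (subst sum.reindex[OF injk], rule sum.cong[OF refl])
    fix l assume "l \<in> L"
    then have "l = {z. Y z = fst (k l) * X z + snd (k l)}" using k L by blast
    then have "P \<inter> l = on_line X Y P (k l)" unfolding on_line_def by blast
    then show "((\<lambda>l. card (on_line X Y P l)) \<circ> k) l = card (P \<inter> l)" by simp
  qed
  ultimately show ?thesis using injk by (simp add: card_image)
qed

section \<open>Counting rich lines\<close>

definition rich_lines :: "(int \<times> int) set \<Rightarrow> nat \<Rightarrow> (int \<times> int) set set" where
  "rich_lines U u = {l \<in> lines. u \<le> card (U \<inter> l)}"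

lemma two_points:
  assumes "card A \<ge> 2" shows "\<exists>x\<in>A. \<exists>y\<in>A. x \<noteq> y"
proof -
  have "finite A" using assms by (metis card.infinite not_numeral_le_zero)
  then show ?thesis using assms card_le_Suc0_iff_eq[of A] by (auto simp: numeral_2_eq_2 not_less_eq_eq)
qed

lemma rich_lines_subset:
  assumes "u \<ge> 2"
  shows "rich_lines U u \<subseteq> (\<lambda>(x, y). line x y) ` (U \<times> U)"
proof
  fix l assume l: "l \<in> rich_lines U u"
  then have "card (U \<inter> l) \<ge> 2" using assms by (simp add: rich_lines_def)
  then obtain x y where "x \<in> U \<inter> l" "y \<in> U \<inter> l" "x \<noteq> y" using two_points by meson
  moreover from this have "l = line x y" using l line_unique by (auto simp: rich_lines_def)
  ultimately show "l \<in> (\<lambda>(x, y). line x y) ` (U \<times> U)" by blast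
qed

lemma finite_rich_lines: "\<lbrakk>finite U; u \<ge> 2\<rbrakk> \<Longrightarrow> finite (rich_lines U u)"
  using rich_lines_subset finite_subset by (metis finite_SigmaI finite_imageI)

lemma card_rich_lines_trivial:
  assumes "finite U" "u \<ge> 2" shows "card (rich_lines U u) \<le> (card U)\<^sup>2"
proof -
  have "card (rich_lines U u) \<le> card ((\<lambda>(x, y). line x y) ` (U \<times> U))"
    using assms rich_lines_subset by (intro card_mono) auto
  also have "\<dots> \<le> card (U \<times> U)" using assms by (intro card_image_le) auto
  finally show ?thesis by (simp add: power2_eq_square card_cartesian_product)
qed

text \<open>The integer parameter is \<open>x\<close> rounded up, which accounts for the factor
  \<open>1 + x\<close> in place of \<open>x\<close>.\<close>

lemma incidence_bound:
  fixes x :: real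
  assumes "finite P" "finite L" "L \<subseteq> lines" "x > 0"
  shows "(\<Sum>l\<in>L. real (card (P \<inter> l))) \<le> card L + 3 * card P * (1 + x) + (card L)\<^sup>2 / x\<^sup>2"
proof -
  define m where "m = nat \<lceil>x\<rceil>"
  have m: "m > 0" "x \<le> real m" "real m \<le> 1 + x" using assms(4) by (auto simp: m_def) linarith+
  define I where "I = (\<Sum>l\<in>L. card (P \<inter> l))"
  have "real (I * m\<^sup>2) \<le> real (card L * m\<^sup>2 + 3 * card P * m ^ 3 + (card L)\<^sup>2)"
    unfolding of_nat_le_iff I_def by (rule szemeredi_trotter_int[OF assms(1-3) m(1)])
  then have "real I * (real m)\<^sup>2 \<le> (card L + 3 * card P * real m + (card L)\<^sup>2 / (real m)\<^sup>2) * (real m)\<^sup>2"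
    using m by (simp add: distrib_right power3_eq_cube power2_eq_square mult.assoc)
  then have "real I \<le> card L + 3 * card P * real m + (card L)\<^sup>2 / (real m)\<^sup>2"
    using m by (subst (asm) mult_le_cancel_right) auto
  also have "\<dots> \<le> card L + 3 * card P * (1 + x) + (card L)\<^sup>2 / x\<^sup>2"
    using m assms(4) by (intro add_mono mult_left_mono divide_left_mono power_mono) auto
  finally show ?thesis by (simp add: I_def)
qed

text \<open>The usual consequence of Szemeredi and Trotter. For \<open>u < 4\<close> counting pairs
  of points suffices. An upper bound \<open>M\<close> replaces the cardinality so that powers of two
  can be inserted.\<close>

lemma card_rich_lines_le:
  assumes fin: "finite U" and u: "u \<ge> 2" and M: "real (card U) \<le> M"
  shows "real (card (rich_lines U u)) \<le> 1536 * (M\<^sup>2 / real u ^ 3 + M / real u)"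
proof -
  define n L where "n = real (card U)" and "L = real (card (rich_lines U u))"
  have n0: "n \<ge> 0" "n \<le> M" using M by (auto simp: n_def)
  have "L \<le> 1536 * (n\<^sup>2 / real u ^ 3 + n / real u)"
  proof (cases "L = 0 \<or> u < 4")
    case True
    then show ?thesis
    proof
      assume u4: "u < 4"
      have "real u ^ 3 \<le> 4 ^ 3" using u4 by (intro power_mono) auto
      then have "n\<^sup>2 * real u ^ 3 \<le> n\<^sup>2 * 1536" by (intro mult_left_mono) auto
      then have "n\<^sup>2 \<le> 1536 * (n\<^sup>2 / real u ^ 3)" using u by (simp add: field_simps)
      moreover have "L \<le> n\<^sup>2" using card_rich_lines_trivial[OF fin u] unfolding L_def n_def
        by (metis of_nat_le_iff of_nat_power)
      moreover have "n / real u \<ge> 0" using n0 by simp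
      ultimately show ?thesis by simp
    qed (use n0 in simp)
  next
    case False
    then have L0: "L > 0" and u4: "u \<ge> 4" by (auto simp: L_def)
    have n1: "n > 0"
    proof -
      obtain l where "l \<in> rich_lines U u" using L0 by (auto simp: L_def card_gt_0_iff)
      then have "U \<noteq> {}" using u by (auto simp: rich_lines_def)
      then show ?thesis using fin by (simp add: n_def card_gt_0_iff)
    qed
    show ?thesis
    proof (cases "u * L \<le> 12 * n")
      case True
      then have "L \<le> 12 * (n / u)" using u by (simp add: field_simps)
      moreover have "n\<^sup>2 / real u ^ 3 \<ge> 0" "n / u \<ge> 0" using n0 by auto
      ultimately show ?thesis unfolding distrib_left by linarith
    next
      case False
      \<comment> \<open>Since \<open>u * L > 12 * n\<close>, here \<open>x > 1 / 2\<close>, and the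
        term of the points is at most \<open>9 * n * x\<close>, three eighths of the incidences.
        With \<open>u \<ge> 4\<close> the term \<open>L\<close> takes another quarter, so the last
        term must carry the remaining three eighths.\<close>
      define x where "x = u * L / (24 * n)"
      have x0: "x > 0" "24 * n * x = u * L" "12 * n * x > 6 * n" using False n1 L0 u by (auto simp: x_def field_simps)
      have "u * L = (\<Sum>l\<in>rich_lines U u. real u)" by (simp add: L_def)
      also have "\<dots> \<le> (\<Sum>l\<in>rich_lines U u. real (card (U \<inter> l)))"
        by (intro sum_mono) (simp add: rich_lines_def)
      also have "\<dots> \<le> L + 3 * n * (1 + x) + L\<^sup>2 / x\<^sup>2"
        using incidence_bound[OF fin finite_rich_lines[OF fin u] _ x0(1)] by (simp add: L_def n_def rich_lines_def)
      also have "3 * n * (1 + x) \<le> 9 * n * x" using x0(3) n1 by (simp add: algebra_simps)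
      also have "9 * n * x = 3 / 8 * (u * L)" by (simp flip: x0(2))
      finally have "u * L \<le> L + 3 / 8 * (u * L) + L\<^sup>2 / x\<^sup>2" by simp
      moreover have "L \<le> u * L / 4" using u4 L0 by simp
      ultimately have "3 / 8 * (u * L) \<le> L\<^sup>2 / x\<^sup>2" by linarith
      then have "3 / 8 * (u * L) * x\<^sup>2 \<le> L\<^sup>2" using x0 by (simp add: field_simps)
      then have "3 / 8 * (u * L) * (u * L)\<^sup>2 \<le> L\<^sup>2 * (24 * n)\<^sup>2"
        using n1 by (simp add: x_def power_divide divide_simps)
      then have "L\<^sup>2 * (3 / 8 * real u ^ 3 * L) \<le> L\<^sup>2 * (576 * n\<^sup>2)"
        by (simp add: power2_eq_square power3_eq_cube algebra_simps)
      then have "3 / 8 * real u ^ 3 * L \<le> 576 * n\<^sup>2" using L0 by (subst (asm) mult_le_cancel_left) auto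
      then have "L \<le> 1536 * (n\<^sup>2 / real u ^ 3)" using u by (simp add: field_simps)
      moreover have "n / u \<ge> 0" using n0 by simp
      ultimately show ?thesis unfolding distrib_left by linarith
    qed
  qed
  also have "\<dots> \<le> 1536 * (M\<^sup>2 / real u ^ 3 + M / real u)"
    using n0 by (intro mult_left_mono add_mono divide_right_mono power_mono) auto
  finally show ?thesis by (simp add: L_def)
qed

section \<open>Points ranked by size\<close>

lemma sum_card_incidences:
  assumes "finite S" "finite L"
  shows "(\<Sum>p\<in>S. card {l \<in> L. p \<in> l}) = (\<Sum>l\<in>L. card (S \<inter> l))"
proof -
  have "(\<Sum>p\<in>S. card {l \<in> L. p \<in> l}) = (\<Sum>p\<in>S. \<Sum>l\<in>L. if p \<in> l then 1 else 0)"
    using assms by (simp add: sum.If_cases Int_def)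
  also have "\<dots> = (\<Sum>l\<in>L. \<Sum>p\<in>S. if p \<in> l then 1 else 0)" by (rule sum.swap)
  also have "\<dots> = (\<Sum>l\<in>L. card (S \<inter> l))" using assms by (simp add: sum.If_cases)
  finally show ?thesis .
qed

text \<open>Each summand is at most \<open>4 * D\<^sup>2 / ((D + n) * (D + n + 1))\<close>, which is
  the increment of \<open>4 * D * n / (D + n)\<close>.\<close>

lemma sum_min_le:
  fixes D :: real
  assumes "D > 0"
  shows "(\<Sum>u=1..n. min 1 (D\<^sup>2 / real u ^ 2)) \<le> 4 * D"
proof -
  have "(\<Sum>u=1..n. min 1 (D\<^sup>2 / real u ^ 2)) \<le> D * (4 * real n / (D + real n))"
  proof (induction n)
    case (Suc n)
    define x where "x = real n"
    have x: "x \<ge> 0" by (simp add: x_def)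
    have "min 1 (D\<^sup>2 / (x + 1)\<^sup>2) \<le> 4 * D\<^sup>2 / (D + (x + 1))\<^sup>2"
    proof (cases "D \<le> x + 1")
      case True
      have "(D + (x + 1))\<^sup>2 \<le> (2 * (x + 1))\<^sup>2" using True assms x by (intro power_mono) auto
      then have "4 * D\<^sup>2 / (2 * (x + 1))\<^sup>2 \<le> 4 * D\<^sup>2 / (D + (x + 1))\<^sup>2"
        using assms x by (intro divide_left_mono) auto
      then show ?thesis unfolding power_mult_distrib by simp
    next
      case False
      have "(D + (x + 1))\<^sup>2 \<le> (2 * D)\<^sup>2" using False assms x by (intro power_mono) auto
      then have "1 \<le> 4 * D\<^sup>2 / (D + (x + 1))\<^sup>2" using assms x by (simp add: field_simps power_mult_distrib)
      then show ?thesis by simp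
    qed
    also have "\<dots> \<le> 4 * D\<^sup>2 / ((D + x) * (D + (x + 1)))"
      unfolding power2_eq_square[of "D + (x + 1)"] using assms x by (intro divide_left_mono mult_right_mono) auto
    also have "\<dots> = D * (4 * (x + 1) / (D + (x + 1))) - D * (4 * x / (D + x))"
      using assms x by (simp add: divide_simps) (simp add: algebra_simps power2_eq_square)
    finally show ?case using Suc by (simp add: x_def add.commute)
  qed simp
  also have "4 * real n / (D + real n) \<le> 4" using assms by (simp add: field_simps)
  finally show ?thesis using assms by (simp add: mult.commute)
qed

lemma sum_inverse_le:
  assumes "real n ^ 2 \<le> 2 ^ i"
  shows "(\<Sum>u=1..n. 1 / real u) \<le> real i + 1"
proof -
  have 1: "(\<Sum>u=1..n. 1 / real u) \<le> ln n + 1" if "n \<ge> 1" for n :: nat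
    using that
  proof (induction n rule: nat_induct_at_least)
    case (Suc n)
    have "ln (real n / (n + 1)) \<le> real n / (n + 1) - 1" using Suc by (intro ln_le_minus_one) auto
    then have "1 / (real n + 1) \<le> ln (real n + 1) - ln n" using Suc by (simp add: ln_div field_simps)
    then show ?case using Suc by (simp add: add.commute)
  qed simp
  show ?thesis
  proof (cases "n = 0")
    case False
    have "2 * ln (real n) = ln (real n ^ 2)" using False by (simp add: ln_realpow)
    also have "\<dots> \<le> ln (2 ^ i)" using assms False by (subst ln_le_cancel_iff) auto
    also have "\<dots> = i * ln 2" by (simp add: ln_realpow)
    also have "\<dots> \<le> real i * 1" using ln_2_less_1 by (intro mult_left_mono) auto
    finally have "ln (real n) \<le> i" using False by (simp add: ln_ge_zero_iff)
    then show ?thesis using 1[of n] False by simp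
  qed simp
qed

lemma real_sq_le_two_power: "(n::nat)\<^sup>2 \<le> 2 ^ i \<Longrightarrow> (real n)\<^sup>2 \<le> 2 ^ i"
  using of_nat_le_iff[of "n\<^sup>2" "2 ^ i", where 'a = real] by simp

lemma two_power_le_real_sq: "2 ^ i < (n::nat)\<^sup>2 \<Longrightarrow> 2 ^ i \<le> (real n)\<^sup>2"
  using of_nat_le_iff[of "2 ^ i" "n\<^sup>2", where 'a = real] by simp

text \<open>\<open>lev\<close> is the dyadic level of a point when the points are listed by decreasing \<open>f\<close>.\<close>

locale ranked =
  fixes P :: "(int \<times> int) set" and lev :: "int \<times> int \<Rightarrow> nat" and f :: "int \<times> int \<Rightarrow> real"
    and \<phi> :: "nat \<Rightarrow> real" and m :: nat and A :: real
  assumes finP: "finite P" and lev_le: "\<And>p. p \<in> P \<Longrightarrow> lev p \<le> m"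
    and f0: "\<And>p. p \<in> P \<Longrightarrow> 0 \<le> f p" and f_le: "\<And>p. p \<in> P \<Longrightarrow> f p \<le> \<phi> (lev p)"
    and phi0: "\<And>i. 0 \<le> \<phi> i" and phi_antimono: "\<And>i j. i \<le> j \<Longrightarrow> \<phi> j \<le> \<phi> i"
    and card_initial: "\<And>i. card {p \<in> P. lev p \<le> i} \<le> 2 * 2 ^ i"
    and sum_phi: "(\<Sum>i\<le>m. 2 ^ i * (\<phi> i)\<^sup>2) \<le> A"
begin

definition U :: "nat \<Rightarrow> (int \<times> int) set" where "U i = {p \<in> P. lev p \<le> i}"
definition S :: "nat \<Rightarrow> (int \<times> int) set" where "S i = {p \<in> P. lev p = i}"

text \<open>Since \<open>U i\<close> has about \<open>2 ^ i\<close> points, the threshold is the square root of its size, above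
  which the bound of Szemeredi and Trotter for the number of rich lines becomes linear in the richness.\<close>

definition rich :: "int \<times> int \<Rightarrow> (int \<times> int) set \<Rightarrow> bool" where
  "rich p l \<longleftrightarrow> 2 ^ lev p < (card (U (lev p) \<inter> l))\<^sup>2"

definition R :: "int \<times> int \<Rightarrow> (int \<times> int) set set" where
  "R p = {l \<in> lines. p \<in> l \<and> rich p l}"

lemma finU [simp]: "finite (U i)" and finS [simp]: "finite (S i)"
  using finP by (auto simp: U_def S_def)

lemma cardU: "real (card (U i)) \<le> 2 * 2 ^ i"
  using card_initial[of i] unfolding U_def[symmetric]
  using of_nat_le_iff[of "card (U i)" "2 * 2 ^ i", where 'a = real] by simp

lemma S_subset_U: "S i \<subseteq> U i" by (auto simp: S_def U_def)

lemma cardS: "real (card (S i)) \<le> 2 * 2 ^ i"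
  using cardU[of i] card_mono[OF finU S_subset_U, of i] by linarith

lemma A0: "0 \<le> A"
  using sum_phi by (rule order_trans[rotated]) (auto intro: sum_nonneg)

lemma sum_by_level: "(\<Sum>p\<in>P. g p) = (\<Sum>i\<le>m. \<Sum>p\<in>S i. g p)"
proof -
  have "(\<Sum>i\<le>m. \<Sum>p | p \<in> P \<and> lev p = i. g p) = (\<Sum>p\<in>P. g p)"
    by (rule sum.group) (use finP lev_le in auto)
  then show ?thesis by (simp add: S_def)
qed

lemma rich_two: "rich p l \<Longrightarrow> 2 \<le> card (U (lev p) \<inter> l)"
proof (rule ccontr)
  assume r: "rich p l" and "\<not> 2 \<le> card (U (lev p) \<inter> l)"
  then have "card (U (lev p) \<inter> l) \<le> 1" by simp
  then have "(card (U (lev p) \<inter> l))\<^sup>2 \<le> 1\<^sup>2" by (intro power_mono) auto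
  moreover have "(1::nat) \<le> 2 ^ lev p" by simp
  ultimately show False using r unfolding rich_def one_power2 by linarith
qed

lemma finite_R [simp]: "finite (R p)"
  by (rule finite_subset[OF _ finite_rich_lines[of "U (lev p)" 2]]) (auto simp: R_def rich_lines_def rich_two)

text \<open>On average a point lies on boundedly many lines that are rich for it. The threshold is
  about \<open>s = sqrt (2 ^ i)\<close>, where the number of rich lines is of order
  \<open>s\<close>; a second use of the incidence bound, with parameter 1, then gives order
  \<open>s\<^sup>2 = 2 ^ i\<close>.\<close>

lemma rich_incidences: "(\<Sum>p\<in>S i. real (card (R p))) \<le> 10 ^ 9 * 2 ^ i"
proof -
  \<comment> \<open>For points of level \<open>i\<close>, being rich on a line means that the line
    has at least \<open>u\<close> points of \<open>U i\<close>.\<close>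
  define u where "u = (LEAST u::nat. 2 ^ i < u\<^sup>2)"
  define s where "s = sqrt (2 ^ i)"
  have "(2::nat) ^ i < (2 ^ i + 1)\<^sup>2" by (simp add: power2_eq_square)
  then have u: "2 ^ i < u\<^sup>2" unfolding u_def by (rule LeastI)
  have u_least: "u \<le> v" if "2 ^ i < v\<^sup>2" for v using that unfolding u_def by (rule Least_le)
  have u2: "u \<ge> 2"
  proof (rule ccontr)
    assume "\<not> 2 \<le> u"
    then have "u\<^sup>2 \<le> 1\<^sup>2" by (intro power_mono) auto
    moreover have "(1::nat) \<le> 2 ^ i" by simp
    ultimately show False using u unfolding one_power2 by linarith
  qed
  have s: "s\<^sup>2 = 2 ^ i" "s \<ge> 1" by (auto simp: s_def)
  have "s\<^sup>2 \<le> (real u)\<^sup>2" using two_power_le_real_sq[OF u] by (simp add: s(1))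
  then have su: "s \<le> u" by (rule power2_le_imp_le) simp
  define L where "L = rich_lines (U i) u"
  have finL: "finite L" using u2 by (simp add: L_def finite_rich_lines)
  have "real (card L) \<le> 1536 * ((2 * s\<^sup>2)\<^sup>2 / real u ^ 3 + 2 * s\<^sup>2 / real u)"
    unfolding L_def by (rule card_rich_lines_le) (use u2 cardU[of i] s in auto)
  also have "\<dots> \<le> 1536 * (4 * s + 2 * s)"
  proof (intro mult_left_mono add_mono)
    have u0: "real u > 0" using u2 by simp
    have "s ^ 3 \<le> real u ^ 3" using su s(2) by (intro power_mono) auto
    then have "4 * s * s ^ 3 \<le> 4 * s * real u ^ 3" using s(2) by (intro mult_left_mono) auto
    then show "(2 * s\<^sup>2)\<^sup>2 / real u ^ 3 \<le> 4 * s"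
      using u0 by (simp add: pos_divide_le_eq power2_eq_square power3_eq_cube)
    have "2 * s * s \<le> 2 * s * real u" using su s(2) by (intro mult_left_mono) auto
    then show "2 * s\<^sup>2 / real u \<le> 2 * s" using u0 by (simp add: pos_divide_le_eq power2_eq_square)
  qed simp
  finally have cL: "real (card L) \<le> 9216 * s" by simp
  have "(\<Sum>p\<in>S i. card (R p)) \<le> (\<Sum>p\<in>S i. card {l \<in> L. p \<in> l})"
  proof (intro sum_mono card_mono)
    fix p assume p: "p \<in> S i"
    show "R p \<subseteq> {l \<in> L. p \<in> l}"
      using p u_least by (auto simp: R_def L_def rich_lines_def rich_def S_def)
  qed (use finL in auto)
  also have "\<dots> = (\<Sum>l\<in>L. card (S i \<inter> l))" using finL by (intro sum_card_incidences) auto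
  finally have "(\<Sum>p\<in>S i. real (card (R p))) \<le> (\<Sum>l\<in>L. real (card (S i \<inter> l)))"
    by (metis of_nat_le_iff of_nat_sum)
  also have "\<dots> \<le> real (card L) + 3 * real (card (S i)) * (1 + 1) + (real (card L))\<^sup>2 / 1\<^sup>2"
    using incidence_bound[of "S i" L 1] finL by (auto simp: L_def rich_lines_def)
  also have "\<dots> \<le> 9216 * s\<^sup>2 + 3 * (2 * s\<^sup>2) * (1 + 1) + (9216 * s)\<^sup>2 / 1\<^sup>2"
  proof (intro add_mono divide_right_mono mult_right_mono power_mono)
    have "s * 1 \<le> s * s" using s(2) by (intro mult_left_mono) auto
    then show "real (card L) \<le> 9216 * s\<^sup>2" using cL by (simp only: power2_eq_square)
    show "3 * real (card (S i)) \<le> 3 * (2 * s\<^sup>2)" using cardS[of i] s by simp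
  qed (use cL in auto)
  also have "\<dots> \<le> 10 ^ 9 * 2 ^ i" using s by (simp add: power_mult_distrib)
  finally show ?thesis .
qed

text \<open>Whatever is bounded on average over every level may be summed against the squares of the
  coefficients at the cost of a constant.\<close>

lemma sum_weighted_le:
  assumes "\<And>p. p \<in> P \<Longrightarrow> 0 \<le> g p" and g: "\<And>i. (\<Sum>p\<in>S i. g p) \<le> C * 2 ^ i" and "C \<ge> 0"
  shows "(\<Sum>p\<in>P. (\<phi> (lev p))\<^sup>2 * g p) \<le> C * A"
proof -
  have "(\<Sum>p\<in>P. (\<phi> (lev p))\<^sup>2 * g p) = (\<Sum>i\<le>m. (\<phi> i)\<^sup>2 * (\<Sum>p\<in>S i. g p))"
    unfolding sum_by_level by (intro sum.cong refl) (simp add: sum_distrib_left S_def)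
  also have "\<dots> \<le> (\<Sum>i\<le>m. (\<phi> i)\<^sup>2 * (C * 2 ^ i))" by (intro sum_mono mult_left_mono g) auto
  also have "\<dots> = C * (\<Sum>i\<le>m. 2 ^ i * (\<phi> i)\<^sup>2)" by (simp add: sum_distrib_left mult_ac)
  also have "\<dots> \<le> C * A" using sum_phi assms(3) by (rule mult_left_mono)
  finally show ?thesis .
qed

lemma f_sq_le: "p \<in> P \<Longrightarrow> (f p)\<^sup>2 \<le> (\<phi> (lev p))\<^sup>2"
  using f0 f_le by (intro power_mono) auto

lemma sum_f_sq: "(\<Sum>p\<in>P. (f p)\<^sup>2) \<le> 2 * A"
proof -
  have "(\<Sum>p\<in>P. (f p)\<^sup>2) \<le> (\<Sum>p\<in>P. (\<phi> (lev p))\<^sup>2 * 1)" by (intro sum_mono) (simp add: f_sq_le)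
  also have "\<dots> \<le> 2 * A" by (rule sum_weighted_le) (use cardS in auto)
  finally show ?thesis .
qed

text \<open>Bounds the total coefficient of the poor points on one line, of which level
  \<open>i\<close> contributes at most \<open>sqrt (2 ^ i)\<close>. By the Cauchy-Schwarz inequality
  over the \<open>m + 1\<close> levels its square costs one logarithm.\<close>

definition \<Lambda> :: real where "\<Lambda> = (\<Sum>i\<le>m. \<phi> i * sqrt (2 ^ i))"

lemma Lambda_nonneg: "0 \<le> \<Lambda>" unfolding \<Lambda>_def by (intro sum_nonneg mult_nonneg_nonneg phi0) auto

lemma Lambda_sq: "\<Lambda>\<^sup>2 \<le> real (m + 1) * A"
proof -
  have "\<Lambda>\<^sup>2 \<le> (\<Sum>i\<le>m. (\<phi> i * sqrt (2 ^ i))\<^sup>2) * real (card {..m})"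
    unfolding \<Lambda>_def by (rule sum_squared_le_sum_of_squares)
  also have "(\<Sum>i\<le>m. (\<phi> i * sqrt (2 ^ i))\<^sup>2) = (\<Sum>i\<le>m. 2 ^ i * (\<phi> i)\<^sup>2)"
    by (simp add: power_mult_distrib mult.commute)
  also have "\<dots> * real (card {..m}) \<le> A * real (m + 1)" using sum_phi A0 by (intro mult_mono) auto
  finally show ?thesis by (simp add: mult.commute)
qed

text \<open>Being rich on \<open>l\<close> depends only on the level, so a single poor point of
  level \<open>i\<close> limits the number of all points of \<open>U i\<close> on
  \<open>l\<close>.\<close>

lemma card_poor_level:
  assumes "B \<subseteq> {q \<in> S i. q \<in> l \<and> \<not> rich q l}"
  shows "(card B)\<^sup>2 \<le> 2 ^ i"
proof (cases "B = {}")
  case False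
  then obtain q where q: "q \<in> S i" "\<not> rich q l" using assms by auto
  have "card B \<le> card (U i \<inter> l)" using assms S_subset_U by (intro card_mono) auto
  then have "(card B)\<^sup>2 \<le> (card (U i \<inter> l))\<^sup>2" by (intro power_mono) auto
  moreover have "(card (U i \<inter> l))\<^sup>2 \<le> 2 ^ i" using q by (auto simp: rich_def S_def)
  ultimately show ?thesis by (rule order_trans)
qed simp

lemma poor_sum_le:
  assumes "B \<subseteq> {q \<in> P. q \<in> l \<and> \<not> rich q l}"
  shows "(\<Sum>q\<in>B. f q) \<le> \<Lambda>"
proof -
  define B' where "B' i = {q \<in> B. lev q = i}" for i
  have finB: "finite B" using assms finP finite_subset by fastforce
  have "(\<Sum>q\<in>B. f q) = (\<Sum>i\<le>m. \<Sum>q\<in>B' i. f q)"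
    unfolding B'_def by (rule sum.group[symmetric]) (use finB assms lev_le in auto)
  also have "\<dots> \<le> (\<Sum>i\<le>m. \<phi> i * sqrt (2 ^ i))"
  proof (rule sum_mono)
    fix i
    have "(card (B' i))\<^sup>2 \<le> 2 ^ i" by (rule card_poor_level[of _ i l]) (use assms in \<open>auto simp: B'_def S_def\<close>)
    then have "(real (card (B' i)))\<^sup>2 \<le> 2 ^ i" by (rule real_sq_le_two_power)
    then have c: "real (card (B' i)) \<le> sqrt (2 ^ i)" by (rule real_le_rsqrt)
    have "(\<Sum>q\<in>B' i. f q) \<le> (\<Sum>q\<in>B' i. \<phi> i)"
      by (intro sum_mono) (use assms f_le in \<open>auto simp: B'_def\<close>)
    also have "\<dots> = \<phi> i * real (card (B' i))" by simp
    also have "\<dots> \<le> \<phi> i * sqrt (2 ^ i)" using c phi0 by (rule mult_left_mono)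
    finally show "(\<Sum>q\<in>B' i. f q) \<le> \<phi> i * sqrt (2 ^ i)" .
  qed
  finally show ?thesis by (simp add: \<Lambda>_def)
qed

section \<open>Second moments of points on lines through a given point\<close>

definition pencil :: "int \<times> int \<Rightarrow> (int \<times> int) set set" where
  "pencil q = line q ` (P - {q})"

definition \<tau> :: "nat \<Rightarrow> int \<times> int \<Rightarrow> (int \<times> int) set \<Rightarrow> nat" where
  "\<tau> i q l = card {p \<in> S i. p \<in> l \<and> p \<noteq> q \<and> \<not> rich p l}"

text \<open>Counts ordered pairs of poor points of level \<open>i\<close> on a common line through a
  point of level \<open>j\<close>. Such collinear pairs will dominate the right-angled triangles
  with apex at level \<open>j\<close>.\<close>

definition W :: "nat \<Rightarrow> nat \<Rightarrow> real" where
  "W j i = (\<Sum>q\<in>S j. \<Sum>l\<in>pencil q. (real (\<tau> i q l))\<^sup>2)"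

lemma finite_pencil [simp]: "finite (pencil q)" using finP by (simp add: pencil_def)

lemma pencilD: "l \<in> pencil q \<Longrightarrow> l \<in> lines \<and> q \<in> l" by (auto simp: pencil_def)

lemma pencil_unique: "\<lbrakk>l \<in> pencil q; p \<in> l; p \<noteq> q\<rbrakk> \<Longrightarrow> l = line q p"
  using pencilD line_unique by metis

lemma sum_tau_le: "(\<Sum>l\<in>pencil q. \<tau> i q l) \<le> card (S i)"
proof -
  have "(\<Sum>l\<in>pencil q. \<tau> i q l) = card (\<Union>l\<in>pencil q. {p \<in> S i. p \<in> l \<and> p \<noteq> q \<and> \<not> rich p l})"
    unfolding \<tau>_def
  proof (rule card_UN_disjoint[symmetric])
    have "l = l'" if "l \<in> pencil q" "l' \<in> pencil q" "p \<in> l" "p \<in> l'" "p \<noteq> q" for l l' p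
      using pencil_unique that by metis
    then show "\<forall>l\<in>pencil q. \<forall>l'\<in>pencil q. l \<noteq> l' \<longrightarrow>
      {p \<in> S i. p \<in> l \<and> p \<noteq> q \<and> \<not> rich p l} \<inter> {p \<in> S i. p \<in> l' \<and> p \<noteq> q \<and> \<not> rich p l'} = {}"
      by blast
  qed auto
  also have "\<dots> \<le> card (S i)" by (intro card_mono) auto
  finally show ?thesis .
qed

lemma tau_sq_le: "(\<tau> i q l)\<^sup>2 \<le> 2 ^ i"
  unfolding \<tau>_def by (rule card_poor_level[of _ i l]) auto

text \<open>The distribution function of \<open>\<tau>\<close>, from which \<open>W\<close> is
  recovered by summation over \<open>u\<close>.\<close>

definition I :: "nat \<Rightarrow> nat \<Rightarrow> nat \<Rightarrow> nat" where
  "I j i u = (\<Sum>q\<in>S j. card {l \<in> pencil q. u \<le> \<tau> i q l})"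

text \<open>Markov's inequality: for fixed \<open>q\<close> every other point lies on only one line
  of the pencil.\<close>

lemma I_trivial: "real u * real (I j i u) \<le> 4 * (2 ^ i * 2 ^ j)"
proof -
  have "u * I j i u = (\<Sum>q\<in>S j. \<Sum>l | l \<in> pencil q \<and> u \<le> \<tau> i q l. u)"
    by (simp add: I_def sum_distrib_left mult.commute)
  also have "\<dots> \<le> (\<Sum>q\<in>S j. \<Sum>l | l \<in> pencil q \<and> u \<le> \<tau> i q l. \<tau> i q l)"
    by (intro sum_mono) auto
  also have "\<dots> \<le> (\<Sum>q\<in>S j. \<Sum>l\<in>pencil q. \<tau> i q l)"
    by (intro sum_mono sum_mono2) auto
  also have "\<dots> \<le> (\<Sum>q\<in>S j. card (S i))" by (intro sum_mono sum_tau_le)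
  finally have "u * I j i u \<le> card (S j) * card (S i)" by simp
  then have "real (u * I j i u) \<le> real (card (S j) * card (S i))" unfolding of_nat_le_iff .
  also have "\<dots> \<le> (2 * 2 ^ j) * (2 * 2 ^ i)" unfolding of_nat_mult by (intro mult_mono cardS) auto
  finally show ?thesis by (simp add: mult_ac)
qed

text \<open>The lines counted are \<open>u\<close>-rich in \<open>U i\<close>, and
  \<open>u\<^sup>2 \<le> 2 ^ i\<close> makes the cubic term dominate their number. The incidence
  bound is applied with parameter \<open>M * \<kappa> / u\<^sup>2\<close>, \<open>M = 2 ^ i\<close>;
  the choice \<open>\<kappa> ^ 3 * 2 ^ j = M\<close> makes the terms linear in this parameter and
  quadratic in its inverse both of order \<open>M * 2 ^ j * \<kappa> / u\<^sup>2\<close>.\<close>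

lemma I_bound:
  fixes i j u :: nat
  assumes u: "u \<ge> 2" "u\<^sup>2 \<le> 2 ^ i"
  defines "\<kappa> \<equiv> 2 powr ((real i - real j) / 3)"
  shows "real (I j i u) \<le> 12288 * 4 ^ i / real u ^ 3 + 6 * 2 ^ j + 151000000 * (2 ^ i * 2 ^ j) * \<kappa> / (real u)\<^sup>2"
proof -
  define L where "L = rich_lines (U i) u"
  define M :: real where "M = 2 ^ i"
  have finL: "finite L" using u by (simp add: L_def finite_rich_lines)
  have uM: "(real u)\<^sup>2 \<le> M" using u(2) unfolding M_def by (rule real_sq_le_two_power)
  have u0: "real u > 0" and M0: "M > 0" using u by (auto simp: M_def)
  have \<kappa>0: "\<kappa> > 0" by (simp add: \<kappa>_def)
  have "\<kappa> ^ 3 = 2 powr (real i - real j)" unfolding \<kappa>_def by (simp add: powr_power diff_divide_distrib)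
  also have "\<dots> = M / 2 ^ j" by (simp add: powr_diff powr_realpow M_def)
  finally have \<kappa>3: "\<kappa> ^ 3 * 2 ^ j = M" by simp
  have "real (card L) \<le> 1536 * ((2 * M)\<^sup>2 / real u ^ 3 + 2 * M / real u)"
    unfolding L_def by (rule card_rich_lines_le) (use u cardU[of i] in \<open>auto simp: M_def\<close>)
  also have "2 * M / real u \<le> (2 * M)\<^sup>2 / real u ^ 3"
  proof -
    have "2 * M * (real u)\<^sup>2 \<le> 2 * M * (2 * M)" using uM M0 by (intro mult_left_mono) auto
    then have "2 * M * (real u)\<^sup>2 / real u ^ 3 \<le> (2 * M)\<^sup>2 / real u ^ 3"
      using u0 by (intro divide_right_mono) (auto simp: power2_eq_square)
    then show ?thesis using u0 by (simp add: power2_eq_square power3_eq_cube)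
  qed
  finally have cL: "real (card L) \<le> 12288 * M\<^sup>2 / real u ^ 3" by (simp add: power_mult_distrib)
  have "I j i u \<le> (\<Sum>q\<in>S j. card {l \<in> L. q \<in> l})"
    unfolding I_def
  proof (intro sum_mono card_mono)
    fix q assume q: "q \<in> S j"
    show "{l \<in> pencil q. u \<le> \<tau> i q l} \<subseteq> {l \<in> L. q \<in> l}"
    proof clarify
      fix l assume l: "l \<in> pencil q" "u \<le> \<tau> i q l"
      have "\<tau> i q l \<le> card (U i \<inter> l)" unfolding \<tau>_def using S_subset_U by (intro card_mono) auto
      then show "l \<in> L \<and> q \<in> l" using l pencilD by (simp add: L_def rich_lines_def)
    qed
  qed (use finL in auto)
  also have "\<dots> = (\<Sum>l\<in>L. card (S j \<inter> l))" using finL by (intro sum_card_incidences) auto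
  finally have "real (I j i u) \<le> (\<Sum>l\<in>L. real (card (S j \<inter> l)))" by (metis of_nat_le_iff of_nat_sum)
  also have "\<dots> \<le> card L + 3 * card (S j) * (1 + M * \<kappa> / (real u)\<^sup>2) + (card L)\<^sup>2 / (M * \<kappa> / (real u)\<^sup>2)\<^sup>2"
    using finL u0 M0 \<kappa>0 by (intro incidence_bound) (auto simp: L_def rich_lines_def)
  also have "\<dots> \<le> 12288 * M\<^sup>2 / real u ^ 3 + 3 * (2 * 2 ^ j) * (1 + M * \<kappa> / (real u)\<^sup>2)
      + (12288 * M\<^sup>2 / real u ^ 3)\<^sup>2 / (M * \<kappa> / (real u)\<^sup>2)\<^sup>2"
    using cL M0 \<kappa>0 cardS[of j] by (intro add_mono mult_right_mono divide_right_mono power_mono) auto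
  also have "(12288 * M\<^sup>2 / real u ^ 3)\<^sup>2 / (M * \<kappa> / (real u)\<^sup>2)\<^sup>2 = 150994944 * (M\<^sup>2 / \<kappa>\<^sup>2) / (real u)\<^sup>2"
    using u0 M0 \<kappa>0 by (simp add: field_simps power2_eq_square power3_eq_cube)
  also have "M\<^sup>2 / \<kappa>\<^sup>2 = M * 2 ^ j * \<kappa>"
  proof -
    have "M\<^sup>2 = M * (\<kappa> ^ 3 * 2 ^ j)" unfolding \<kappa>3 by (simp add: power2_eq_square)
    then show ?thesis using \<kappa>0 by (simp add: field_simps power2_eq_square power3_eq_cube)
  qed
  finally have "real (I j i u) \<le> 12288 * M\<^sup>2 / real u ^ 3 + 6 * 2 ^ j * (1 + M * \<kappa> / (real u)\<^sup>2) + 150994944 * (M * 2 ^ j * \<kappa>) / (real u)\<^sup>2"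
    by simp
  also have "\<dots> = 12288 * M\<^sup>2 / real u ^ 3 + 6 * 2 ^ j + 150994950 * (M * 2 ^ j * \<kappa> / (real u)\<^sup>2)"
    by (simp add: algebra_simps)
  also have "\<dots> \<le> 12288 * M\<^sup>2 / real u ^ 3 + 6 * 2 ^ j + 151000000 * (M * 2 ^ j * \<kappa> / (real u)\<^sup>2)"
    using M0 \<kappa>0 by (intro add_left_mono mult_right_mono) auto
  also have "M\<^sup>2 = 4 ^ i" by (simp add: M_def power2_eq_square flip: power_mult_distrib)
  finally show ?thesis by (simp add: M_def mult_ac)
qed

text \<open>The sum over \<open>u\<close> of \<open>u * I j i u\<close> is dominated by the smaller of the trivial bound and the
  incidence bound; the harmonic sum in the middle term is where a logarithm appears.\<close>

lemma W_bound:
  defines "\<kappa> i j \<equiv> 2 powr ((real i - real j) / 3)" and "D i j \<equiv> 2 powr ((real i - real j) / 2)"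
  shows "W j i \<le> 302000000 * (2 ^ i * 2 ^ j) * (1 + (real i + 1) * \<kappa> i j + D i j)"
proof -
  define T where "T = {u::nat. 1 \<le> u \<and> u\<^sup>2 \<le> 2 ^ i}"
  define n where "n = Max (insert 0 T)"
  define E :: real where "E = 2 ^ i * 2 ^ j"
  have E0: "E > 0" by (simp add: E_def)
  have "T \<subseteq> {..2 ^ i}"
  proof
    fix u assume "u \<in> T"
    then have "u \<le> u * u" "u * u \<le> 2 ^ i" by (auto simp: T_def power2_eq_square)
    then show "u \<in> {..2 ^ i}" unfolding atMost_iff by (rule order_trans)
  qed
  then have finT: "finite T" using finite_subset by blast
  have n_T: "n = 0 \<or> n \<in> T" unfolding n_def using Max_in[of "insert 0 T"] finT by auto
  then have n2: "n\<^sup>2 \<le> 2 ^ i" by (auto simp: T_def)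
  have T: "T = {1..n}"
  proof
    show "T \<subseteq> {1..n}" using finT by (auto simp: n_def T_def)
    show "{1..n} \<subseteq> T"
    proof
      fix u assume u: "u \<in> {1..n}"
      then have "u\<^sup>2 \<le> n\<^sup>2" by (intro power_mono) auto
      then have "u\<^sup>2 \<le> 2 ^ i" using n2 by (rule order_trans)
      then show "u \<in> T" using u by (simp add: T_def)
    qed
  qed
  have rn2: "(real n)\<^sup>2 \<le> 2 ^ i" using n2 by (rule real_sq_le_two_power)
  \<comment> \<open>The square is the sum of the first odd numbers \<open>2 * u - 1\<close>, rounded
    up to \<open>2 * u\<close>; only \<open>u\<close> in \<open>T\<close> occur because
    \<open>\<tau>\<close> counts poor points.\<close>
  have tau_le: "(real (\<tau> i q l))\<^sup>2 \<le> (\<Sum>u\<in>T. if u \<le> \<tau> i q l then 2 * real u else 0)" for q l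
  proof -
    define t where "t = \<tau> i q l"
    have gauss: "(real k)\<^sup>2 \<le> (\<Sum>u=1..k. 2 * real u)" for k
      by (induction k) (auto simp: power2_eq_square algebra_simps)
    have "{1..t} \<subseteq> T"
    proof
      fix u assume u: "u \<in> {1..t}"
      then have "u\<^sup>2 \<le> t\<^sup>2" by (intro power_mono) auto
      then have "u\<^sup>2 \<le> 2 ^ i" using tau_sq_le[of i q l] unfolding t_def by (rule order_trans)
      then show "u \<in> T" using u by (simp add: T_def)
    qed
    then have "{u \<in> T. u \<le> t} = {1..t}" by (auto simp: T_def)
    then show ?thesis using gauss[of t] finT by (simp add: sum.If_cases t_def Int_def)
  qed
  have "W j i \<le> (\<Sum>q\<in>S j. \<Sum>l\<in>pencil q. \<Sum>u\<in>T. if u \<le> \<tau> i q l then 2 * real u else 0)"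
    unfolding W_def by (intro sum_mono tau_le)
  also have "\<dots> = (\<Sum>q\<in>S j. \<Sum>u\<in>T. \<Sum>l\<in>pencil q. if u \<le> \<tau> i q l then 2 * real u else 0)"
    by (intro sum.cong refl sum.swap)
  also have "\<dots> = (\<Sum>u\<in>T. \<Sum>q\<in>S j. \<Sum>l\<in>pencil q. if u \<le> \<tau> i q l then 2 * real u else 0)"
    by (rule sum.swap)
  also have "\<dots> = (\<Sum>u\<in>T. 2 * (real u * real (I j i u)))"
    by (intro sum.cong refl) (simp add: I_def sum.If_cases sum_distrib_left Int_def mult_ac)
  \<comment> \<open>The cubic term of \<open>I_bound\<close>, times \<open>u\<close>, equals
    \<open>12288 * E * (D i j)\<^sup>2 / u\<^sup>2\<close>. Where this quotient exceeds 1, the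
    trivial bound is used instead; hence the minimum. The value \<open>u = 1\<close>, to which
    \<open>I_bound\<close> does not apply, is paid for separately.\<close>
  also have "\<dots> \<le> (\<Sum>u\<in>T. 2 * (6 * 2 ^ j * real u + 151000000 * E * \<kappa> i j * (1 / real u) +
       12288 * E * min 1 ((D i j)\<^sup>2 / (real u)\<^sup>2) + (if u = 1 then 4 * E else 0)))"
  proof (intro sum_mono mult_left_mono)
    fix u assume u: "u \<in> T"
    have nn: "\<kappa> i j > 0" "D i j > 0" by (auto simp: \<kappa>_def D_def)
    have a: "real u * real (I j i u) \<le> 4 * E" using I_trivial[of u j i] by (simp add: E_def)
    have nonneg: "0 \<le> 6 * 2 ^ j * real u" "0 \<le> 151000000 * E * \<kappa> i j * (1 / real u)"
      "0 \<le> 12288 * E * min 1 ((D i j)\<^sup>2 / (real u)\<^sup>2)" using E0 nn by auto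
    show "real u * real (I j i u) \<le> 6 * 2 ^ j * real u + 151000000 * E * \<kappa> i j * (1 / real u) +
       12288 * E * min 1 ((D i j)\<^sup>2 / (real u)\<^sup>2) + (if u = 1 then 4 * E else 0)"
    proof (cases "u = 1")
      case True
      show ?thesis unfolding if_P[OF True] using a nonneg by linarith
    next
      case False
      then have u2: "u \<ge> 2" "u\<^sup>2 \<le> 2 ^ i" using u by (auto simp: T_def)
      have u0: "real u > 0" using u2 by simp
      have D2: "4 ^ i = E * (D i j)\<^sup>2"
      proof -
        have "(D i j)\<^sup>2 = 2 powr (real i - real j)" unfolding D_def by (simp add: powr_power diff_divide_distrib)
        also have "\<dots> = 2 ^ i / 2 ^ j" by (simp add: powr_diff powr_realpow)
        finally show ?thesis by (simp add: E_def flip: power_mult_distrib)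
      qed
      have "real u * real (I j i u) \<le> real u * (12288 * 4 ^ i / real u ^ 3 + 6 * 2 ^ j + 151000000 * E * \<kappa> i j / (real u)\<^sup>2)"
        using I_bound[OF u2, of j] u0 by (intro mult_left_mono) (auto simp: E_def \<kappa>_def)
      also have "\<dots> = 6 * 2 ^ j * real u + 151000000 * E * \<kappa> i j * (1 / real u) + 12288 * E * ((D i j)\<^sup>2 / (real u)\<^sup>2)"
        using u0 unfolding D2 by (simp add: field_simps power2_eq_square power3_eq_cube)
      finally have b: "real u * real (I j i u) \<le> \<dots>" .
      have "u \<noteq> 1" using False .
      show ?thesis
      proof (cases "1 \<le> (D i j)\<^sup>2 / (real u)\<^sup>2")
        case True
        then have "12288 * E * min 1 ((D i j)\<^sup>2 / (real u)\<^sup>2) = 12288 * E" by (simp add: min_def)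
        then show ?thesis unfolding if_not_P[OF \<open>u \<noteq> 1\<close>] using a nonneg E0 by linarith
      next
        case False
        then show ?thesis using b \<open>u \<noteq> 1\<close> by (simp add: min_def)
      qed
    qed
  qed auto
  also have "\<dots> = 2 * (6 * 2 ^ j * (\<Sum>u\<in>T. real u) + 151000000 * E * \<kappa> i j * (\<Sum>u\<in>T. 1 / real u) +
       12288 * E * (\<Sum>u\<in>T. min 1 ((D i j)\<^sup>2 / (real u)\<^sup>2)) + (\<Sum>u\<in>T. if u = 1 then 4 * E else 0))"
    by (simp only: sum.distrib sum_distrib_left distrib_left mult.assoc)
  also have "\<dots> \<le> 2 * (6 * 2 ^ j * 2 ^ i + 151000000 * E * \<kappa> i j * (real i + 1) + 12288 * E * (4 * D i j) + 4 * E)"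
  proof (intro mult_left_mono add_mono)
    have gauss: "(\<Sum>u=1..k. real u) \<le> (real k)\<^sup>2" for k
      by (induction k) (auto simp: power2_eq_square algebra_simps)
    show "(\<Sum>u\<in>T. real u) \<le> 2 ^ i" using gauss[of n] rn2 unfolding T by linarith
    show "(\<Sum>u\<in>T. 1 / real u) \<le> real i + 1" unfolding T by (rule sum_inverse_le[OF rn2])
    show "(\<Sum>u\<in>T. min 1 ((D i j)\<^sup>2 / (real u)\<^sup>2)) \<le> 4 * D i j" unfolding T by (rule sum_min_le) (simp add: D_def)
    show "(\<Sum>u\<in>T. if u = 1 then 4 * E else 0) \<le> 4 * E" using finT E0 by (simp add: sum.delta)
  qed (use E0 in \<open>auto simp: \<kappa>_def\<close>)
  also have "\<dots> = E * (20 + 302000000 * ((real i + 1) * \<kappa> i j) + 98304 * D i j)"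
    by (simp add: E_def algebra_simps)
  also have "\<dots> \<le> E * (302000000 + 302000000 * ((real i + 1) * \<kappa> i j) + 302000000 * D i j)"
    using E0 by (intro mult_left_mono add_mono mult_right_mono) (auto simp: D_def)
  finally show ?thesis by (simp add: E_def algebra_simps)
qed

end

section \<open>Rectangles\<close>

locale anisotropic =
  fixes a b :: int
  assumes a0: "a \<noteq> 0" and b0: "b \<noteq> 0"
    and aniso: "\<And>x y. a * x\<^sup>2 + b * y\<^sup>2 = 0 \<Longrightarrow> x = 0 \<and> y = 0"
begin

definition perp :: "int \<times> int \<Rightarrow> int \<times> int \<Rightarrow> (int \<times> int) set" where
  "perp x y = {z. a * (fst y - fst x) * (fst z - fst x) + b * (snd y - snd x) * (snd z - snd x) = 0}"

lemma perp_sym: "z \<in> perp x y \<longleftrightarrow> y \<in> perp x z"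
  by (simp add: perp_def mult_ac)

lemma perp_is_line: "perp x y = line x (fst x - b * (snd y - snd x), snd x + a * (fst y - fst x))"
proof (intro set_eqI)
  fix z
  have "z \<in> perp x y \<longleftrightarrow> a * (fst y - fst x) * (fst z - fst x) + b * (snd y - snd x) * (snd z - snd x) = 0"
    by (simp add: perp_def)
  also have "\<dots> \<longleftrightarrow> (- b * (snd y - snd x)) * (snd z - snd x) = (a * (fst y - fst x)) * (fst z - fst x)"
    by (simp add: algebra_simps eq_commute)
  also have "\<dots> \<longleftrightarrow> z \<in> line x (fst x - b * (snd y - snd x), snd x + a * (fst y - fst x))"
    by (simp add: line_def)
  finally show "z \<in> perp x y \<longleftrightarrow> z \<in> line x (fst x - b * (snd y - snd x), snd x + a * (fst y - fst x))" .
qed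

lemma perp_in_lines: "x \<noteq> y \<Longrightarrow> perp x y \<in> lines"
  unfolding perp_is_line by (rule line_in_lines) (use a0 b0 in \<open>auto simp: prod_eq_iff\<close>)

lemma in_perp [simp]: "x \<in> perp x y"
  by (simp add: perp_def)

lemma line_eq_perp: "\<lbrakk>z \<in> perp x y; z \<noteq> x; x \<noteq> y\<rbrakk> \<Longrightarrow> line x z = perp x y"
  using line_unique[OF perp_in_lines] in_perp by metis

lemma perp_eq_perp:
  assumes "line x y = line x z" "x \<noteq> y" "x \<noteq> z"
  shows "perp x y = perp x z"
proof -
  have *: "perp x y \<subseteq> perp x z" if "line x y = line x z" "x \<noteq> y" for y z
  proof
    fix w assume w: "w \<in> perp x y"
    have "z \<in> line x y" using that by simp
    then have 1: "(fst y - fst x) * (snd z - snd x) = (snd y - snd x) * (fst z - fst x)" by (simp add: line_def)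
    have 2: "a * (fst y - fst x) * (fst w - fst x) + b * (snd y - snd x) * (snd w - snd x) = 0" using w by (simp add: perp_def)
    have nz: "(fst y - fst x, snd y - snd x) \<noteq> (0, 0)" using that by (auto simp: prod_eq_iff)
    have 3: "(fst y - fst x) * (- a * (fst w - fst x)) = (snd y - snd x) * (b * (snd w - snd x))"
      using 2 by (simp add: algebra_simps)
    have "(snd z - snd x) * (b * (snd w - snd x)) = (fst z - fst x) * (- a * (fst w - fst x))"
      using parallel_trans[OF 1 3 nz] by (simp add: mult.commute)
    then show "w \<in> perp x z" by (simp add: perp_def algebra_simps)
  qed
  show ?thesis using *[OF assms(1,2)] *[OF assms(1)[symmetric] assms(3)] by blast
qed

text \<open>Taking perpendiculars at \<open>x\<close> is an involution: for any second point
  \<open>w\<close> of \<open>perp x y\<close>, the line through \<open>x\<close> and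
  \<open>y\<close> is \<open>perp x w\<close> again.\<close>

lemma line_eq_line:
  assumes "perp x y = perp x z" "x \<noteq> y" "x \<noteq> z"
  shows "line x y = line x z"
proof -
  define w where "w = (fst x - b * (snd y - snd x), snd x + a * (fst y - fst x))"
  have w: "w \<in> perp x y" by (simp add: perp_def w_def algebra_simps)
  have w': "w \<noteq> x" using assms(2) a0 b0 by (auto simp: w_def prod_eq_iff)
  have "y \<in> perp x w" "z \<in> perp x w"
    using w perp_sym[of w x y] perp_sym[of w x z] assms(1) by simp_all
  then have "line x y = perp x w" "line x z = perp x w"
    using line_eq_perp[of y x w] line_eq_perp[of z x w] w' assms(2,3) by simp_all
  then show ?thesis by simp
qed

text \<open>Both \<open>q\<close> and \<open>q'\<close> are feet of the perpendicular from
  \<open>r\<close> to one line through \<open>p\<close>. Elimination leaves the value of the form at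
  \<open>q' - p\<close> as a factor, and here anisotropy enters: an isotropic line is perpendicular
  to itself.\<close>

lemma foot_unique:
  assumes "q \<in> line p q'" "p \<noteq> q'"
    and "a * (fst q - fst p) * (fst r - fst q) + b * (snd q - snd p) * (snd r - snd q) = 0"
    and "a * (fst q' - fst p) * (fst r - fst q') + b * (snd q' - snd p) * (snd r - snd q') = 0"
    and "p \<noteq> q"
  shows "q = q'"
proof -
  define v1 v2 w1 w2 r1 r2 where "v1 = fst q' - fst p" and "v2 = snd q' - snd p" and "w1 = fst q - fst p" and "w2 = snd q - snd p"
    and "r1 = fst r - fst p" and "r2 = snd r - snd p"
  have par: "v1 * w2 = v2 * w1" using assms(1) by (simp add: line_def v1_def v2_def w1_def w2_def)
  have e1: "a * w1 * (r1 - w1) + b * w2 * (r2 - w2) = 0" using assms(3) by (simp add: w1_def w2_def r1_def r2_def)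
  have e2: "a * v1 * (r1 - v1) + b * v2 * (r2 - v2) = 0" using assms(4) by (simp add: v1_def v2_def r1_def r2_def)
  have nv: "v1 \<noteq> 0 \<or> v2 \<noteq> 0" using assms(2) by (auto simp: v1_def v2_def prod_eq_iff)
  have nw: "w1 \<noteq> 0 \<or> w2 \<noteq> 0" using assms(5) by (auto simp: w1_def w2_def prod_eq_iff)
  have "(v1 - w1) * w1 * (a * v1\<^sup>2 + b * v2\<^sup>2) = 0" "(v1 - w1) * w2 * (a * v1\<^sup>2 + b * v2\<^sup>2) = 0"
       "(v2 - w2) * w1 * (a * v1\<^sup>2 + b * v2\<^sup>2) = 0" "(v2 - w2) * w2 * (a * v1\<^sup>2 + b * v2\<^sup>2) = 0"
    using par e1 e2 by algebra+
  moreover have "a * v1\<^sup>2 + b * v2\<^sup>2 \<noteq> 0" using aniso nv by blast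
  ultimately have "v1 = w1" "v2 = w2" using nw by auto
  then show ?thesis by (simp add: v1_def v2_def w1_def w2_def prod_eq_iff)
qed

end

lemma sum_le_via_injection:
  fixes w :: "'x \<Rightarrow> real"
  assumes "finite Y" "inj_on g X" "g ` X \<subseteq> Y" "\<And>x. x \<in> X \<Longrightarrow> w x \<le> h (g x)" "\<And>y. y \<in> Y \<Longrightarrow> 0 \<le> h y"
  shows "(\<Sum>x\<in>X. w x) \<le> (\<Sum>y\<in>Y. h y)"
proof -
  have "(\<Sum>x\<in>X. w x) \<le> (\<Sum>x\<in>X. h (g x))" by (intro sum_mono assms(4))
  also have "\<dots> = (\<Sum>y\<in>g ` X. h y)" using assms(2) by (simp add: sum.reindex)
  also have "\<dots> \<le> (\<Sum>y\<in>Y. h y)" using assms(1,3,5) by (intro sum_mono2) auto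
  finally show ?thesis .
qed

lemma sum_over_Sigma:
  assumes "finite A" "\<And>x. x \<in> A \<Longrightarrow> finite (B x)"
  shows "(\<Sum>z\<in>Sigma A B. h z) = (\<Sum>x\<in>A. \<Sum>y\<in>B x. h (x, y))"
  using assms by (simp add: sum.Sigma)

lemma line_commute: "line p q = line q p"
  by (auto simp: line_def algebra_simps)

text \<open>Up to the symmetries of the rectangle, either two adjacent corners are rich, or one of the three
  other configurations occurs.\<close>

lemma rectangle_cases:
  fixes i j k l :: nat
  shows "(vp \<and> vq) \<or> (vq \<and> vr) \<or> (vr \<and> vs) \<or> (vs \<and> vp) \<or>
    (\<not> vq \<and> \<not> vs \<and> (vp \<and> i \<le> k \<or> vr \<and> k \<le> i)) \<or>
    (\<not> vp \<and> \<not> vr \<and> (vq \<and> j \<le> l \<or> vs \<and> l \<le> j)) \<or>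
    (vp \<and> \<not> vq \<and> \<not> vr \<and> \<not> vs \<and> (i \<le> j \<or> i \<le> l)) \<or>
    (vq \<and> \<not> vp \<and> \<not> vr \<and> \<not> vs \<and> (j \<le> k \<or> j \<le> i)) \<or>
    (vr \<and> \<not> vp \<and> \<not> vq \<and> \<not> vs \<and> (k \<le> l \<or> k \<le> j)) \<or>
    (vs \<and> \<not> vp \<and> \<not> vq \<and> \<not> vr \<and> (l \<le> i \<or> l \<le> k)) \<or>
    (\<not> vp \<and> \<not> vr \<and> i \<le> l \<and> j \<le> l \<and> k \<le> l) \<or>
    (\<not> vq \<and> \<not> vs \<and> j \<le> i \<and> k \<le> i \<and> l \<le> i) \<or>
    (\<not> vr \<and> \<not> vp \<and> k \<le> j \<and> l \<le> j \<and> i \<le> j) \<or>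
    (\<not> vs \<and> \<not> vq \<and> l \<le> k \<and> i \<le> k \<and> j \<le> k)"
  by (cases vp; cases vq; cases vr; cases vs; simp; arith)

section \<open>Weighted sums over rectangles\<close>

locale rectangle_sum = ranked + anisotropic
begin

text \<open>Corners in cyclic order, with diagonals \<open>p r\<close> and \<open>q s\<close> and no
  degenerate sides; \<open>turn\<close> and \<open>flip\<close> generate the eight
  symmetries.\<close>

definition rects :: "((int \<times> int) \<times> (int \<times> int) \<times> (int \<times> int) \<times> (int \<times> int)) set" where
  "rects = {(p, q, r, s). p \<in> P \<and> q \<in> P \<and> r \<in> P \<and> s \<in> P \<and> p + r = q + s \<and> s \<in> perp p q \<and> p \<noteq> q \<and> p \<noteq> s}"

abbreviation "turn \<equiv> (\<lambda>(p, q, r, s). (q, r, s, p))"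
abbreviation "flip \<equiv> (\<lambda>(p, q, r, s). (p, s, r, q))"

lemma fourth_corner: "p + r = q + s \<Longrightarrow> fst r = fst q + fst s - fst p \<and> snd r = snd q + snd s - snd p" for p q r s :: "int \<times> int"
  by (auto simp: prod_eq_iff)

lemma turn_rects:
  assumes "(p, q, r, s) \<in> rects" shows "(q, r, s, p) \<in> rects"
proof -
  have d: "fst r - fst q = fst s - fst p" "snd r - snd q = snd s - snd p"
    using assms fourth_corner[of p r q s] by (auto simp: rects_def)
  have e: "a * (fst q - fst p) * (fst s - fst p) + b * (snd q - snd p) * (snd s - snd p) = 0"
    using assms by (simp add: rects_def perp_def)
  have "p \<in> perp q r" unfolding perp_def mem_Collect_eq d using e by algebra
  moreover have "q \<noteq> r" using assms by (auto simp: rects_def)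
  ultimately show ?thesis using assms by (auto simp: rects_def add.commute)
qed

lemma flip_rects: "(p, q, r, s) \<in> rects \<Longrightarrow> (p, s, r, q) \<in> rects"
  using perp_sym by (auto simp: rects_def add.commute)

lemma rects_sides:
  assumes "(p, q, r, s) \<in> rects"
  shows "line p s = perp p q" "line q r = perp q p" "r \<in> perp q p" "q \<noteq> r"
proof -
  have "s \<in> perp p q" "s \<noteq> p" "p \<noteq> q" using assms by (auto simp: rects_def)
  then show "line p s = perp p q" by (rule line_eq_perp)
  have "(q, p, s, r) \<in> rects" using flip_rects turn_rects assms by blast
  then show r: "r \<in> perp q p" "q \<noteq> r" by (auto simp: rects_def)
  then show "line q r = perp q p" using \<open>p \<noteq> q\<close> by (intro line_eq_perp) auto
qed

lemma finite_rects [simp]: "finite rects"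
  by (rule finite_subset[of _ "P \<times> P \<times> P \<times> P"]) (use finP in \<open>auto simp: rects_def\<close>)

lemma sum_turn: "(\<Sum>x\<in>rects. F (turn x)) = (\<Sum>x\<in>rects. F x)"
proof (rule sum.reindex_bij_betw)
  have "turn ` rects = rects"
  proof
    show "turn ` rects \<subseteq> rects" using turn_rects by auto
    show "rects \<subseteq> turn ` rects"
    proof
      fix x assume x: "x \<in> rects"
      then obtain p q r s where "x = (p, q, r, s)" by (metis prod_cases4)
      then have "(s, p, q, r) \<in> rects" "x = turn (s, p, q, r)" using x turn_rects by auto
      then show "x \<in> turn ` rects" by blast
    qed
  qed
  then show "bij_betw turn rects rects" by (auto simp: bij_betw_def inj_on_def)
qed

lemma sum_flip: "(\<Sum>x\<in>rects. F (flip x)) = (\<Sum>x\<in>rects. F x)"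
proof (rule sum.reindex_bij_betw)
  have "flip ` rects = rects"
  proof
    show "flip ` rects \<subseteq> rects" using flip_rects by auto
    show "rects \<subseteq> flip ` rects"
    proof
      fix x assume x: "x \<in> rects"
      then obtain p q r s where "x = (p, q, r, s)" by (metis prod_cases4)
      then have "(p, s, r, q) \<in> rects" "x = flip (p, s, r, q)" using x flip_rects by auto
      then show "x \<in> flip ` rects" by blast
    qed
  qed
  then show "bij_betw flip rects rects" by (auto simp: bij_betw_def inj_on_def)
qed

text \<open>The weight of a rectangle is distributed over the four cases of the count: \<open>TA\<close> pays for two
  adjacent rich corners, \<open>TB\<close> and \<open>TC\<close> for a rich corner \<open>p\<close> and two poor ones, with a free corner
  (\<open>r\<close> or \<open>s\<close>) of no smaller level, and \<open>TD\<close> for a corner \<open>s\<close> of maximal level with poor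
  neighbours.\<close>

definition wt where "wt = (\<lambda>(p, q, r, s). f p * f q * f r * f s)"

definition TA where "TA = (\<lambda>(p, q, r, s). if rich p (line p q) then (f p)\<^sup>2 * (f r)\<^sup>2 else 0)"

definition TB where "TB = (\<lambda>(p, q, r, s). if rich p (line p q) \<and> \<not> rich q (line q p) \<and> \<not> rich s (line s p) \<and> lev p \<le> lev r
   then f p * f q * f r * f s else 0)"

definition TC where "TC = (\<lambda>(p, q, r, s). if (rich p (line p q) \<or> rich p (line p s)) \<and> \<not> rich q (line q p) \<and> \<not> rich r (line r q) \<and> lev p \<le> lev s
   then f p * f q * f r * f s else 0)"

definition TD where "TD = (\<lambda>(p, q, r, s). if \<not> rich p (line p q) \<and> \<not> rich r (line r q) \<and> lev p \<le> lev s \<and> lev q \<le> lev s \<and> lev r \<le> lev s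
   then f p * f q * f r * f s else 0)"

text \<open>Opposite corners \<open>p\<close>, \<open>r\<close> and the rich line along the side at
  \<open>p\<close> determine \<open>q\<close> as a foot of a perpendicular, hence the rectangle.
  Since \<open>p\<close> has boundedly many rich lines on average, the sum factorises without a
  logarithm.\<close>

lemma sum_TA: "(\<Sum>x\<in>rects. TA x) \<le> 2 * 10 ^ 9 * A\<^sup>2"
proof -
  define X where "X = {(p, q, r, s) \<in> rects. rich p (line p q)}"
  define Y where "Y = (SIGMA p:P. P \<times> R p)"
  define g :: "(int \<times> int) \<times> (int \<times> int) \<times> (int \<times> int) \<times> (int \<times> int) \<Rightarrow> _" where "g = (\<lambda>(p, q, r, s). (p, r, line p q))"
  define h where "h = (\<lambda>(p, r, l::(int \<times> int) set). (f p)\<^sup>2 * (f r)\<^sup>2)"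
  have "(\<Sum>x\<in>rects. TA x) = (\<Sum>x\<in>X. TA x)"
    by (rule sum.mono_neutral_right) (auto simp: X_def TA_def split: if_splits)
  also have "\<dots> \<le> (\<Sum>y\<in>Y. h y)"
  proof (rule sum_le_via_injection)
    show "finite Y" using finP by (auto simp: Y_def)
    show "g ` X \<subseteq> Y" by (auto simp: X_def Y_def g_def R_def rects_def)
    show "inj_on g X"
    proof (rule inj_onI)
      fix x x' assume x: "x \<in> X" "x' \<in> X" "g x = g x'"
      obtain p q r s p' q' r' s' where xx: "x = (p, q, r, s)" "x' = (p', q', r', s')" by (metis prod_cases4)
      have e: "p' = p" "r' = r" "line p q = line p q'" using x xx by (auto simp: g_def)
      have rs: "(p, q, r, s) \<in> rects" "(p, q', r, s') \<in> rects" using x xx e by (auto simp: X_def)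
      have "q = q'"
      proof (rule foot_unique)
        show "q \<in> line p q'" using e(3) in_line by metis
        show "p \<noteq> q'" "p \<noteq> q" using rs by (auto simp: rects_def)
        show "a * (fst q - fst p) * (fst r - fst q) + b * (snd q - snd p) * (snd r - snd q) = 0"
          using rs(1) fourth_corner[of p r q s] by (auto simp: rects_def perp_def)
        show "a * (fst q' - fst p) * (fst r - fst q') + b * (snd q' - snd p) * (snd r - snd q') = 0"
          using rs(2) fourth_corner[of p r q' s'] by (auto simp: rects_def perp_def)
      qed
      moreover have "s = s'" using rs \<open>q = q'\<close> by (auto simp: rects_def)
      ultimately show "x = x'" using xx e by simp
    qed
  qed (auto simp: h_def g_def X_def TA_def)
  also have "\<dots> = (\<Sum>p\<in>P. \<Sum>r\<in>P. \<Sum>l\<in>R p. (f p)\<^sup>2 * (f r)\<^sup>2)"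
    unfolding Y_def h_def using finP by (simp add: sum_over_Sigma)
  also have "\<dots> = (\<Sum>p\<in>P. (f p)\<^sup>2 * real (card (R p))) * (\<Sum>r\<in>P. (f r)\<^sup>2)"
    unfolding sum_product by (intro sum.cong refl) simp
  also have "\<dots> \<le> (10 ^ 9 * A) * (2 * A)"
  proof (intro mult_mono sum_f_sq)
    have "(\<Sum>p\<in>P. (f p)\<^sup>2 * real (card (R p))) \<le> (\<Sum>p\<in>P. (\<phi> (lev p))\<^sup>2 * real (card (R p)))"
      by (intro sum_mono mult_right_mono f_sq_le) auto
    also have "\<dots> \<le> 10 ^ 9 * A" using rich_incidences by (intro sum_weighted_le) auto
    finally show "(\<Sum>p\<in>P. (f p)\<^sup>2 * real (card (R p))) \<le> 10 ^ 9 * A" .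
  qed (use A0 in \<open>auto intro: sum_nonneg\<close>)
  finally show ?thesis by (simp add: power2_eq_square)
qed

text \<open>Grouping by the rich line through \<open>p\<close> leaves at most
  \<open>\<Lambda>\<close> for the poor points on each.\<close>

lemma rich_poor_sum:
  assumes "B \<subseteq> {q \<in> P. q \<noteq> p \<and> rich p (line p q) \<and> \<not> rich q (line p q)}"
  shows "(\<Sum>q\<in>B. f q) \<le> card (R p) * \<Lambda>"
proof -
  have finB: "finite B" using assms finP finite_subset by fastforce
  have "(\<Sum>q\<in>B. f q) = (\<Sum>l\<in>R p. \<Sum>q | q \<in> B \<and> line p q = l. f q)"
  proof (rule sum.group[symmetric])
    show "line p ` B \<subseteq> R p" using assms by (auto simp: R_def)
  qed (use finB in auto)
  also have "\<dots> \<le> (\<Sum>l\<in>R p. \<Lambda>)"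
  proof (intro sum_mono)
    fix l assume "l \<in> R p"
    have "{q \<in> B. line p q = l} \<subseteq> {q \<in> P. q \<in> l \<and> \<not> rich q l}" using assms by auto
    then show "(\<Sum>q | q \<in> B \<and> line p q = l. f q) \<le> \<Lambda>" by (rule poor_sum_le)
  qed
  finally show ?thesis by simp
qed

text \<open>Here the rich line is perpendicular to the side that carries \<open>q\<close>, but it
  still determines that side, by \<open>line_eq_line\<close>.\<close>

lemma rich_perp_poor_sum:
  assumes "B \<subseteq> {q \<in> P. q \<noteq> p \<and> rich p (perp p q) \<and> \<not> rich q (line p q)}"
  shows "(\<Sum>q\<in>B. f q) \<le> card (R p) * \<Lambda>"
proof -
  have finB: "finite B" using assms finP finite_subset by fastforce
  have "(\<Sum>q\<in>B. f q) = (\<Sum>l\<in>R p. \<Sum>q | q \<in> B \<and> perp p q = l. f q)"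
  proof (rule sum.group[symmetric])
    show "perp p ` B \<subseteq> R p"
    proof
      fix l assume "l \<in> perp p ` B"
      then obtain q where q: "q \<in> B" "l = perp p q" by blast
      then have "p \<noteq> q" "rich p (perp p q)" using assms by auto
      then show "l \<in> R p" using q(2) perp_in_lines[of p q] by (simp add: R_def)
    qed
  qed (use finB in auto)
  also have "\<dots> \<le> (\<Sum>l\<in>R p. \<Lambda>)"
  proof (intro sum_mono)
    fix l assume "l \<in> R p"
    show "(\<Sum>q | q \<in> B \<and> perp p q = l. f q) \<le> \<Lambda>"
    proof (cases "{q \<in> B. perp p q = l} = {}")
      case True
      show ?thesis unfolding True using Lambda_nonneg by simp
    next
      case False
      then obtain q0 where q0: "q0 \<in> B" "perp p q0 = l" by auto
      have "{q \<in> B. perp p q = l} \<subseteq> {q \<in> P. q \<in> line p q0 \<and> \<not> rich q (line p q0)}"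
      proof
        fix q assume q: "q \<in> {q \<in> B. perp p q = l}"
        then have "line p q = line p q0" using q0 assms by (intro line_eq_line) auto
        then show "q \<in> {q \<in> P. q \<in> line p q0 \<and> \<not> rich q (line p q0)}"
          using q assms in_line(2)[of q p] by auto
      qed
      then show ?thesis by (rule poor_sum_le)
    qed
  qed
  finally show ?thesis by simp
qed

text \<open>For three corners chosen one after another, starting at a rich \<open>p\<close>: each of
  the two poor corners costs \<open>\<Lambda>\<close>, the number of rich lines at \<open>p\<close>
  is bounded on average, and the factor \<open>\<phi> (lev p)\<close> stands for the omitted fourth
  corner.\<close>

lemma sum_rich_paths:
  assumes "\<And>p. p \<in> P \<Longrightarrow> 0 \<le> G p" "\<And>p. p \<in> P \<Longrightarrow> G p \<le> c * real (card (R p)) * \<Lambda>\<^sup>2" "c \<ge> 0"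
  shows "(\<Sum>p\<in>P. f p * \<phi> (lev p) * G p) \<le> c * 10 ^ 9 * real (m + 1) * A\<^sup>2"
proof -
  have "(\<Sum>p\<in>P. f p * \<phi> (lev p) * G p) \<le> (\<Sum>p\<in>P. (\<phi> (lev p))\<^sup>2 * (c * real (card (R p)) * \<Lambda>\<^sup>2))"
  proof (rule sum_mono)
    fix p assume p: "p \<in> P"
    have "f p * \<phi> (lev p) * G p \<le> \<phi> (lev p) * \<phi> (lev p) * G p"
      using p assms f_le phi0 by (intro mult_right_mono) auto
    also have "\<dots> \<le> \<phi> (lev p) * \<phi> (lev p) * (c * real (card (R p)) * \<Lambda>\<^sup>2)"
      using p assms phi0 by (intro mult_left_mono) auto
    finally show "f p * \<phi> (lev p) * G p \<le> (\<phi> (lev p))\<^sup>2 * (c * real (card (R p)) * \<Lambda>\<^sup>2)"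
      by (simp add: power2_eq_square)
  qed
  also have "\<dots> = (c * \<Lambda>\<^sup>2) * (\<Sum>p\<in>P. (\<phi> (lev p))\<^sup>2 * real (card (R p)))"
    by (simp add: sum_distrib_left mult_ac)
  also have "\<dots> \<le> (c * \<Lambda>\<^sup>2) * (10 ^ 9 * A)"
    using rich_incidences assms(3) by (intro mult_left_mono sum_weighted_le) auto
  also have "\<dots> \<le> (c * (real (m + 1) * A)) * (10 ^ 9 * A)"
    using Lambda_sq A0 assms(3) by (intro mult_right_mono mult_left_mono) auto
  finally show ?thesis by (simp add: power2_eq_square mult_ac)
qed

text \<open>The free corner \<open>r\<close> satisfies \<open>f r \<le> \<phi> (lev p)\<close>, and
  the path is \<open>q\<close>, \<open>p\<close>, \<open>s\<close>: first \<open>q\<close> on a rich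
  line through \<open>p\<close>, then \<open>s\<close> poor on the perpendicular.\<close>

lemma sum_TB: "(\<Sum>x\<in>rects. TB x) \<le> 10 ^ 9 * real (m + 1) * A\<^sup>2"
proof -
  define B1 where "B1 p = {q \<in> P. q \<noteq> p \<and> rich p (line p q) \<and> \<not> rich q (line p q)}" for p
  define B2 where "B2 p q = {s \<in> P. s \<in> perp p q \<and> \<not> rich s (perp p q)}" for p q
  define X where "X = {(p, q, r, s) \<in> rects. rich p (line p q) \<and> \<not> rich q (line q p) \<and> \<not> rich s (line s p) \<and> lev p \<le> lev r}"
  define Y where "Y = (SIGMA p:P. SIGMA q:B1 p. B2 p q)"
  define g :: "(int \<times> int) \<times> (int \<times> int) \<times> (int \<times> int) \<times> (int \<times> int) \<Rightarrow> _" where "g = (\<lambda>(p, q, r, s). (p, q, s))"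
  define h where "h = (\<lambda>(p, q, s). f p * \<phi> (lev p) * (f q * f s))"
  have fin: "finite (B1 p)" "finite (B2 p q)" for p q using finP by (auto simp: B1_def B2_def)
  have "(\<Sum>x\<in>rects. TB x) = (\<Sum>x\<in>X. TB x)"
    by (rule sum.mono_neutral_right) (auto simp: X_def TB_def split: if_splits)
  also have "\<dots> \<le> (\<Sum>y\<in>Y. h y)"
  proof (rule sum_le_via_injection)
    show "finite Y" using finP fin by (auto simp: Y_def)
    show "g ` X \<subseteq> Y"
    proof
      fix y assume "y \<in> g ` X"
      then obtain p q r s where y: "y = (p, q, s)" and x: "(p, q, r, s) \<in> X" by (auto simp: g_def)
      then have rx: "(p, q, r, s) \<in> rects" by (auto simp: X_def)
      have "line s p = perp p q" using rects_sides[OF rx] line_commute by simp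
      then show "y \<in> Y" using x y line_commute[of p q] by (auto simp: X_def Y_def B1_def B2_def rects_def)
    qed
    show "inj_on g X" by (rule inj_onI) (auto simp: g_def X_def rects_def)
    show "0 \<le> h y" if "y \<in> Y" for y
      using that f0 phi0 by (auto simp: Y_def h_def B1_def B2_def intro!: mult_nonneg_nonneg)
    show "TB x \<le> h (g x)" if "x \<in> X" for x
    proof -
      obtain p q r s where x: "x = (p, q, r, s)" by (metis prod_cases4)
      have xr: "p \<in> P" "q \<in> P" "r \<in> P" "s \<in> P" "lev p \<le> lev r" using that x by (auto simp: X_def rects_def)
      have "f r \<le> \<phi> (lev p)" using f_le[OF xr(3)] phi_antimono[OF xr(5)] by linarith
      then have "(f p * f q * f s) * f r \<le> (f p * f q * f s) * \<phi> (lev p)"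
        using f0 xr by (intro mult_left_mono) auto
      then show ?thesis using that x by (simp add: X_def TB_def h_def g_def mult_ac)
    qed
  qed
  also have "\<dots> = (\<Sum>p\<in>P. f p * \<phi> (lev p) * (\<Sum>q\<in>B1 p. f q * (\<Sum>s\<in>B2 p q. f s)))"
    unfolding Y_def h_def using finP fin by (simp add: sum_over_Sigma sum_distrib_left)
  also have "\<dots> \<le> 1 * 10 ^ 9 * real (m + 1) * A\<^sup>2"
  proof (rule sum_rich_paths)
    fix p assume p: "p \<in> P"
    show "0 \<le> (\<Sum>q\<in>B1 p. f q * (\<Sum>s\<in>B2 p q. f s))"
      using f0 by (auto simp: B1_def B2_def intro!: sum_nonneg mult_nonneg_nonneg)
    have "(\<Sum>q\<in>B1 p. f q * (\<Sum>s\<in>B2 p q. f s)) \<le> (\<Sum>q\<in>B1 p. f q * \<Lambda>)"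
    proof (intro sum_mono mult_left_mono)
      fix q
      show "(\<Sum>s\<in>B2 p q. f s) \<le> \<Lambda>" by (rule poor_sum_le[of _ "perp p q"]) (auto simp: B2_def)
    qed (use f0 in \<open>auto simp: B1_def\<close>)
    also have "\<dots> = (\<Sum>q\<in>B1 p. f q) * \<Lambda>" by (simp add: sum_distrib_right)
    also have "\<dots> \<le> (card (R p) * \<Lambda>) * \<Lambda>"
      by (intro mult_right_mono rich_poor_sum Lambda_nonneg) (auto simp: B1_def)
    finally show "(\<Sum>q\<in>B1 p. f q * (\<Sum>s\<in>B2 p q. f s)) \<le> 1 * real (card (R p)) * \<Lambda>\<^sup>2" by (simp add: power2_eq_square)
  qed simp
  finally show ?thesis by simp
qed

text \<open>The path is now \<open>p\<close>, \<open>q\<close>, \<open>r\<close> with free corner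
  \<open>s\<close>. The factor 2 reflects that the rich line at \<open>p\<close> may run along
  either of its sides.\<close>

lemma sum_TC: "(\<Sum>x\<in>rects. TC x) \<le> 2 * 10 ^ 9 * real (m + 1) * A\<^sup>2"
proof -
  define B1 where "B1 p = {q \<in> P. q \<noteq> p \<and> rich p (line p q) \<and> \<not> rich q (line p q)}" for p
  define B3 where "B3 p = {q \<in> P. q \<noteq> p \<and> rich p (perp p q) \<and> \<not> rich q (line p q)}" for p
  define B2 where "B2 p q = {r \<in> P. r \<in> perp q p \<and> \<not> rich r (perp q p)}" for p q
  define X where "X = {(p, q, r, s) \<in> rects. (rich p (line p q) \<or> rich p (line p s)) \<and> \<not> rich q (line q p) \<and> \<not> rich r (line r q) \<and> lev p \<le> lev s}"
  define Y where "Y = (SIGMA p:P. SIGMA q:B1 p \<union> B3 p. B2 p q)"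
  define g :: "(int \<times> int) \<times> (int \<times> int) \<times> (int \<times> int) \<times> (int \<times> int) \<Rightarrow> _" where "g = (\<lambda>(p, q, r, s). (p, q, r))"
  define h where "h = (\<lambda>(p, q, r). f p * \<phi> (lev p) * (f q * f r))"
  have fin: "finite (B1 p)" "finite (B3 p)" "finite (B2 p q)" for p q using finP by (auto simp: B1_def B2_def B3_def)
  have "(\<Sum>x\<in>rects. TC x) = (\<Sum>x\<in>X. TC x)"
    by (rule sum.mono_neutral_right) (auto simp: X_def TC_def split: if_splits)
  also have "\<dots> \<le> (\<Sum>y\<in>Y. h y)"
  proof (rule sum_le_via_injection)
    show "finite Y" using finP fin by (auto simp: Y_def)
    show "g ` X \<subseteq> Y"
    proof
      fix y assume "y \<in> g ` X"
      then obtain p q r s where y: "y = (p, q, r)" and x: "(p, q, r, s) \<in> X" by (auto simp: g_def)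
      then have rx: "(p, q, r, s) \<in> rects" by (auto simp: X_def)
      have "line r q = perp q p" "line p s = perp p q" "r \<in> perp q p" using rects_sides[OF rx] line_commute by auto
      then show "y \<in> Y" using x y line_commute[of p q] by (auto simp: X_def Y_def B1_def B2_def B3_def rects_def)
    qed
    show "inj_on g X"
    proof (rule inj_onI)
      fix x x' assume x: "x \<in> X" "x' \<in> X" "g x = g x'"
      obtain p q r s p' q' r' s' where xx: "x = (p, q, r, s)" "x' = (p', q', r', s')" by (metis prod_cases4)
      have "q + s = q' + s'" using x xx by (auto simp: g_def X_def rects_def)
      then show "x = x'" using x xx by (auto simp: g_def)
    qed
    show "0 \<le> h y" if "y \<in> Y" for y
      using that f0 phi0 by (auto simp: Y_def h_def B1_def B2_def B3_def intro!: mult_nonneg_nonneg)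
    show "TC x \<le> h (g x)" if "x \<in> X" for x
    proof -
      obtain p q r s where x: "x = (p, q, r, s)" by (metis prod_cases4)
      have xr: "p \<in> P" "q \<in> P" "r \<in> P" "s \<in> P" "lev p \<le> lev s" using that x by (auto simp: X_def rects_def)
      have "f s \<le> \<phi> (lev p)" using f_le[OF xr(4)] phi_antimono[OF xr(5)] by linarith
      then have "(f p * f q * f r) * f s \<le> (f p * f q * f r) * \<phi> (lev p)"
        using f0 xr by (intro mult_left_mono) auto
      then show ?thesis using that x by (simp add: X_def TC_def h_def g_def mult_ac)
    qed
  qed
  also have "\<dots> = (\<Sum>p\<in>P. f p * \<phi> (lev p) * (\<Sum>q\<in>B1 p \<union> B3 p. f q * (\<Sum>r\<in>B2 p q. f r)))"
    unfolding Y_def h_def using finP fin by (simp add: sum_over_Sigma sum_distrib_left)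
  also have "\<dots> \<le> 2 * 10 ^ 9 * real (m + 1) * A\<^sup>2"
  proof (rule sum_rich_paths)
    fix p assume p: "p \<in> P"
    show "0 \<le> (\<Sum>q\<in>B1 p \<union> B3 p. f q * (\<Sum>r\<in>B2 p q. f r))"
      using f0 by (auto simp: B1_def B2_def B3_def intro!: sum_nonneg mult_nonneg_nonneg)
    have "(\<Sum>q\<in>B1 p \<union> B3 p. f q * (\<Sum>r\<in>B2 p q. f r)) \<le> (\<Sum>q\<in>B1 p \<union> B3 p. f q * \<Lambda>)"
    proof (intro sum_mono mult_left_mono)
      fix q
      show "(\<Sum>s\<in>B2 p q. f s) \<le> \<Lambda>" by (rule poor_sum_le[of _ "perp q p"]) (auto simp: B2_def)
    qed (use f0 in \<open>auto simp: B1_def B3_def\<close>)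
    also have "\<dots> = (\<Sum>q\<in>B1 p \<union> B3 p. f q) * \<Lambda>" by (simp add: sum_distrib_right)
    also have "(\<Sum>q\<in>B1 p \<union> B3 p. f q) \<le> (\<Sum>q\<in>B1 p. f q) + (\<Sum>q\<in>B3 p. f q)"
    proof -
      have "(\<Sum>q\<in>B1 p \<union> B3 p. f q) + (\<Sum>q\<in>B1 p \<inter> B3 p. f q) = (\<Sum>q\<in>B1 p. f q) + (\<Sum>q\<in>B3 p. f q)"
        using fin by (intro sum.union_inter)
      moreover have "0 \<le> (\<Sum>q\<in>B1 p \<inter> B3 p. f q)" using f0 by (auto simp: B1_def intro!: sum_nonneg)
      ultimately show ?thesis by linarith
    qed
    also have "\<dots> \<le> card (R p) * \<Lambda> + card (R p) * \<Lambda>"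
      by (intro add_mono rich_poor_sum rich_perp_poor_sum) (auto simp: B1_def B3_def)
    finally show "(\<Sum>q\<in>B1 p \<union> B3 p. f q * (\<Sum>r\<in>B2 p q. f r)) \<le> 2 * real (card (R p)) * \<Lambda>\<^sup>2"
      using Lambda_nonneg by (simp add: power2_eq_square mult_right_mono mult_ac)
  qed simp
  finally show ?thesis by simp
qed

end

text \<open>Cauchy-Schwarz over the levels, with \<open>sqrt (2 ^ i)\<close> inserted so that the
  first factor is exactly the sum bounded by \<open>A\<close>.\<close>

lemma (in ranked) line_sum_sq_le:
  assumes "\<And>p. p \<in> B \<Longrightarrow> p \<in> P \<and> p \<noteq> q \<and> p \<in> l \<and> \<not> rich p l"
  shows "(\<Sum>p\<in>B. f p * sqrt (\<phi> (max (lev q) (lev p))))\<^sup>2 \<le> A * (\<Sum>i\<le>m. \<phi> (max (lev q) i) * (real (\<tau> i q l))\<^sup>2 / 2 ^ i)"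
proof -
  define j where "j = lev q"
  define B' where "B' i = {p \<in> B. lev p = i}" for i
  have BP: "B \<subseteq> P" using assms by auto
  have finB: "finite B" using BP finP finite_subset by blast
  define G where "G = (\<Sum>p\<in>B. f p * sqrt (\<phi> (max j (lev p))))"
  have "G = (\<Sum>i\<le>m. \<Sum>p\<in>B' i. f p * sqrt (\<phi> (max j (lev p))))"
    unfolding B'_def G_def by (rule sum.group[symmetric]) (use finB BP lev_le in auto)
  also have "\<dots> \<le> (\<Sum>i\<le>m. (sqrt (2 ^ i) * \<phi> i) * (sqrt (\<phi> (max j i)) * real (\<tau> i q l) / sqrt (2 ^ i)))"
  proof (rule sum_mono)
    fix i
    have "(\<Sum>p\<in>B' i. f p * sqrt (\<phi> (max j (lev p)))) \<le> (\<Sum>p\<in>B' i. \<phi> i * sqrt (\<phi> (max j i)))"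
      using BP f_le phi0 by (intro sum_mono) (auto simp: B'_def intro!: mult_right_mono)
    also have "\<dots> = \<phi> i * sqrt (\<phi> (max j i)) * real (card (B' i))" by simp
    also have "\<dots> \<le> \<phi> i * sqrt (\<phi> (max j i)) * real (\<tau> i q l)"
    proof (intro mult_left_mono)
      have "card (B' i) \<le> \<tau> i q l" unfolding \<tau>_def
        by (rule card_mono) (use assms finP in \<open>auto simp: B'_def S_def\<close>)
      then show "real (card (B' i)) \<le> real (\<tau> i q l)" by simp
    qed (use phi0 in auto)
    also have "\<dots> = (sqrt (2 ^ i) * \<phi> i) * (sqrt (\<phi> (max j i)) * real (\<tau> i q l) / sqrt (2 ^ i))" by simp
    finally show "(\<Sum>p\<in>B' i. f p * sqrt (\<phi> (max j (lev p)))) \<le> \<dots>" .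
  qed
  finally have "G \<le> (\<Sum>i\<le>m. (sqrt (2 ^ i) * \<phi> i) * (sqrt (\<phi> (max j i)) * real (\<tau> i q l) / sqrt (2 ^ i)))" .
  moreover have "0 \<le> G" unfolding G_def using BP f0 phi0 by (intro sum_nonneg mult_nonneg_nonneg) auto
  ultimately have "G\<^sup>2 \<le> (\<Sum>i\<le>m. (sqrt (2 ^ i) * \<phi> i) * (sqrt (\<phi> (max j i)) * real (\<tau> i q l) / sqrt (2 ^ i)))\<^sup>2"
    by (intro power_mono)
  also have "\<dots> \<le> (\<Sum>i\<le>m. (sqrt (2 ^ i) * \<phi> i)\<^sup>2) * (\<Sum>i\<le>m. (sqrt (\<phi> (max j i)) * real (\<tau> i q l) / sqrt (2 ^ i))\<^sup>2)"
    by (rule Cauchy_Schwarz_ineq_sum)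
  also have "(\<Sum>i\<le>m. (sqrt (2 ^ i) * \<phi> i)\<^sup>2) = (\<Sum>i\<le>m. 2 ^ i * (\<phi> i)\<^sup>2)"
    by (simp add: power_mult_distrib)
  also have "(\<Sum>i\<le>m. (sqrt (\<phi> (max j i)) * real (\<tau> i q l) / sqrt (2 ^ i))\<^sup>2) = (\<Sum>i\<le>m. \<phi> (max j i) * (real (\<tau> i q l))\<^sup>2 / 2 ^ i)"
    using phi0 by (simp add: power_mult_distrib power_divide)
  also have "(\<Sum>i\<le>m. 2 ^ i * (\<phi> i)\<^sup>2) * (\<Sum>i\<le>m. \<phi> (max j i) * (real (\<tau> i q l))\<^sup>2 / 2 ^ i) \<le> A * (\<Sum>i\<le>m. \<phi> (max j i) * (real (\<tau> i q l))\<^sup>2 / 2 ^ i)"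
    using sum_phi phi0 by (intro mult_right_mono sum_nonneg) auto
  finally show ?thesis by (simp add: G_def j_def)
qed

lemma geometric_sum_le: "(\<Sum>i\<le>m. (9 / 10 :: real) ^ (if i \<le> j then j - i else i - j)) \<le> 20"
proof -
  have g: "(\<Sum>k<n. (9 / 10 :: real) ^ k) \<le> 10" for n
    by (simp add: sum_gp_strict)
  have "(\<Sum>i\<le>m. (9 / 10 :: real) ^ (if i \<le> j then j - i else i - j))
      \<le> (\<Sum>i\<in>{..j} \<union> {j<..j + m}. (9 / 10 :: real) ^ (if i \<le> j then j - i else i - j))"
    by (intro sum_mono2) auto
  also have "\<dots> = (\<Sum>i\<le>j. (9 / 10 :: real) ^ (j - i)) + (\<Sum>i\<in>{j<..j + m}. (9 / 10 :: real) ^ (i - j))"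
    by (subst sum.union_disjoint) (auto intro!: arg_cong2[of _ _ _ _ "(+)"] sum.cong)
  also have "(\<Sum>i\<le>j. (9 / 10 :: real) ^ (j - i)) = (\<Sum>k<Suc j. (9 / 10 :: real) ^ k)"
    by (rule sum.reindex_bij_witness[of _ "\<lambda>k. j - k" "\<lambda>i. j - i"]) auto
  also have "(\<Sum>i\<in>{j<..j + m}. (9 / 10 :: real) ^ (i - j)) = (\<Sum>k\<in>{0<..m}. (9 / 10 :: real) ^ k)"
    by (rule sum.reindex_bij_witness[of _ "\<lambda>k. j + k" "\<lambda>i. i - j"]) auto
  also have "\<dots> \<le> (\<Sum>k<Suc m. (9 / 10 :: real) ^ k)" by (intro sum_mono2) auto
  finally show ?thesis using g[of "Suc j"] g[of "Suc m"] by linarith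
qed

text \<open>The sixth power of \<open>9 / 10\<close> exceeds one half.\<close>

lemma two_powr_sixth_le: "2 powr (- real d / 6) \<le> (9 / 10) ^ d"
proof -
  have "2 powr (- (1 :: real) / 6) \<le> 9 / 10"
  proof (rule power_le_imp_le_base[of _ 5])
    have "(2 powr (- (1 :: real) / 6)) ^ Suc 5 = 2 powr (- 1)" by (simp add: powr_power)
    also have "\<dots> \<le> (9 / 10) ^ Suc 5" by (simp add: powr_minus field_simps)
    finally show "(2 powr (- (1 :: real) / 6)) ^ Suc 5 \<le> (9 / 10) ^ Suc 5" .
  qed simp
  then have "(2 powr (- 1 / 6)) ^ d \<le> (9 / 10 :: real) ^ d" by (intro power_mono) auto
  then show ?thesis by (simp add: powr_power)
qed

context ranked begin

text \<open>For \<open>i \<le> j\<close> the factor \<open>\<kappa>\<close> decays by itself and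
  \<open>D \<le> 1\<close>. For \<open>i > j\<close> the weighted inequality of means for
  \<open>\<phi> j * \<phi> i\<close> gains \<open>e = 2 powr ((j - i) / 2)\<close>, which cancels
  \<open>D\<close> exactly and exceeds the growth of \<open>\<kappa>\<close>, leaving the exponent
  \<open>1 / 2 - 1 / 3 = 1 / 6\<close>.\<close>

lemma level_pair_bound:
  fixes i j :: nat
  assumes "i \<le> m" "j \<le> m"
  defines "\<kappa> \<equiv> 2 powr ((real i - real j) / 3)" and "D \<equiv> 2 powr ((real i - real j) / 2)"
  shows "\<phi> j * \<phi> (max j i) * 2 ^ j * (1 + (real i + 1) * \<kappa> + D)
    \<le> (2 ^ j * (\<phi> j)\<^sup>2 + 2 ^ i * (\<phi> i)\<^sup>2) * (2 + real (m + 1) * (9 / 10) ^ (if i \<le> j then j - i else i - j))"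
proof -
  define L where "L = real (m + 1)"
  define \<rho> :: real where "\<rho> = (9 / 10) ^ (if i \<le> j then j - i else i - j)"
  define aj ai where "aj = 2 ^ j * (\<phi> j)\<^sup>2" and "ai = 2 ^ i * (\<phi> i)\<^sup>2"
  have nn: "0 \<le> aj" "0 \<le> ai" "0 \<le> \<rho>" "0 \<le> L" "0 < \<kappa>" "0 < D"
    by (auto simp: aj_def ai_def \<rho>_def L_def \<kappa>_def D_def)
  have iL: "real i + 1 \<le> L" using assms by (simp add: L_def)
  show ?thesis
  proof (cases "i \<le> j")
    case True
    have "\<kappa> \<le> 2 powr (- real (j - i) / 6)" unfolding \<kappa>_def using True by (intro powr_mono) (auto simp: of_nat_diff)
    also have "\<dots> \<le> \<rho>" using two_powr_sixth_le[of "j - i"] True by (simp add: \<rho>_def)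
    finally have "(real i + 1) * \<kappa> \<le> L * \<rho>" using iL nn by (intro mult_mono) auto
    moreover have "D \<le> 2 powr 0" unfolding D_def using True by (intro powr_mono) auto
    ultimately have "1 + (real i + 1) * \<kappa> + D \<le> 2 + L * \<rho>" by simp
    then have "aj * (1 + (real i + 1) * \<kappa> + D) \<le> aj * (2 + L * \<rho>)" using nn by (intro mult_left_mono) auto
    also have "\<dots> \<le> (aj + ai) * (2 + L * \<rho>)" using nn by (intro mult_right_mono) auto
    finally show ?thesis using True by (simp add: aj_def ai_def L_def \<rho>_def max_def power2_eq_square mult_ac)
  next
    case False
    define e where "e = 2 powr ((real j - real i) / 2)"
    have e0: "e > 0" by (simp add: e_def)
    have e2: "e\<^sup>2 * 2 ^ i = 2 ^ j"
    proof -
      have "e\<^sup>2 = 2 powr (real j - real i)" unfolding e_def by (simp add: powr_power diff_divide_distrib)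
      also have "\<dots> = 2 ^ j / 2 ^ i" by (simp add: powr_diff powr_realpow)
      finally show ?thesis by simp
    qed
    have eD: "e * D = 1" unfolding e_def D_def by (simp flip: powr_add add_divide_distrib)
    have "e * \<kappa> = 2 powr (- real (i - j) / 6)"
      unfolding e_def \<kappa>_def using False by (simp flip: powr_add add: of_nat_diff field_simps)
    also have "\<dots> \<le> \<rho>" using two_powr_sixth_le[of "i - j"] False by (simp add: \<rho>_def)
    finally have "(real i + 1) * (e * \<kappa>) \<le> L * \<rho>" using iL nn e0 by (intro mult_mono) auto
    moreover have "e \<le> 2 powr 0" unfolding e_def using False by (intro powr_mono) auto
    ultimately have 1: "e * (1 + (real i + 1) * \<kappa> + D) \<le> 2 + L * \<rho>"
      using eD by (simp add: algebra_simps)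
    have "\<phi> j * \<phi> i * 2 ^ j \<le> (aj + ai) * e"
    proof -
      have "0 \<le> (e * \<phi> j - \<phi> i)\<^sup>2 + (e * \<phi> j)\<^sup>2 + (\<phi> i)\<^sup>2" by simp
      then have "e * \<phi> j * \<phi> i \<le> e\<^sup>2 * (\<phi> j)\<^sup>2 + (\<phi> i)\<^sup>2" by (simp add: power2_eq_square algebra_simps)
      then have "(e * \<phi> j * \<phi> i) * (e * 2 ^ i) \<le> (e\<^sup>2 * (\<phi> j)\<^sup>2 + (\<phi> i)\<^sup>2) * (e * 2 ^ i)"
        using e0 by (intro mult_right_mono) auto
      also have "\<dots> = ((e\<^sup>2 * 2 ^ i) * (\<phi> j)\<^sup>2 + 2 ^ i * (\<phi> i)\<^sup>2) * e" by (simp add: algebra_simps)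
      finally have "\<phi> j * \<phi> i * (e\<^sup>2 * 2 ^ i) \<le> ((e\<^sup>2 * 2 ^ i) * (\<phi> j)\<^sup>2 + 2 ^ i * (\<phi> i)\<^sup>2) * e"
        by (simp add: power2_eq_square mult_ac)
      then show ?thesis unfolding e2 by (simp add: aj_def ai_def)
    qed
    then have "\<phi> j * \<phi> i * 2 ^ j * (1 + (real i + 1) * \<kappa> + D) \<le> (aj + ai) * e * (1 + (real i + 1) * \<kappa> + D)"
      using nn by (intro mult_right_mono) auto
    also have "\<dots> = (aj + ai) * (e * (1 + (real i + 1) * \<kappa> + D))" by simp
    also have "\<dots> \<le> (aj + ai) * (2 + L * \<rho>)" using 1 nn by (intro mult_left_mono) auto
    finally show ?thesis using False by (simp add: aj_def ai_def L_def \<rho>_def max_def)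
  qed
qed

text \<open>With one level fixed, the constant 2 summed over all levels gives \<open>2 * L\<close>,
  and the term with the harmonic factor \<open>L\<close> gives at most \<open>20 * L\<close> by its
  geometric decay. So the two logarithms add up to \<open>22 * L\<close>.\<close>

lemma sum_level_pairs:
  "(\<Sum>j\<le>m. \<Sum>i\<le>m. \<phi> j * (\<phi> (max j i) * W j i / 2 ^ i)) \<le> 14 * 10 ^ 9 * real (m + 1) * A"
proof -
  define a where "a i = 2 ^ i * (\<phi> i)\<^sup>2" for i
  define \<rho> :: "nat \<Rightarrow> nat \<Rightarrow> real" where "\<rho> i j = (9 / 10) ^ (if i \<le> j then j - i else i - j)" for i j
  define L where "L = real (m + 1)"
  have "(\<Sum>j\<le>m. \<Sum>i\<le>m. \<phi> j * (\<phi> (max j i) * W j i / 2 ^ i))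
     \<le> (\<Sum>j\<le>m. \<Sum>i\<le>m. 302000000 * ((a j + a i) * (2 + L * \<rho> i j)))"
  proof (intro sum_mono)
    fix i j assume ij: "j \<in> {..m}" "i \<in> {..m}"
    define X where "X = 1 + (real i + 1) * 2 powr ((real i - real j) / 3) + 2 powr ((real i - real j) / 2)"
    have "\<phi> j * (\<phi> (max j i) * W j i / 2 ^ i) = (\<phi> j * \<phi> (max j i) / 2 ^ i) * W j i" by simp
    also have "\<dots> \<le> (\<phi> j * \<phi> (max j i) / 2 ^ i) * (302000000 * (2 ^ i * 2 ^ j) * X)"
      using W_bound[of j i] phi0 by (intro mult_left_mono) (auto simp: X_def)
    also have "\<dots> = 302000000 * (\<phi> j * \<phi> (max j i) * 2 ^ j * X)" by simp
    also have "\<dots> \<le> 302000000 * ((a j + a i) * (2 + L * \<rho> i j))"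
      using level_pair_bound[of i j] ij by (intro mult_left_mono) (auto simp: X_def a_def L_def \<rho>_def)
    finally show "\<phi> j * (\<phi> (max j i) * W j i / 2 ^ i) \<le> 302000000 * ((a j + a i) * (2 + L * \<rho> i j))" .
  qed
  also have "\<dots> = 302000000 * ((\<Sum>j\<le>m. \<Sum>i\<le>m. a j * (2 + L * \<rho> i j)) + (\<Sum>j\<le>m. \<Sum>i\<le>m. a i * (2 + L * \<rho> i j)))"
    unfolding distrib_right sum.distrib[symmetric] sum_distrib_left ..
  also have "(\<Sum>j\<le>m. \<Sum>i\<le>m. a i * (2 + L * \<rho> i j)) = (\<Sum>i\<le>m. \<Sum>j\<le>m. a i * (2 + L * \<rho> i j))" by (rule sum.swap)
  also have "(\<Sum>j\<le>m. \<Sum>i\<le>m. a j * (2 + L * \<rho> i j)) \<le> (\<Sum>j\<le>m. a j * (22 * L))"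
  proof (intro sum_mono)
    fix j
    have "(\<Sum>i\<le>m. a j * (2 + L * \<rho> i j)) = a j * (2 * L + L * (\<Sum>i\<le>m. \<rho> i j))"
      by (simp add: sum_distrib_left[symmetric] sum.distrib L_def)
    also have "\<dots> \<le> a j * (2 * L + L * 20)"
      using geometric_sum_le[of j m] by (intro mult_left_mono add_left_mono) (auto simp: a_def \<rho>_def L_def)
    finally show "(\<Sum>i\<le>m. a j * (2 + L * \<rho> i j)) \<le> a j * (22 * L)" by simp
  qed
  also have "(\<Sum>i\<le>m. \<Sum>j\<le>m. a i * (2 + L * \<rho> i j)) \<le> (\<Sum>i\<le>m. a i * (22 * L))"
  proof (intro sum_mono)
    fix i
    have sym: "\<rho> i j = \<rho> j i" for j by (auto simp: \<rho>_def)
    have "(\<Sum>j\<le>m. a i * (2 + L * \<rho> i j)) = a i * (2 * L + L * (\<Sum>j\<le>m. \<rho> j i))"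
      unfolding sym by (simp add: sum_distrib_left[symmetric] sum.distrib L_def)
    also have "\<dots> \<le> a i * (2 * L + L * 20)"
      using geometric_sum_le[of i m] by (intro mult_left_mono add_left_mono) (auto simp: a_def \<rho>_def L_def)
    finally show "(\<Sum>j\<le>m. a i * (2 + L * \<rho> i j)) \<le> a i * (22 * L)" by simp
  qed
  also have "302000000 * ((\<Sum>j\<le>m. a j * (22 * L)) + (\<Sum>i\<le>m. a i * (22 * L))) = 13288000000 * L * (\<Sum>i\<le>m. a i)"
    by (simp add: sum_distrib_right[symmetric])
  also have "\<dots> \<le> 13288000000 * L * A" using sum_phi by (intro mult_left_mono) (auto simp: a_def L_def)
  also have "\<dots> \<le> 14 * 10 ^ 9 * L * A" using A0 by (intro mult_right_mono) (auto simp: L_def)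
  finally show ?thesis by (simp add: L_def)
qed

end

context rectangle_sum begin

text \<open>One leg of a right angle at \<open>q\<close>. The square root is its share of the bound
  for the coefficient of the omitted opposite corner, whose level is at least those of
  \<open>q\<close> and \<open>p\<close>; rich legs are set to 0 because other cases pay for
  them.\<close>

definition side :: "int \<times> int \<Rightarrow> int \<times> int \<Rightarrow> real" where
  "side q p = (if rich p (line q p) then 0 else f p * sqrt (\<phi> (max (lev q) (lev p))))"

lemma side_nonneg: "p \<in> P \<Longrightarrow> 0 \<le> side q p"
  using f0 phi0 by (simp add: side_def)

text \<open>Pairing a line through \<open>q\<close> with its perpendicular is injective, so the orthogonality can be
  dropped by the inequality between geometric and arithmetic means.\<close>

lemma right_angle_sum_le:
  assumes q: "q \<in> P"
  shows "(\<Sum>p\<in>P - {q}. \<Sum>r | r \<in> P - {q} \<and> r \<in> perp q p. side q p * side q r)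
     \<le> (\<Sum>l\<in>pencil q. A * (\<Sum>i\<le>m. \<phi> (max (lev q) i) * (real (\<tau> i q l))\<^sup>2 / 2 ^ i))"
proof -
  define G where "G l = (\<Sum>p | p \<in> P - {q} \<and> p \<in> l. side q p)" for l
  define rep where "rep l = (SOME p. p \<in> P - {q} \<and> line q p = l)" for l
  define \<sigma> where "\<sigma> l = perp q (rep l)" for l
  have rep: "rep l \<in> P - {q} \<and> line q (rep l) = l" if l: "l \<in> pencil q" for l
  proof -
    obtain p where "p \<in> P - {q} \<and> line q p = l" using l unfolding pencil_def by blast
    then show ?thesis unfolding rep_def by (rule someI)
  qed
  have inj: "inj_on \<sigma> (pencil q)"
  proof (rule inj_onI)
    fix l l' assume l: "l \<in> pencil q" "l' \<in> pencil q" "\<sigma> l = \<sigma> l'"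
    then have "line q (rep l) = line q (rep l')" using rep[OF l(1)] rep[OF l(2)]
      by (intro line_eq_line) (auto simp: \<sigma>_def)
    then show "l = l'" using rep l by simp
  qed
  have sig: "perp q p = \<sigma> (line q p)" if "p \<in> P - {q}" for p
  proof -
    have l: "line q p \<in> pencil q" using that by (simp add: pencil_def)
    show ?thesis unfolding \<sigma>_def using rep[OF l] that by (intro perp_eq_perp) auto
  qed
  have "(\<Sum>p\<in>P - {q}. \<Sum>r | r \<in> P - {q} \<and> r \<in> perp q p. side q p * side q r)
      = (\<Sum>p\<in>P - {q}. side q p * G (\<sigma> (line q p)))"
    by (intro sum.cong refl) (simp add: G_def sum_distrib_left sig)
  also have "\<dots> = (\<Sum>l\<in>pencil q. \<Sum>p | p \<in> P - {q} \<and> line q p = l. side q p * G (\<sigma> (line q p)))"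
    by (rule sum.group[symmetric]) (use finP in \<open>auto simp: pencil_def\<close>)
  also have "\<dots> = (\<Sum>l\<in>pencil q. G l * G (\<sigma> l))"
  proof (rule sum.cong[OF refl])
    fix l assume l: "l \<in> pencil q"
    have "{p. p \<in> P - {q} \<and> line q p = l} = {p. p \<in> P - {q} \<and> p \<in> l}"
    proof (intro Collect_cong conj_cong refl)
      fix p assume p: "p \<in> P - {q}"
      show "line q p = l \<longleftrightarrow> p \<in> l"
      proof
        assume "p \<in> l" then show "line q p = l" using pencil_unique[OF l, of p] p by simp
      qed auto
    qed
    moreover have "(\<Sum>p | p \<in> P - {q} \<and> line q p = l. side q p * G (\<sigma> (line q p)))
        = (\<Sum>p | p \<in> P - {q} \<and> line q p = l. side q p * G (\<sigma> l))" by (rule sum.cong) auto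
    ultimately show "(\<Sum>p | p \<in> P - {q} \<and> line q p = l. side q p * G (\<sigma> (line q p))) = G l * G (\<sigma> l)"
      unfolding G_def[of l] sum_distrib_right by simp
  qed
  also have "\<dots> \<le> (\<Sum>l\<in>pencil q. ((G l)\<^sup>2 + (G (\<sigma> l))\<^sup>2) / 2)"
  proof (intro sum_mono)
    fix l
    have "0 \<le> (G l - G (\<sigma> l))\<^sup>2" by simp
    then show "G l * G (\<sigma> l) \<le> ((G l)\<^sup>2 + (G (\<sigma> l))\<^sup>2) / 2" by (simp add: power2_eq_square algebra_simps)
  qed
  also have "\<dots> = ((\<Sum>l\<in>pencil q. (G l)\<^sup>2) + (\<Sum>l\<in>pencil q. (G (\<sigma> l))\<^sup>2)) / 2"
    by (simp add: sum_divide_distrib[symmetric] sum.distrib)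
  \<comment> \<open>By injectivity of \<open>\<sigma>\<close> each line is reached at most once, and
    a perpendicular outside the pencil contains no further point of \<open>P\<close>, so its
    \<open>G\<close> vanishes.\<close>
  also have "(\<Sum>l\<in>pencil q. (G (\<sigma> l))\<^sup>2) \<le> (\<Sum>l\<in>pencil q. (G l)\<^sup>2)"
  proof -
    have "(\<Sum>l\<in>pencil q. (G (\<sigma> l))\<^sup>2) = (\<Sum>l\<in>\<sigma> ` pencil q. (G l)\<^sup>2)"
      using inj by (simp add: sum.reindex)
    also have "\<dots> \<le> (\<Sum>l\<in>\<sigma> ` pencil q \<union> pencil q. (G l)\<^sup>2)" by (intro sum_mono2) auto
    also have "\<dots> = (\<Sum>l\<in>pencil q. (G l)\<^sup>2)"
    proof (rule sum.mono_neutral_right)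
      show "\<forall>l\<in>\<sigma> ` pencil q \<union> pencil q - pencil q. (G l)\<^sup>2 = 0"
      proof
        fix l assume "l \<in> \<sigma> ` pencil q \<union> pencil q - pencil q"
        then obtain l' where l: "l \<notin> pencil q" "l' \<in> pencil q" "l = perp q (rep l')" by (auto simp: \<sigma>_def)
        have "{p. p \<in> P - {q} \<and> p \<in> l} = {}"
        proof (rule ccontr)
          assume "{p. p \<in> P - {q} \<and> p \<in> l} \<noteq> {}"
          then obtain p where p: "p \<in> P - {q}" "p \<in> l" by auto
          then have "line q p = l" using l rep[OF l(2)] line_eq_perp[of p q "rep l'"] by auto
          then show False using l p by (auto simp: pencil_def)
        qed
        then show "(G l)\<^sup>2 = 0" unfolding G_def by (simp only: sum.empty) simp
      qed
    qed auto
    finally show ?thesis .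
  qed
  finally have "(\<Sum>p\<in>P - {q}. \<Sum>r | r \<in> P - {q} \<and> r \<in> perp q p. side q p * side q r) \<le> (\<Sum>l\<in>pencil q. (G l)\<^sup>2)"
    by simp
  also have "\<dots> \<le> (\<Sum>l\<in>pencil q. A * (\<Sum>i\<le>m. \<phi> (max (lev q) i) * (real (\<tau> i q l))\<^sup>2 / 2 ^ i))"
  proof (intro sum_mono)
    fix l assume l: "l \<in> pencil q"
    have "G l = (\<Sum>p | p \<in> P - {q} \<and> p \<in> l. if rich p l then 0 else f p * sqrt (\<phi> (max (lev q) (lev p))))"
      unfolding G_def
    proof (rule sum.cong[OF refl])
      fix p assume "p \<in> {p. p \<in> P - {q} \<and> p \<in> l}"
      then have "line q p = l" using pencil_unique[OF l, of p] by simp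
      then show "side q p = (if rich p l then 0 else f p * sqrt (\<phi> (max (lev q) (lev p))))" by (simp add: side_def)
    qed
    also have "\<dots> = (\<Sum>p | p \<in> P - {q} \<and> p \<in> l \<and> \<not> rich p l. f p * sqrt (\<phi> (max (lev q) (lev p))))"
      by (rule sum.mono_neutral_cong_right) (use finP in auto)
    finally have "(G l)\<^sup>2 = (\<Sum>p | p \<in> P - {q} \<and> p \<in> l \<and> \<not> rich p l. f p * sqrt (\<phi> (max (lev q) (lev p))))\<^sup>2" by simp
    also have "\<dots> \<le> A * (\<Sum>i\<le>m. \<phi> (max (lev q) i) * (real (\<tau> i q l))\<^sup>2 / 2 ^ i)"
      by (rule line_sum_sq_le) auto
    finally show "(G l)\<^sup>2 \<le> A * (\<Sum>i\<le>m. \<phi> (max (lev q) i) * (real (\<tau> i q l))\<^sup>2 / 2 ^ i)" .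
  qed
  finally show ?thesis .
qed

text \<open>As \<open>s\<close> has the largest level, \<open>f s\<close> is at most the product of
  the two square roots in \<open>side\<close>. Dropping \<open>s\<close> leaves right angles at
  \<open>q\<close>, and collecting \<open>q\<close> by level turns the squares of
  \<open>\<tau>\<close> into \<open>W\<close>.\<close>

lemma sum_TD: "(\<Sum>x\<in>rects. TD x) \<le> 14 * 10 ^ 9 * real (m + 1) * A\<^sup>2"
proof -
  define X where "X = {(p, q, r, s) \<in> rects. \<not> rich p (line p q) \<and> \<not> rich r (line r q) \<and> lev p \<le> lev s \<and> lev q \<le> lev s \<and> lev r \<le> lev s}"
  define Y where "Y = (SIGMA q:P. SIGMA p:P - {q}. {r. r \<in> P - {q} \<and> r \<in> perp q p})"
  define g :: "(int \<times> int) \<times> (int \<times> int) \<times> (int \<times> int) \<times> (int \<times> int) \<Rightarrow> _" where "g = (\<lambda>(p, q, r, s). (q, p, r))"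
  define h where "h = (\<lambda>(q, p, r). f q * (side q p * side q r))"
  have "(\<Sum>x\<in>rects. TD x) = (\<Sum>x\<in>X. TD x)"
    by (rule sum.mono_neutral_right) (auto simp: X_def TD_def split: if_splits)
  also have "\<dots> \<le> (\<Sum>y\<in>Y. h y)"
  proof (rule sum_le_via_injection)
    show "finite Y" using finP by (auto simp: Y_def)
    show "g ` X \<subseteq> Y"
    proof
      fix y assume "y \<in> g ` X"
      then obtain p q r s where y: "y = (q, p, r)" and x: "(p, q, r, s) \<in> X" by (auto simp: g_def)
      then have rx: "(p, q, r, s) \<in> rects" by (auto simp: X_def)
      then show "y \<in> Y" using y rects_sides[OF rx] by (auto simp: Y_def rects_def)
    qed
    show "inj_on g X"
    proof (rule inj_onI)
      fix x x' assume x: "x \<in> X" "x' \<in> X" "g x = g x'"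
      obtain p q r s p' q' r' s' where xx: "x = (p, q, r, s)" "x' = (p', q', r', s')" by (metis prod_cases4)
      have "q + s = q' + s'" using x xx by (auto simp: g_def X_def rects_def)
      then show "x = x'" using x xx by (auto simp: g_def)
    qed
    show "0 \<le> h y" if "y \<in> Y" for y
      using that f0 side_nonneg by (auto simp: Y_def h_def intro!: mult_nonneg_nonneg)
    show "TD x \<le> h (g x)" if "x \<in> X" for x
    proof -
      obtain p q r s where x: "x = (p, q, r, s)" by (metis prod_cases4)
      have xr: "p \<in> P" "q \<in> P" "r \<in> P" "s \<in> P" "lev p \<le> lev s" "lev q \<le> lev s" "lev r \<le> lev s"
        "\<not> rich p (line q p)" "\<not> rich r (line q r)" using that x line_commute by (auto simp: X_def rects_def)
      have "sqrt (f s) \<le> sqrt (\<phi> (max (lev q) (lev p)))" "sqrt (f s) \<le> sqrt (\<phi> (max (lev q) (lev r)))"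
        using f_le[OF xr(4)] phi_antimono[of "max (lev q) (lev p)" "lev s"] phi_antimono[of "max (lev q) (lev r)" "lev s"] xr
        by (auto intro: order_trans)
      then have "sqrt (f s) * sqrt (f s) \<le> sqrt (\<phi> (max (lev q) (lev p))) * sqrt (\<phi> (max (lev q) (lev r)))"
        using f0[OF xr(4)] phi0 by (intro mult_mono) auto
      then have "f s \<le> sqrt (\<phi> (max (lev q) (lev p))) * sqrt (\<phi> (max (lev q) (lev r)))"
        using f0[OF xr(4)] by simp
      then have "(f p * f q * f r) * f s \<le> (f p * f q * f r) * (sqrt (\<phi> (max (lev q) (lev p))) * sqrt (\<phi> (max (lev q) (lev r))))"
        using f0 xr by (intro mult_left_mono) auto
      then show ?thesis using that x xr by (simp add: X_def TD_def h_def g_def side_def mult_ac)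
    qed
  qed
  also have "\<dots> = (\<Sum>q\<in>P. f q * (\<Sum>p\<in>P - {q}. \<Sum>r | r \<in> P - {q} \<and> r \<in> perp q p. side q p * side q r))"
    unfolding Y_def h_def using finP by (simp add: sum_over_Sigma sum_distrib_left)
  also have "\<dots> \<le> (\<Sum>q\<in>P. \<phi> (lev q) * (\<Sum>l\<in>pencil q. A * (\<Sum>i\<le>m. \<phi> (max (lev q) i) * (real (\<tau> i q l))\<^sup>2 / 2 ^ i)))"
    using right_angle_sum_le f_le phi0 side_nonneg by (intro sum_mono mult_mono) (auto intro!: sum_nonneg mult_nonneg_nonneg)
  also have "\<dots> = (\<Sum>j\<le>m. \<Sum>q\<in>S j. \<phi> j * (\<Sum>l\<in>pencil q. A * (\<Sum>i\<le>m. \<phi> (max j i) * (real (\<tau> i q l))\<^sup>2 / 2 ^ i)))"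
    unfolding sum_by_level by (intro sum.cong refl) (simp add: S_def)
  also have "\<dots> = (\<Sum>j\<le>m. A * (\<Sum>i\<le>m. \<phi> j * (\<phi> (max j i) * W j i / 2 ^ i)))"
  proof (rule sum.cong[OF refl])
    fix j
    have "(\<Sum>q\<in>S j. \<phi> j * (\<Sum>l\<in>pencil q. A * (\<Sum>i\<le>m. \<phi> (max j i) * (real (\<tau> i q l))\<^sup>2 / 2 ^ i)))
      = (\<Sum>q\<in>S j. \<Sum>l\<in>pencil q. \<Sum>i\<le>m. A * (\<phi> j * (\<phi> (max j i) * (real (\<tau> i q l))\<^sup>2 / 2 ^ i)))"
      by (simp add: sum_distrib_left mult_ac)
    also have "\<dots> = (\<Sum>q\<in>S j. \<Sum>i\<le>m. \<Sum>l\<in>pencil q. A * (\<phi> j * (\<phi> (max j i) * (real (\<tau> i q l))\<^sup>2 / 2 ^ i)))"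
      by (intro sum.cong refl sum.swap)
    also have "\<dots> = (\<Sum>i\<le>m. \<Sum>q\<in>S j. \<Sum>l\<in>pencil q. A * (\<phi> j * (\<phi> (max j i) * (real (\<tau> i q l))\<^sup>2 / 2 ^ i)))"
      by (rule sum.swap)
    also have "\<dots> = A * (\<Sum>i\<le>m. \<phi> j * (\<phi> (max j i) * W j i / 2 ^ i))"
      by (simp add: W_def sum_distrib_left sum_divide_distrib)
    finally show "(\<Sum>q\<in>S j. \<phi> j * (\<Sum>l\<in>pencil q. A * (\<Sum>i\<le>m. \<phi> (max j i) * (real (\<tau> i q l))\<^sup>2 / 2 ^ i)))
      = A * (\<Sum>i\<le>m. \<phi> j * (\<phi> (max j i) * W j i / 2 ^ i))" .
  qed
  also have "\<dots> = A * (\<Sum>j\<le>m. \<Sum>i\<le>m. \<phi> j * (\<phi> (max j i) * W j i / 2 ^ i))" by (rule sum_distrib_left[symmetric])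
  also have "\<dots> \<le> A * (14 * 10 ^ 9 * real (m + 1) * A)" using sum_level_pairs A0 by (rule mult_left_mono)
  finally show ?thesis by (simp add: power2_eq_square mult_ac)
qed

definition TS where "TS x = TA x + TB x + TC x + TD x"

lemma TS_parts: "x \<in> rects \<Longrightarrow> 0 \<le> TA x \<and> 0 \<le> TB x \<and> 0 \<le> TC x \<and> 0 \<le> TD x"
proof -
  assume x: "x \<in> rects"
  obtain p q r s where xx: "x = (p, q, r, s)" by (metis prod_cases4)
  have "0 \<le> f p" "0 \<le> f q" "0 \<le> f r" "0 \<le> f s" using x f0 by (simp_all add: rects_def xx)
  then show ?thesis by (simp add: TA_def TB_def TC_def TD_def xx)
qed

lemma TA_le_TS: "x \<in> rects \<Longrightarrow> TA x \<le> TS x"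
  and TB_le_TS: "x \<in> rects \<Longrightarrow> TB x \<le> TS x"
  and TC_le_TS: "x \<in> rects \<Longrightarrow> TC x \<le> TS x"
  and TD_le_TS: "x \<in> rects \<Longrightarrow> TD x \<le> TS x"
  and TS_nonneg: "x \<in> rects \<Longrightarrow> 0 \<le> TS x"
  using TS_parts[of x] by (simp_all add: TS_def)

text \<open>A corner counts as rich if one of its two sides is. For two adjacent rich corners the
  weight is first split along the diagonals by the inequality of means, and each corner pays for its
  own diagonal. Every other configuration is an image of \<open>TB\<close>, \<open>TC\<close> or
  \<open>TD\<close> under one of the eight symmetries.\<close>

lemma wt_le_symmetrized:
  assumes x: "x \<in> rects"
  shows "wt x \<le> TS x + TS (turn x) + TS (turn (turn x)) + TS (turn (turn (turn x)))
    + TS (flip x) + TS (flip (turn x)) + TS (flip (turn (turn x))) + TS (flip (turn (turn (turn x))))"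
proof -
  obtain p q r s where xx: "x = (p, q, r, s)" by (metis prod_cases4)
  have R: "(p, q, r, s) \<in> rects" "(q, r, s, p) \<in> rects" "(r, s, p, q) \<in> rects" "(s, p, q, r) \<in> rects"
    using x xx turn_rects by blast+
  note R' = R[THEN flip_rects]
  have f: "0 \<le> f p" "0 \<le> f q" "0 \<le> f r" "0 \<le> f s" using R(1) f0 by (simp_all add: rects_def)
  have amgm: "u * v \<le> u\<^sup>2 + v\<^sup>2" for u v :: real
  proof -
    have "0 \<le> (u - v)\<^sup>2 + u\<^sup>2 + v\<^sup>2" by simp
    then show ?thesis by (simp add: power2_eq_square algebra_simps)
  qed
  have w: "wt x = (f p * f r) * (f q * f s)" by (simp add: wt_def xx)
  have w2: "wt x \<le> (f p)\<^sup>2 * (f r)\<^sup>2 + (f q)\<^sup>2 * (f s)\<^sup>2"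
    unfolding w using amgm[of "f p * f r" "f q * f s"] by (simp add: power_mult_distrib)
  define vp vq vr vs where "vp \<longleftrightarrow> rich p (line p q) \<or> rich p (line p s)" and "vq \<longleftrightarrow> rich q (line q p) \<or> rich q (line q r)"
    and "vr \<longleftrightarrow> rich r (line r q) \<or> rich r (line r s)" and "vs \<longleftrightarrow> rich s (line s p) \<or> rich s (line s r)"
  let ?T = "TS (p, q, r, s) + TS (q, r, s, p) + TS (r, s, p, q) + TS (s, p, q, r)
     + TS (p, s, r, q) + TS (q, p, s, r) + TS (r, q, p, s) + TS (s, r, q, p)"
  have A1: "vp \<Longrightarrow> (f p)\<^sup>2 * (f r)\<^sup>2 \<le> TA (p, q, r, s) + TA (p, s, r, q)" by (auto simp: vp_def TA_def)
  have A2: "vq \<Longrightarrow> (f q)\<^sup>2 * (f s)\<^sup>2 \<le> TA (q, r, s, p) + TA (q, p, s, r)" by (auto simp: vq_def TA_def)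
  have A3: "vr \<Longrightarrow> (f p)\<^sup>2 * (f r)\<^sup>2 \<le> TA (r, s, p, q) + TA (r, q, p, s)" by (auto simp: vr_def TA_def mult.commute)
  have A4: "vs \<Longrightarrow> (f q)\<^sup>2 * (f s)\<^sup>2 \<le> TA (s, p, q, r) + TA (s, r, q, p)" by (auto simp: vs_def TA_def mult.commute)
  have B1: "vp \<Longrightarrow> \<not> vq \<Longrightarrow> \<not> vs \<Longrightarrow> lev p \<le> lev r \<Longrightarrow> wt x \<le> TB (p, q, r, s) + TB (p, s, r, q)"
    using f by (auto simp: vp_def vq_def vs_def TB_def w mult_ac)
  have B2: "vq \<Longrightarrow> \<not> vr \<Longrightarrow> \<not> vp \<Longrightarrow> lev q \<le> lev s \<Longrightarrow> wt x \<le> TB (q, r, s, p) + TB (q, p, s, r)"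
    using f by (auto simp: vp_def vq_def vr_def TB_def w mult_ac)
  have B3: "vr \<Longrightarrow> \<not> vs \<Longrightarrow> \<not> vq \<Longrightarrow> lev r \<le> lev p \<Longrightarrow> wt x \<le> TB (r, s, p, q) + TB (r, q, p, s)"
    using f by (auto simp: vr_def vq_def vs_def TB_def w mult_ac)
  have B4: "vs \<Longrightarrow> \<not> vp \<Longrightarrow> \<not> vr \<Longrightarrow> lev s \<le> lev q \<Longrightarrow> wt x \<le> TB (s, p, q, r) + TB (s, r, q, p)"
    using f by (auto simp: vp_def vr_def vs_def TB_def w mult_ac)
  have C1: "vp \<Longrightarrow> \<not> vq \<Longrightarrow> \<not> vr \<Longrightarrow> lev p \<le> lev s \<Longrightarrow> wt x \<le> TC (p, q, r, s)"
    by (simp add: vp_def vq_def vr_def TC_def w mult_ac)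
  have C1': "vp \<Longrightarrow> \<not> vs \<Longrightarrow> \<not> vr \<Longrightarrow> lev p \<le> lev q \<Longrightarrow> wt x \<le> TC (p, s, r, q)"
    by (simp add: vp_def vs_def vr_def TC_def w mult_ac disj_commute)
  have C2: "vq \<Longrightarrow> \<not> vr \<Longrightarrow> \<not> vs \<Longrightarrow> lev q \<le> lev p \<Longrightarrow> wt x \<le> TC (q, r, s, p)"
    by (simp add: vs_def vq_def vr_def TC_def w mult_ac disj_commute)
  have C2': "vq \<Longrightarrow> \<not> vp \<Longrightarrow> \<not> vs \<Longrightarrow> lev q \<le> lev r \<Longrightarrow> wt x \<le> TC (q, p, s, r)"
    by (simp add: vp_def vq_def vs_def TC_def w mult_ac)
  have C3: "vr \<Longrightarrow> \<not> vs \<Longrightarrow> \<not> vp \<Longrightarrow> lev r \<le> lev q \<Longrightarrow> wt x \<le> TC (r, s, p, q)"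
    by (simp add: vp_def vs_def vr_def TC_def w mult_ac disj_commute)
  have C3': "vr \<Longrightarrow> \<not> vq \<Longrightarrow> \<not> vp \<Longrightarrow> lev r \<le> lev s \<Longrightarrow> wt x \<le> TC (r, q, p, s)"
    by (simp add: vp_def vq_def vr_def TC_def w mult_ac)
  have C4: "vs \<Longrightarrow> \<not> vp \<Longrightarrow> \<not> vq \<Longrightarrow> lev s \<le> lev r \<Longrightarrow> wt x \<le> TC (s, p, q, r)"
    by (simp add: vp_def vq_def vs_def TC_def w mult_ac)
  have C4': "vs \<Longrightarrow> \<not> vr \<Longrightarrow> \<not> vq \<Longrightarrow> lev s \<le> lev p \<Longrightarrow> wt x \<le> TC (s, r, q, p)"
    by (simp add: vs_def vq_def vr_def TC_def w mult_ac disj_commute)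
  have D1: "\<not> vp \<Longrightarrow> \<not> vr \<Longrightarrow> lev p \<le> lev s \<Longrightarrow> lev q \<le> lev s \<Longrightarrow> lev r \<le> lev s \<Longrightarrow> wt x \<le> TD (p, q, r, s)"
    by (simp add: vp_def vr_def TD_def w mult_ac)
  have D2: "\<not> vq \<Longrightarrow> \<not> vs \<Longrightarrow> lev q \<le> lev p \<Longrightarrow> lev r \<le> lev p \<Longrightarrow> lev s \<le> lev p \<Longrightarrow> wt x \<le> TD (q, r, s, p)"
    by (simp add: vq_def vs_def TD_def w mult_ac)
  have D3: "\<not> vr \<Longrightarrow> \<not> vp \<Longrightarrow> lev r \<le> lev q \<Longrightarrow> lev s \<le> lev q \<Longrightarrow> lev p \<le> lev q \<Longrightarrow> wt x \<le> TD (r, s, p, q)"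
    by (simp add: vp_def vr_def TD_def w mult_ac)
  have D4: "\<not> vs \<Longrightarrow> \<not> vq \<Longrightarrow> lev s \<le> lev r \<Longrightarrow> lev p \<le> lev r \<Longrightarrow> lev q \<le> lev r \<Longrightarrow> wt x \<le> TD (s, p, q, r)"
    by (simp add: vq_def vs_def TD_def w mult_ac)
  note le = R[THEN TA_le_TS] R'[THEN TA_le_TS] R[THEN TB_le_TS] R'[THEN TB_le_TS] R[THEN TC_le_TS] R'[THEN TC_le_TS]
    R[THEN TD_le_TS] R'[THEN TD_le_TS] R[THEN TS_nonneg] R'[THEN TS_nonneg]
  have KA1: "wt x \<le> ?T" if "vp" "vq" using w2 A1[OF that(1)] A2[OF that(2)] le by linarith
  have KA2: "wt x \<le> ?T" if "vq" "vr" using w2 A2[OF that(1)] A3[OF that(2)] le by linarith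
  have KA3: "wt x \<le> ?T" if "vr" "vs" using w2 A3[OF that(1)] A4[OF that(2)] le by linarith
  have KA4: "wt x \<le> ?T" if "vs" "vp" using w2 A4[OF that(1)] A1[OF that(2)] le by linarith
  have KB1: "wt x \<le> ?T" if "vp" "\<not> vq" "\<not> vs" "lev p \<le> lev r" using B1[OF that] le by linarith
  have KB2: "wt x \<le> ?T" if "vq" "\<not> vr" "\<not> vp" "lev q \<le> lev s" using B2[OF that] le by linarith
  have KB3: "wt x \<le> ?T" if "vr" "\<not> vs" "\<not> vq" "lev r \<le> lev p" using B3[OF that] le by linarith
  have KB4: "wt x \<le> ?T" if "vs" "\<not> vp" "\<not> vr" "lev s \<le> lev q" using B4[OF that] le by linarith
  have KC1: "wt x \<le> ?T" if "vp" "\<not> vq" "\<not> vr" "lev p \<le> lev s" using C1[OF that] le by linarith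
  have KC1': "wt x \<le> ?T" if "vp" "\<not> vs" "\<not> vr" "lev p \<le> lev q" using C1'[OF that] le by linarith
  have KC2: "wt x \<le> ?T" if "vq" "\<not> vr" "\<not> vs" "lev q \<le> lev p" using C2[OF that] le by linarith
  have KC2': "wt x \<le> ?T" if "vq" "\<not> vp" "\<not> vs" "lev q \<le> lev r" using C2'[OF that] le by linarith
  have KC3: "wt x \<le> ?T" if "vr" "\<not> vs" "\<not> vp" "lev r \<le> lev q" using C3[OF that] le by linarith
  have KC3': "wt x \<le> ?T" if "vr" "\<not> vq" "\<not> vp" "lev r \<le> lev s" using C3'[OF that] le by linarith
  have KC4: "wt x \<le> ?T" if "vs" "\<not> vp" "\<not> vq" "lev s \<le> lev r" using C4[OF that] le by linarith
  have KC4': "wt x \<le> ?T" if "vs" "\<not> vr" "\<not> vq" "lev s \<le> lev p" using C4'[OF that] le by linarith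
  have KD1: "wt x \<le> ?T" if "\<not> vp" "\<not> vr" "lev p \<le> lev s" "lev q \<le> lev s" "lev r \<le> lev s" using D1[OF that] le by linarith
  have KD2: "wt x \<le> ?T" if "\<not> vq" "\<not> vs" "lev q \<le> lev p" "lev r \<le> lev p" "lev s \<le> lev p" using D2[OF that] le by linarith
  have KD3: "wt x \<le> ?T" if "\<not> vr" "\<not> vp" "lev r \<le> lev q" "lev s \<le> lev q" "lev p \<le> lev q" using D3[OF that] le by linarith
  have KD4: "wt x \<le> ?T" if "\<not> vs" "\<not> vq" "lev s \<le> lev r" "lev p \<le> lev r" "lev q \<le> lev r" using D4[OF that] le by linarith
  have "wt x \<le> ?T"
    by (insert rectangle_cases[of vp vq vr vs "lev p" "lev r" "lev q" "lev s"], elim disjE conjE;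
      ((rule KA1; assumption) | (rule KA2; assumption) | (rule KA3; assumption) |
       (rule KA4; assumption) | (rule KB1; assumption) | (rule KB2; assumption) |
       (rule KB3; assumption) | (rule KB4; assumption) | (rule KC1; assumption) |
       (rule KC1'; assumption) | (rule KC2; assumption) | (rule KC2'; assumption) |
       (rule KC3; assumption) | (rule KC3'; assumption) | (rule KC4; assumption) |
       (rule KC4'; assumption) | (rule KD1; assumption) | (rule KD2; assumption) |
       (rule KD3; assumption) | (rule KD4; assumption)))
  then show ?thesis by (simp add: xx)
qed

theorem sum_rects_le: "(\<Sum>x\<in>rects. wt x) \<le> 10 ^ 12 * real (m + 1) * A\<^sup>2"
proof -
  have t: "(\<Sum>x\<in>rects. TS (turn x)) = sum TS rects" by (rule sum_turn)
  have t2: "(\<Sum>x\<in>rects. TS (turn (turn x))) = sum TS rects" using sum_turn[of "\<lambda>x. TS (turn x)"] t by simp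
  have t3: "(\<Sum>x\<in>rects. TS (turn (turn (turn x)))) = sum TS rects" using sum_turn[of "\<lambda>x. TS (turn (turn x))"] t2 by simp
  have f: "(\<Sum>x\<in>rects. TS (flip x)) = sum TS rects" by (rule sum_flip)
  have f1: "(\<Sum>x\<in>rects. TS (flip (turn x))) = sum TS rects" using sum_turn[of "\<lambda>x. TS (flip x)"] f by simp
  have f2: "(\<Sum>x\<in>rects. TS (flip (turn (turn x)))) = sum TS rects" using sum_turn[of "\<lambda>x. TS (flip (turn x))"] f1 by simp
  have f3: "(\<Sum>x\<in>rects. TS (flip (turn (turn (turn x))))) = sum TS rects" using sum_turn[of "\<lambda>x. TS (flip (turn (turn x)))"] f2 by simp
  define Z where "Z = real (m + 1) * A\<^sup>2"
  have Z: "A\<^sup>2 \<le> Z" "0 \<le> Z" unfolding Z_def using mult_right_mono[of 1 "real (m + 1)" "A\<^sup>2"] by auto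
  have "(\<Sum>x\<in>rects. wt x) \<le> (\<Sum>x\<in>rects. TS x + TS (turn x) + TS (turn (turn x)) + TS (turn (turn (turn x)))
    + TS (flip x) + TS (flip (turn x)) + TS (flip (turn (turn x))) + TS (flip (turn (turn (turn x)))))"
    by (intro sum_mono wt_le_symmetrized)
  also have "\<dots> = 8 * sum TS rects" by (simp only: sum.distrib t t2 t3 f f1 f2 f3)
  also have "sum TS rects = sum TA rects + sum TB rects + sum TC rects + sum TD rects"
    unfolding sum.distrib[symmetric] by (rule sum.cong) (simp_all add: TS_def)
  also have "\<dots> \<le> 2 * 10 ^ 9 * A\<^sup>2 + 10 ^ 9 * Z + 2 * 10 ^ 9 * Z + 14 * 10 ^ 9 * Z"
    unfolding Z_def mult.assoc[symmetric] by (intro add_mono sum_TA sum_TB sum_TC sum_TD)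
  \<comment> \<open>The total is \<open>152 * 10 ^ 9\<close>, rounded up generously.\<close>
  also have "8 * (2 * 10 ^ 9 * A\<^sup>2 + 10 ^ 9 * Z + 2 * 10 ^ 9 * Z + 14 * 10 ^ 9 * Z) \<le> 10 ^ 12 * Z"
    using Z by simp
  finally show ?thesis by (simp only: Z_def mult.assoc)
qed

end

section \<open>Energy bounds\<close>

lemma sum_Un_le_sum:
  fixes g :: "'x \<Rightarrow> real"
  assumes "finite X" "finite Y" "\<And>x. x \<in> X \<inter> Y \<Longrightarrow> 0 \<le> g x"
  shows "sum g (X \<union> Y) \<le> sum g X + sum g Y"
  using sum.union_inter[OF assms(1,2), of g] sum_nonneg[of "X \<inter> Y" g, OF assms(3)] by linarith

section \<open>Ranking the points by their coefficients\<close>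

lemma dyadic_condensation:
  fixes F :: "nat \<Rightarrow> real"
  assumes anti: "\<And>i j. i \<le> j \<Longrightarrow> F j \<le> F i"
  shows "(\<Sum>j\<le>m. 2 ^ j * F (2 ^ j - 1)) \<le> F 0 + 2 * (\<Sum>i<2 ^ m - 1. F i)"
proof (induction m)
  case (Suc m)
  have "2 ^ m * F (2 ^ Suc m - 1) = (\<Sum>i\<in>{(2::nat) ^ m - 1..<2 ^ Suc m - 1}. F (2 ^ Suc m - 1))" by simp
  also have "\<dots> \<le> (\<Sum>i\<in>{(2::nat) ^ m - 1..<2 ^ Suc m - 1}. F i)" by (intro sum_mono anti) auto
  finally have 1: "2 ^ m * F (2 ^ Suc m - 1) \<le> (\<Sum>i\<in>{(2::nat) ^ m - 1..<2 ^ Suc m - 1}. F i)" .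
  have "(2::nat) ^ m - 1 \<le> 2 ^ Suc m - 1" by (intro diff_le_mono power_increasing) auto
  then have 2: "(\<Sum>i<2 ^ Suc m - 1. F i) = (\<Sum>i<2 ^ m - 1. F i) + (\<Sum>i\<in>{(2::nat) ^ m - 1..<2 ^ Suc m - 1}. F i)"
    by (simp add: lessThan_atLeast0 sum.atLeastLessThan_concat)
  show ?case using Suc 1 unfolding 2 by simp
qed simp

text \<open>The points are sorted by decreasing \<open>f\<close>. The level is the binary logarithm
  of the position counted from 1, rounded down, and \<open>\<phi> j\<close> is the value at the
  first position of level \<open>j\<close>. The factor 3 is \<open>1 + 2\<close> from Cauchy
  condensation.\<close>

lemma exists_ranking:
  assumes finP: "finite P" and f: "\<And>p. p \<in> P \<Longrightarrow> 0 \<le> f p" and m: "card P < 2 ^ (m + 1)"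
  shows "\<exists>lev \<phi>. ranked P lev f \<phi> m (3 * (\<Sum>p\<in>P. (f p)\<^sup>2))"
proof -
  obtain ys where ys: "set ys = P" "distinct ys" using finite_distinct_list[OF finP] by blast
  define xs where "xs = sort_key (\<lambda>p. - f p) ys"
  have xs: "set xs = P" "distinct xs" "sorted (map (\<lambda>p. - f p) xs)"
    using ys by (simp_all add: xs_def)
  define n where "n = length xs"
  have nP: "n = card P" using distinct_card[OF xs(2)] xs(1) by (simp add: n_def)
  have anti: "f (xs ! j) \<le> f (xs ! i)" if "i \<le> j" "j < n" for i j
    using sorted_nth_mono[OF xs(3), of i j] that by (simp add: n_def)
  define idx where "idx p = inv_into {..<n} ((!) xs) p" for p
  have bij: "bij_betw ((!) xs) {..<n} P" using bij_betw_nth[OF xs(2)] xs(1) by (simp add: n_def)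
  have idx: "idx p < n" "xs ! idx p = p" if "p \<in> P" for p
    using bij that inv_into_into[of p "(!) xs" "{..<n}"] f_inv_into_f[of p "(!) xs" "{..<n}"]
    by (auto simp: idx_def bij_betw_def)
  define lev where "lev p = (LEAST j. idx p + 1 < 2 ^ (j + 1))" for p
  have lev_upper: "idx p + 1 < 2 ^ (lev p + 1)" for p
  proof -
    have "idx p + 1 < 2 ^ (idx p + 1 + 1)" by (rule less_trans[OF less_exp]) auto
    then show ?thesis unfolding lev_def by (rule LeastI)
  qed
  have lev_lower: "2 ^ lev p \<le> idx p + 1" for p
  proof (cases "lev p")
    case (Suc k)
    then have "\<not> idx p + 1 < 2 ^ (k + 1)" using not_less_Least[of k "\<lambda>j. idx p + 1 < 2 ^ (j + 1)"] by (simp add: lev_def)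
    then show ?thesis using Suc by simp
  qed simp
  \<comment> \<open>Padding with 0 beyond the last point keeps \<open>F\<close> decreasing, so that
    \<open>\<phi>\<close> is defined at every level.\<close>
  define F where "F i = (if i < n then f (xs ! i) else 0)" for i
  have F0: "0 \<le> F i" for i using f[of "xs ! i"] xs(1) nth_mem[of i xs] by (simp add: F_def n_def)
  have Fanti: "F j \<le> F i" if "i \<le> j" for i j
    using anti[OF that] that F0[of i] by (auto simp: F_def)
  define \<phi> where "\<phi> j = F (2 ^ j - 1)" for j
  have "ranked P lev f \<phi> m (3 * (\<Sum>p\<in>P. (f p)\<^sup>2))"
  proof
    show "lev p \<le> m" if "p \<in> P" for p
    proof -
      have "idx p + 1 < 2 ^ (m + 1)" using idx(1)[OF that] m nP by simp
      then show ?thesis unfolding lev_def by (rule Least_le)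
    qed
    show "f p \<le> \<phi> (lev p)" if "p \<in> P" for p
    proof -
      have "f p = F (idx p)" using idx[OF that] by (simp add: F_def)
      also have "\<dots> \<le> F (2 ^ lev p - 1)" using lev_lower[of p] by (intro Fanti) simp
      finally show ?thesis by (simp add: \<phi>_def)
    qed
    show "\<phi> j \<le> \<phi> i" if "i \<le> j" for i j
      unfolding \<phi>_def using that by (intro Fanti diff_le_mono power_increasing) auto
    show "card {p \<in> P. lev p \<le> i} \<le> 2 * 2 ^ i" for i
    proof -
      have "card {p \<in> P. lev p \<le> i} \<le> card {..<2 * 2 ^ i :: nat}"
      proof (rule card_inj_on_le[of idx])
        show "inj_on idx {p \<in> P. lev p \<le> i}" by (rule inj_on_inverseI[of _ "(!) xs"]) (use idx(2) in auto)
        show "idx ` {p \<in> P. lev p \<le> i} \<subseteq> {..<2 * 2 ^ i}"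
        proof clarsimp
          fix u v assume "lev (u, v) \<le> i"
          then have "(2::nat) ^ (lev (u, v) + 1) \<le> 2 ^ (i + 1)" by (intro power_increasing) auto
          with lev_upper[of "(u, v)"] have "idx (u, v) + 1 < 2 ^ (i + 1)" by (rule less_le_trans)
          then show "idx (u, v) < 2 * 2 ^ i" by simp
        qed
      qed simp
      then show ?thesis by simp
    qed
    have sumF: "(\<Sum>i<k. (F i)\<^sup>2) \<le> (\<Sum>p\<in>P. (f p)\<^sup>2)" for k
    proof -
      have "(\<Sum>i<k. (F i)\<^sup>2) = (\<Sum>i\<in>{..<k} \<inter> {..<n}. (F i)\<^sup>2)"
        by (rule sum.mono_neutral_right) (auto simp: F_def)
      also have "\<dots> \<le> (\<Sum>i<n. (F i)\<^sup>2)" by (intro sum_mono2) auto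
      also have "\<dots> = (\<Sum>i<n. (f (xs ! i))\<^sup>2)" by (simp add: F_def)
      also have "\<dots> = (\<Sum>p\<in>P. (f p)\<^sup>2)" using bij by (rule sum.reindex_bij_betw)
      finally show ?thesis .
    qed
    have "(\<Sum>j\<le>m. 2 ^ j * (\<phi> j)\<^sup>2) \<le> (F 0)\<^sup>2 + 2 * (\<Sum>i<2 ^ m - 1. (F i)\<^sup>2)"
      unfolding \<phi>_def using Fanti F0 by (intro dyadic_condensation power_mono) auto
    also have "\<dots> \<le> 3 * (\<Sum>p\<in>P. (f p)\<^sup>2)" using sumF[of 1] sumF[of "2 ^ m - 1"] by simp
    finally show "(\<Sum>j\<le>m. 2 ^ j * (\<phi> j)\<^sup>2) \<le> 3 * (\<Sum>p\<in>P. (f p)\<^sup>2)" .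
  qed (use finP f F0 in \<open>auto simp: \<phi>_def\<close>)
  then show ?thesis by blast
qed

section \<open>The energy of the quadratic form\<close>

definition qform :: "int \<Rightarrow> int \<Rightarrow> int \<times> int \<Rightarrow> int" where
  "qform a b k = a * (fst k)\<^sup>2 + b * (snd k)\<^sup>2"

definition quads :: "int \<Rightarrow> int \<Rightarrow> (int \<times> int) set \<Rightarrow> ((int \<times> int) \<times> (int \<times> int) \<times> (int \<times> int) \<times> (int \<times> int)) set" where
  "quads a b P = {(k1, k2, k3, k4). k1 \<in> P \<and> k2 \<in> P \<and> k3 \<in> P \<and> k4 \<in> P \<and> k1 + k2 = k3 + k4 \<and>
     qform a b k1 + qform a b k2 = qform a b k3 + qform a b k4}"

definition energy :: "int \<Rightarrow> int \<Rightarrow> (int \<times> int) set \<Rightarrow> (int \<times> int \<Rightarrow> real) \<Rightarrow> real" where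
  "energy a b P f = (\<Sum>(k1, k2, k3, k4)\<in>quads a b P. f k1 * f k2 * (f k3 * f k4))"

lemma finite_quads: "finite P \<Longrightarrow> finite (quads a b P)"
  by (rule finite_subset[of _ "P \<times> P \<times> P \<times> P"]) (auto simp: quads_def)

text \<open>Eliminating \<open>k2\<close> polarises the form: \<open>k1\<close>, \<open>k2\<close>
  are opposite corners, and the sides leaving \<open>k1\<close> are orthogonal.\<close>

lemma quad_orthogonal:
  assumes "k1 + k2 = k3 + k4" "qform a b k1 + qform a b k2 = qform a b k3 + qform a b k4"
  shows "a * (fst k3 - fst k1) * (fst k4 - fst k1) + b * (snd k3 - snd k1) * (snd k4 - snd k1) = 0"
proof -
  have 1: "fst k2 = fst k3 + fst k4 - fst k1" "snd k2 = snd k3 + snd k4 - snd k1"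
    using assms(1) by (auto simp: prod_eq_iff)
  have "2 * (a * (fst k3 - fst k1) * (fst k4 - fst k1) + b * (snd k3 - snd k1) * (snd k4 - snd k1)) = 0"
    using assms(2) unfolding qform_def 1 by algebra
  then show ?thesis by simp
qed

text \<open>The degenerate quadruples, with \<open>k1 = k3\<close> or \<open>k1 = k4\<close>,
  contribute at most the square of the sum each. All others are rectangles once the corners are
  reordered cyclically as \<open>k1\<close>, \<open>k3\<close>, \<open>k2\<close>,
  \<open>k4\<close>.\<close>

lemma (in anisotropic) energy_le_log:
  assumes finP: "finite P" and f: "\<And>p. p \<in> P \<Longrightarrow> 0 \<le> f p" and m: "card P < 2 ^ (m + 1)"
  shows "energy a b P f \<le> 10 ^ 13 * real (m + 1) * (\<Sum>p\<in>P. (f p)\<^sup>2)\<^sup>2"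
proof -
  define A where "A = 3 * (\<Sum>p\<in>P. (f p)\<^sup>2)"
  obtain lev \<phi> where "ranked P lev f \<phi> m A" using exists_ranking[of P f m] finP f m unfolding A_def by blast
  then interpret ranked P lev f \<phi> m A .
  interpret rectangle_sum P lev f \<phi> m A a b ..
  define g where "g = (\<lambda>(k1, k2, k3, k4). f k1 * f k2 * (f k3 * f k4))"
  define X1 where "X1 = {(k1, k2, k3, k4) \<in> quads a b P. k1 = k3}"
  define X2 where "X2 = {(k1, k2, k3, k4) \<in> quads a b P. k1 = k4}"
  define X3 where "X3 = {(k1, k2, k3, k4) \<in> quads a b P. k1 \<noteq> k3 \<and> k1 \<noteq> k4}"
  have fin: "finite X1" "finite X2" "finite X3"
    using finite_quads[OF finP] by (auto simp: X1_def X2_def X3_def intro: finite_subset[rotated])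
  have g0: "0 \<le> g x" if "x \<in> quads a b P" for x
    using that f by (auto simp: g_def quads_def)
  define T where "T = (\<Sum>p\<in>P. (f p)\<^sup>2)"
  have prod: "(\<Sum>y\<in>P \<times> P. (f (fst y))\<^sup>2 * (f (snd y))\<^sup>2) = T\<^sup>2"
    unfolding T_def power2_eq_square[of "sum _ _"] sum_product by (simp add: sum.cartesian_product split_def)
  have deg1: "sum g X1 \<le> T\<^sup>2"
    unfolding prod[symmetric]
  proof (rule sum_le_via_injection[where g = "\<lambda>(k1, k2, k3, k4). (k1, k2)"])
    show "inj_on (\<lambda>(k1, k2, k3, k4). (k1, k2)) X1" by (rule inj_onI) (auto simp: X1_def quads_def)
    show "g x \<le> (f (fst ((\<lambda>(k1, k2, k3, k4). (k1, k2)) x)))\<^sup>2 * (f (snd ((\<lambda>(k1, k2, k3, k4). (k1, k2)) x)))\<^sup>2" if "x \<in> X1" for x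
    proof -
      obtain k1 k2 k3 k4 where x: "x = (k1, k2, k3, k4)" by (metis prod_cases4)
      then have "k3 = k1" "k1 + k2 = k1 + k4" using that by (auto simp: X1_def quads_def)
      then show ?thesis by (simp add: x g_def power2_eq_square)
    qed
  qed (use finP in \<open>auto simp: X1_def quads_def\<close>)
  have deg2: "sum g X2 \<le> T\<^sup>2"
    unfolding prod[symmetric]
  proof (rule sum_le_via_injection[where g = "\<lambda>(k1, k2, k3, k4). (k1, k2)"])
    show "inj_on (\<lambda>(k1, k2, k3, k4). (k1, k2)) X2"
      by (rule inj_onI) (auto simp: X2_def quads_def add.commute)
    show "g x \<le> (f (fst ((\<lambda>(k1, k2, k3, k4). (k1, k2)) x)))\<^sup>2 * (f (snd ((\<lambda>(k1, k2, k3, k4). (k1, k2)) x)))\<^sup>2" if "x \<in> X2" for x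
    proof -
      obtain k1 k2 k3 k4 where x: "x = (k1, k2, k3, k4)" by (metis prod_cases4)
      then have "k4 = k1" "k1 + k2 = k1 + k3" using that by (auto simp: X2_def quads_def add.commute)
      then show ?thesis by (simp add: x g_def power2_eq_square)
    qed
  qed (use finP in \<open>auto simp: X2_def quads_def\<close>)
  have "sum g X3 \<le> (\<Sum>x\<in>rects. wt x)"
  proof (rule sum_le_via_injection[where g = "\<lambda>(k1, k2, k3, k4). (k1, k3, k2, k4)"])
    show "inj_on (\<lambda>(k1, k2, k3, k4). (k1, k3, k2, k4)) X3" by (rule inj_onI) auto
    show "(\<lambda>(k1, k2, k3, k4). (k1, k3, k2, k4)) ` X3 \<subseteq> rects"
    proof
      fix y assume "y \<in> (\<lambda>(k1, k2, k3, k4). (k1, k3, k2, k4)) ` X3"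
      then obtain k1 k2 k3 k4 where y: "y = (k1, k3, k2, k4)" and x: "(k1, k2, k3, k4) \<in> X3" by auto
      then have q: "k1 + k2 = k3 + k4" "qform a b k1 + qform a b k2 = qform a b k3 + qform a b k4"
        by (simp_all add: X3_def quads_def)
      then show "y \<in> rects" using x quad_orthogonal[OF q] unfolding y
        by (simp add: rects_def X3_def quads_def perp_def)
    qed
    show "0 \<le> wt y" if "y \<in> rects" for y using that f by (auto simp: wt_def rects_def)
  qed (auto simp: g_def wt_def mult_ac)
  also have "\<dots> \<le> 10 ^ 12 * real (m + 1) * A\<^sup>2" by (rule sum_rects_le)
  finally have nondeg: "sum g X3 \<le> 9 * 10 ^ 12 * (real (m + 1) * T\<^sup>2)" 
    unfolding A_def T_def[symmetric] power_mult_distrib by (simp add: mult_ac distrib_left distrib_right)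
  have "energy a b P f = sum g (quads a b P)" by (simp add: energy_def g_def)
  also have "\<dots> \<le> sum g (X1 \<union> (X2 \<union> X3))"
    using fin g0 by (intro sum_mono2) (auto simp: X1_def X2_def X3_def)
  also have "\<dots> \<le> sum g X1 + sum g (X2 \<union> X3)"
    using fin g0 by (intro sum_Un_le_sum) (auto simp: X1_def X2_def X3_def)
  also have "\<dots> \<le> sum g X1 + (sum g X2 + sum g X3)"
    using fin g0 by (intro add_left_mono sum_Un_le_sum) (auto simp: X1_def X2_def X3_def)
  also have "\<dots> \<le> 2 * T\<^sup>2 + 9 * 10 ^ 12 * (real (m + 1) * T\<^sup>2)" using deg1 deg2 nondeg by simp
  also have "\<dots> \<le> 10 ^ 13 * (real (m + 1) * T\<^sup>2)"
  proof -
    have "1 * T\<^sup>2 \<le> real (m + 1) * T\<^sup>2" by (intro mult_right_mono) auto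
    have *: "2 * y + 9 * 10 ^ 12 * z \<le> 10 ^ 13 * z" if "1 * y \<le> z" "0 \<le> y" for y z :: real
      using that by simp
    show ?thesis by (rule *) (fact, simp)
  qed
  finally show ?thesis by (simp only: T_def mult.assoc)
qed

lemma finite_freq_box [simp]: "finite (freq_box N)"
  by (simp add: freq_box_def)

lemma card_freq_box: "card (freq_box N) = (2 * N + 1)\<^sup>2"
proof -
  have "card {- int N..int N} = 2 * N + 1" by simp
  then show ?thesis unfolding freq_box_def card_cartesian_product by (simp only: power2_eq_square)
qed

text \<open>The inequality of means reduces the energy to the number of pairs
  \<open>(k3, k4)\<close> for given \<open>(k1, k2)\<close>. There are \<open>2 * N + 1\<close>
  columns with two pairs each, at most \<open>6 * N\<close> in all.\<close>

lemma energy_le_linear: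
  assumes b: "b \<noteq> 0" and N: "N \<ge> 1"
  shows "energy a b (freq_box N) f \<le> 6 * real N * (\<Sum>p\<in>freq_box N. (f p)\<^sup>2)\<^sup>2"
proof -
  define P where "P = freq_box N"
  have finP: "finite P" by (simp add: P_def)
  define G where "G k1 k2 = {(k3, k4). (k1, k2, k3, k4) \<in> quads a b P}" for k1 k2
  have finG: "finite (G k1 k2)" for k1 k2
    by (rule finite_subset[of _ "P \<times> P"]) (use finP in \<open>auto simp: G_def quads_def\<close>)
  have cardG: "card (G k1 k2) \<le> 6 * N" for k1 k2
  proof -
    define V where "V x = {k \<in> G k1 k2. fst (fst k) = x}" for x
    have V: "card (V x) \<le> 2" for x
    proof (cases "V x = {}")
      case False
      then obtain k3 k4 where k: "(k3, k4) \<in> V x" by auto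
      have "V x \<subseteq> {(k3, k4), ((x, snd k1 + snd k2 - snd k3), (fst k1 + fst k2 - x, snd k3))}"
      proof
        fix l assume l: "l \<in> V x"
        obtain l3 l4 where ll: "l = (l3, l4)" by (cases l)
        have e: "fst l3 = x" "fst k3 = x" "fst l4 = fst k1 + fst k2 - x" "fst k4 = fst k1 + fst k2 - x"
            "snd l4 = snd k1 + snd k2 - snd l3" "snd k4 = snd k1 + snd k2 - snd k3"
          using l k by (auto simp: ll V_def G_def quads_def prod_eq_iff)
        have "qform a b l3 + qform a b l4 = qform a b k3 + qform a b k4"
          using l k by (auto simp: ll V_def G_def quads_def)
        \<comment> \<open>Within a column the condition is a quadratic equation for
          \<open>snd k3\<close>; its roots have sum \<open>snd k1 + snd k2\<close>, so one solution
          determines the other.\<close>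
        then have "2 * b * ((snd l3 - snd k3) * (snd l3 + snd k3 - snd k1 - snd k2)) = 0"
          unfolding qform_def e by algebra
        then have "snd l3 = snd k3 \<or> snd l3 = snd k1 + snd k2 - snd k3" using b by auto
        then show "l \<in> {(k3, k4), ((x, snd k1 + snd k2 - snd k3), (fst k1 + fst k2 - x, snd k3))}"
          using e by (auto simp: ll prod_eq_iff)
      qed
      then have "card (V x) \<le> card {(k3, k4), ((x, snd k1 + snd k2 - snd k3), (fst k1 + fst k2 - x, snd k3))}"
        by (intro card_mono) auto
      also have "\<dots> \<le> 2" by (simp add: card_insert_if)
      finally show ?thesis .
    qed simp
    have "fst (fst k) \<in> {- int N..int N}" if "k \<in> G k1 k2" for k
      using that by (cases k) (simp add: G_def quads_def P_def freq_box_def mem_Times_iff)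
    then have "G k1 k2 = (\<Union>x\<in>{- int N..int N}. V x)" by (auto simp: V_def)
    then have "card (G k1 k2) \<le> (\<Sum>x\<in>{- int N..int N}. card (V x))" by (simp add: card_UN_le)
    also have "\<dots> \<le> (\<Sum>x\<in>{- int N..int N}. 2)" by (intro sum_mono V)
    also have "\<dots> \<le> 6 * N" using N by simp
    finally show ?thesis .
  qed
  define h where "h k = (f (fst k))\<^sup>2 * (f (fst (snd k)))\<^sup>2" for k :: "(int \<times> int) \<times> (int \<times> int) \<times> (int \<times> int) \<times> (int \<times> int)"
  define sw where "sw = (\<lambda>(k1, k2, k3, k4). (k3, k4, k1, k2) :: (int \<times> int) \<times> (int \<times> int) \<times> (int \<times> int) \<times> (int \<times> int))"
  have "energy a b P f \<le> (\<Sum>k\<in>quads a b P. (h k + h (sw k)) / 2)"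
    unfolding energy_def
  proof (rule sum_mono)
    fix k assume "k \<in> quads a b P"
    obtain k1 k2 k3 k4 where k: "k = (k1, k2, k3, k4)" by (metis prod_cases4)
    have "0 \<le> (f k1 * f k2 - f k3 * f k4)\<^sup>2" by simp
    then show "(case k of (k1, k2, k3, k4) \<Rightarrow> f k1 * f k2 * (f k3 * f k4)) \<le> (h k + h (sw k)) / 2"
      by (simp add: k h_def sw_def power2_eq_square algebra_simps)
  qed
  also have "\<dots> = ((\<Sum>k\<in>quads a b P. h k) + (\<Sum>k\<in>quads a b P. h (sw k))) / 2"
    by (simp add: sum_divide_distrib[symmetric] sum.distrib)
  also have "(\<Sum>k\<in>quads a b P. h (sw k)) = (\<Sum>k\<in>quads a b P. h k)"
    by (rule sum.reindex_bij_witness[of _ sw sw]) (auto simp: sw_def quads_def)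
  also have "((\<Sum>k\<in>quads a b P. h k) + (\<Sum>k\<in>quads a b P. h k)) / 2 = (\<Sum>k\<in>quads a b P. h k)" by simp
  also have "quads a b P = (SIGMA k1:P. SIGMA k2:P. G k1 k2)"
    by (auto simp: G_def quads_def)
  also have "(\<Sum>k\<in>\<dots>. h k) = (\<Sum>k1\<in>P. \<Sum>k2\<in>P. real (card (G k1 k2)) * ((f k1)\<^sup>2 * (f k2)\<^sup>2))"
    using finP finG by (simp add: sum_over_Sigma h_def)
  also have "\<dots> \<le> (\<Sum>k1\<in>P. \<Sum>k2\<in>P. real (6 * N) * ((f k1)\<^sup>2 * (f k2)\<^sup>2))"
    using cardG by (intro sum_mono mult_right_mono) (auto simp: of_nat_le_iff simp del: of_nat_mult)
  also have "\<dots> = 6 * real N * ((\<Sum>p\<in>P. (f p)\<^sup>2) * (\<Sum>p\<in>P. (f p)\<^sup>2))"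
    unfolding sum_product unfolding sum_distrib_left by simp
  finally show ?thesis by (simp add: P_def power2_eq_square)
qed

section \<open>Fourier analysis on the torus\<close>

definition circle :: "real measure" where
  "circle = restrict_space lborel {0..2 * pi}"

lemma finite_measure_circle: "finite_measure circle"
  by (rule finite_measureI) (simp add: circle_def emeasure_restrict_space space_restrict_space)

lemma integrable_cis: "integrable circle (\<lambda>t. cis (of_int n * t))"
  and integral_cis: "(LINT t|circle. cis (of_int n * t)) = (if n = 0 then of_real (2 * pi) else 0)"
proof -
  define F where "F = (\<lambda>t::real. if n = 0 then of_real t else cis (of_int n * t) / (\<i> * of_int n))"
  have d: "(F has_vector_derivative cis (of_int n * t)) (at t within {0..2 * pi})" for t
  proof (cases "n = 0")
    case True
    then show ?thesis unfolding F_def by (auto intro!: derivative_eq_intros has_vector_derivative_real_field)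
  next
    case False
    have "((\<lambda>t. exp (\<i> * of_int n * of_real t) / (\<i> * of_int n)) has_vector_derivative exp (\<i> * of_int n * of_real t)) (at t within {0..2 * pi})"
      using False by (auto intro!: derivative_eq_intros has_vector_derivative_real_field simp: field_simps)
    then show ?thesis using False by (simp add: F_def cis_conv_exp mult_ac)
  qed
  have c: "continuous_on {0..2 * pi} (\<lambda>t. cis (of_int n * t))" by (intro continuous_intros)
  have b: "has_bochner_integral lborel (\<lambda>t. indicator {0..2 * pi} t *\<^sub>R cis (of_int n * t)) (F (2 * pi) - F 0)"
    using has_bochner_integral_FTC_Icc[OF _ d c] by simp
  have v: "F (2 * pi) - F 0 = (if n = 0 then of_real (2 * pi) else 0)"
    using cis_multiple_2pi[of "of_int n"] by (auto simp: F_def mult_ac)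
  show "integrable circle (\<lambda>t. cis (of_int n * t))"
    unfolding circle_def by (subst integrable_restrict_space) (use b in \<open>auto simp: has_bochner_integral_iff\<close>)
  show "(LINT t|circle. cis (of_int n * t)) = (if n = 0 then of_real (2 * pi) else 0)"
    unfolding circle_def v[symmetric] by (subst integral_restrict_space) (use b in \<open>auto simp: has_bochner_integral_iff\<close>)
qed

lemma (in pair_sigma_finite) integrable_times:
  fixes f g :: "_ \<Rightarrow> complex"
  assumes f: "integrable M1 f" and g: "integrable M2 g"
  shows "integrable (M1 \<Otimes>\<^sub>M M2) (\<lambda>x. f (fst x) * g (snd x))"
proof (rule Fubini_integrable)
  have [measurable]: "f \<in> borel_measurable M1" "g \<in> borel_measurable M2" using f g by auto
  show "(\<lambda>x. f (fst x) * g (snd x)) \<in> borel_measurable (M1 \<Otimes>\<^sub>M M2)" by measurable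
  show "integrable M1 (\<lambda>x. \<integral> y. norm (f (fst (x, y)) * g (snd (x, y))) \<partial>M2)"
    using f by (simp add: norm_mult)
  show "AE x in M1. integrable M2 (\<lambda>y. f (fst (x, y)) * g (snd (x, y)))" using g by simp
qed

lemma (in pair_sigma_finite) integral_times:
  fixes f g :: "_ \<Rightarrow> complex"
  assumes f: "integrable M1 f" and g: "integrable M2 g"
  shows "(LINT x|(M1 \<Otimes>\<^sub>M M2). f (fst x) * g (snd x)) = (LINT x|M1. f x) * (LINT y|M2. g y)"
  using integral_fst'[OF integrable_times[OF assms]] by simp

lemma torus_set [simp]: "{0..2 * pi} \<times> {0..2 * pi} \<in> sets (borel :: (real \<times> real) measure)"
  by (intro borel_closed closed_Times) auto

text \<open>\<open>torus\<close> is a restriction of Lebesgue measure on the plane. Moving the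
  indicator into the integrand exposes a product measure, to which Fubini applies.\<close>

lemma integrable_torus_iff:
  fixes f :: "real \<times> real \<Rightarrow> complex"
  shows "integrable torus f \<longleftrightarrow> integrable (lborel \<Otimes>\<^sub>M lborel) (\<lambda>x. indicator ({0..2 * pi} \<times> {0..2 * pi}) x *\<^sub>R f x)"
  unfolding torus_def by (subst integrable_restrict_space) (simp_all add: lborel_prod)

lemma integral_torus:
  fixes f :: "real \<times> real \<Rightarrow> complex"
  shows "(LINT x|torus. f x) = (LINT x|(lborel \<Otimes>\<^sub>M lborel). indicator ({0..2 * pi} \<times> {0..2 * pi}) x *\<^sub>R f x)"
  unfolding torus_def by (subst integral_restrict_space) (simp_all add: lborel_prod)

lemma finite_measure_torus: "finite_measure torus"
proof -
  have "emeasure lborel ({0..2 * pi} \<times> {0..2 * pi} :: (real \<times> real) set) = emeasure lborel {0..2 * pi :: real} * emeasure lborel {0..2 * pi :: real}"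
    unfolding lborel_prod[symmetric] by (intro sigma_finite_measure.emeasure_pair_measure_Times) (auto intro: lborel.sigma_finite_measure_axioms)
  then show ?thesis
    by (intro finite_measureI) (simp add: torus_def emeasure_restrict_space space_restrict_space ennreal_mult_eq_top_iff)
qed

lemma integrable_character: "integrable torus (character k)"
  and integral_character: "(LINT x|torus. character k x) = (if k = 0 then of_real ((2 * pi)\<^sup>2) else 0)"
proof -
  define h :: "int \<Rightarrow> real \<Rightarrow> complex" where "h n t = indicator {0..2 * pi} t *\<^sub>R cis (of_int n * t)" for n t
  have h: "integrable lborel (h n)" "(LINT t|lborel. h n t) = (if n = 0 then of_real (2 * pi) else 0)" for n
    using integrable_cis[of n] integral_cis[of n]
    by (simp_all add: circle_def h_def[abs_def] integrable_restrict_space integral_restrict_space)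
  have e: "(\<lambda>x. indicator ({0..2 * pi} \<times> {0..2 * pi}) x *\<^sub>R character k x) = (\<lambda>x. h (fst k) (fst x) * h (snd k) (snd x))"
    by (auto simp: fun_eq_iff h_def character_def cis_mult indicator_def)
  show "integrable torus (character k)"
    unfolding integrable_torus_iff e by (rule lborel_pair.integrable_times[OF h(1) h(1)])
  show "(LINT x|torus. character k x) = (if k = 0 then of_real ((2 * pi)\<^sup>2) else 0)"
    unfolding integral_torus e lborel_pair.integral_times[OF h(1) h(1)] h(2)
    by (auto simp: prod_eq_iff power2_eq_square)
qed

lemma character_mult: "character k x * character l x = character (k + l) x"
  by (simp add: character_def cis_mult algebra_simps)

lemma cnj_character: "cnj (character k x) = character (- k) x"
  by (simp add: character_def cis_cnj)

lemma cmod_character [simp]: "cmod (character k x) = 1"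
  by (simp add: character_def)

section \<open>Space-time waves and the evolution\<close>

definition wave :: "int \<Rightarrow> int \<times> int \<Rightarrow> real \<times> real \<times> real \<Rightarrow> complex" where
  "wave n k z = cis (of_int n * fst z) * character k (snd z)"

lemma wave_mult: "wave n k z * wave m l z = wave (n + m) (k + l) z"
  by (simp add: wave_def cis_mult character_mult[symmetric] algebra_simps)

lemma cnj_wave: "cnj (wave n k z) = wave (- n) (- k) z"
  by (simp add: wave_def cis_cnj cnj_character)

lemma integrable_wave: "integrable spacetime (wave n k)"
  and integral_wave: "(LINT z|spacetime. wave n k z) = (if n = 0 \<and> k = 0 then of_real ((2 * pi) ^ 3) else 0)"
proof -
  interpret c: finite_measure circle by (rule finite_measure_circle)
  interpret t: finite_measure torus by (rule finite_measure_torus)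
  interpret pair_sigma_finite circle torus by unfold_locales
  have s: "spacetime = circle \<Otimes>\<^sub>M torus" by (simp add: spacetime_def circle_def)
  show "integrable spacetime (wave n k)"
    unfolding s wave_def[abs_def] by (rule integrable_times[OF integrable_cis integrable_character])
  show "(LINT z|spacetime. wave n k z) = (if n = 0 \<and> k = 0 then of_real ((2 * pi) ^ 3) else 0)"
    unfolding s wave_def integral_times[OF integrable_cis integrable_character] integral_cis integral_character
    by (auto simp: power2_eq_square power3_eq_cube)
qed

lemma fourier_coeff_trig:
  assumes "finite B"
  shows "fourier_coeff (\<lambda>x. \<Sum>k\<in>B. c k * character k x) j = (if j \<in> B then c j else 0)"
proof -
  have "(LINT x|torus. (\<Sum>k\<in>B. c k * character k x) * character (- j) x)
      = (LINT x|torus. (\<Sum>k\<in>B. c k * character (k - j) x))"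
    by (intro Bochner_Integration.integral_cong refl) (simp add: sum_distrib_right mult.assoc character_mult)
  also have "\<dots> = (\<Sum>k\<in>B. c k * (LINT x|torus. character (k - j) x))"
    by (simp add: integrable_character)
  also have "\<dots> = (\<Sum>k\<in>B. if k = j then c j * of_real ((2 * pi)\<^sup>2) else 0)"
    by (intro sum.cong refl) (auto simp: integral_character)
  finally show ?thesis using assms by (simp add: fourier_coeff_def sum.delta')
qed

text \<open>From \<open>n = N\<close> on the square partial sums no longer change, so
  \<open>lim\<close> is their common value.\<close>

lemma propagator_trig:
  "propagator a b t (\<lambda>x. \<Sum>k\<in>freq_box N. c k * character k x) x
     = (\<Sum>k\<in>freq_box N. c k * wave (- qform a b k) k (t, x))"
proof -
  have "(\<Sum>k\<in>freq_box n. cis (- t * of_int (a * (fst k)\<^sup>2 + b * (snd k)\<^sup>2)) *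
        fourier_coeff (\<lambda>x. \<Sum>k\<in>freq_box N. c k * character k x) k * character k x)
     = (\<Sum>k\<in>freq_box N. c k * wave (- qform a b k) k (t, x))" if "n \<ge> N" for n
  proof -
    have "freq_box N \<subseteq> freq_box n" using that by (auto simp: freq_box_def)
    then have "(\<Sum>k\<in>freq_box n. cis (- t * of_int (a * (fst k)\<^sup>2 + b * (snd k)\<^sup>2)) *
        fourier_coeff (\<lambda>x. \<Sum>k\<in>freq_box N. c k * character k x) k * character k x)
       = (\<Sum>k\<in>freq_box N. cis (- t * of_int (a * (fst k)\<^sup>2 + b * (snd k)\<^sup>2)) *
        fourier_coeff (\<lambda>x. \<Sum>k\<in>freq_box N. c k * character k x) k * character k x)"
      by (intro sum.mono_neutral_right) (auto simp: fourier_coeff_trig)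
    also have "\<dots> = (\<Sum>k\<in>freq_box N. c k * wave (- qform a b k) k (t, x))"
    proof (intro sum.cong refl)
      fix k assume "k \<in> freq_box N"
      moreover have "cis (- t * of_int (a * (fst k)\<^sup>2 + b * (snd k)\<^sup>2)) = cis (of_int (- qform a b k) * t)"
        by (rule arg_cong[of _ _ cis]) (simp add: qform_def algebra_simps)
      ultimately show "cis (- t * of_int (a * (fst k)\<^sup>2 + b * (snd k)\<^sup>2)) *
          fourier_coeff (\<lambda>x. \<Sum>k\<in>freq_box N. c k * character k x) k * character k x
        = c k * wave (- qform a b k) k (t, x)"
        by (simp only: fourier_coeff_trig finite_freq_box wave_def fst_conv snd_conv if_True mult_ac)
    qed
    finally show ?thesis .
  qed
  then have "(\<lambda>n. \<Sum>k\<in>freq_box n. cis (- t * of_int (a * (fst k)\<^sup>2 + b * (snd k)\<^sup>2)) *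
        fourier_coeff (\<lambda>x. \<Sum>k\<in>freq_box N. c k * character k x) k * character k x)
     \<longlonglongrightarrow> (\<Sum>k\<in>freq_box N. c k * wave (- qform a b k) k (t, x))"
    by (intro tendsto_eventually eventually_sequentiallyI[of N])
  then show ?thesis unfolding propagator_def by (rule limI)
qed

lemma proj_le_eq: "proj_le N f = (\<lambda>x. \<Sum>k\<in>freq_box N. fourier_coeff f k * character k x)"
  by (simp add: fun_eq_iff proj_le_def)

definition evolution :: "int \<Rightarrow> int \<Rightarrow> (int \<times> int) set \<Rightarrow> (int \<times> int \<Rightarrow> complex) \<Rightarrow> real \<times> real \<times> real \<Rightarrow> complex" where
  "evolution a b B c z = (\<Sum>k\<in>B. c k * wave (- qform a b k) k z)"

lemma propagator_proj:
  "(\<lambda>(t, x). propagator a b t (proj_le N \<phi>) x) = evolution a b (freq_box N) (fourier_coeff \<phi>)"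
  by (auto simp: fun_eq_iff proj_le_eq propagator_trig evolution_def)

lemma evolution_measurable: "evolution a b B c \<in> borel_measurable spacetime"
proof -
  have "wave n k \<in> borel_measurable spacetime" for n k using integrable_wave by (rule borel_measurable_integrable)
  then show ?thesis unfolding evolution_def[abs_def] by (intro borel_measurable_sum borel_measurable_times borel_measurable_const)
qed

lemma sum_quads:
  assumes "finite B"
  shows "(\<Sum>(k1, k2, k3, k4)\<in>quads a b B. h k1 k2 k3 k4)
    = (\<Sum>k1\<in>B. \<Sum>k2\<in>B. \<Sum>k3\<in>B. \<Sum>k4\<in>B. if qform a b k1 + qform a b k2 = qform a b k3 + qform a b k4 \<and> k1 + k2 = k3 + k4
        then h k1 k2 k3 k4 else 0)"
proof -
  define g where "g = (\<lambda>(k1, k2, k3, k4). if qform a b k1 + qform a b k2 = qform a b k3 + qform a b k4 \<and> k1 + k2 = k3 + k4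
        then h k1 k2 k3 k4 else 0)"
  have "(\<Sum>(k1, k2, k3, k4)\<in>quads a b B. h k1 k2 k3 k4) = (\<Sum>k\<in>B \<times> B \<times> B \<times> B. g k)"
  proof (rule sum.mono_neutral_cong_left)
    show "\<forall>k\<in>B \<times> B \<times> B \<times> B - quads a b B. g k = 0"
    proof
      fix k assume k: "k \<in> B \<times> B \<times> B \<times> B - quads a b B"
      obtain k1 k2 k3 k4 where "k = (k1, k2, k3, k4)" by (metis prod_cases4)
      then show "g k = 0" using k by (auto simp: quads_def g_def)
    qed
    show "(case k of (k1, k2, k3, k4) \<Rightarrow> h k1 k2 k3 k4) = g k" if "k \<in> quads a b B" for k
    proof -
      obtain k1 k2 k3 k4 where "k = (k1, k2, k3, k4)" by (metis prod_cases4)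
      then show ?thesis using that by (simp add: quads_def g_def)
    qed
  qed (use assms in \<open>auto simp: quads_def\<close>)
  also have "\<dots> = (\<Sum>k1\<in>B. \<Sum>k2\<in>B. \<Sum>k3\<in>B. \<Sum>k4\<in>B. g (k1, k2, k3, k4))"
    using assms by (simp add: sum_over_Sigma)
  finally show ?thesis by (simp add: g_def)
qed

text \<open>The fourth power is a product of two copies of the evolution and two of its conjugate.
  Each fourfold product of waves is again one wave, and it has nonzero integral exactly when its
  time and space frequencies both vanish.\<close>

lemma evolution_fourth_power:
  assumes "finite B"
  shows "integrable spacetime (\<lambda>z. cmod (evolution a b B c z) ^ 4)"
    and "of_real (LINT z|spacetime. cmod (evolution a b B c z) ^ 4)
       = of_real ((2 * pi) ^ 3) * (\<Sum>(k1, k2, k3, k4)\<in>quads a b B. c k1 * c k2 * (cnj (c k3) * cnj (c k4)))"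
proof -
  let ?Q = "qform a b"
  define C where "C k1 k2 k3 k4 = c k1 * c k2 * (cnj (c k3) * cnj (c k4))" for k1 k2 k3 k4
  define w where "w k1 k2 k3 k4 = wave (- ?Q k1 + (- ?Q k2 + (?Q k3 + ?Q k4))) (k1 + (k2 + (- k3 + - k4)))" for k1 k2 k3 k4
  define G where "G z = (\<Sum>k1\<in>B. \<Sum>k2\<in>B. \<Sum>k3\<in>B. \<Sum>k4\<in>B. C k1 k2 k3 k4 * w k1 k2 k3 k4 z)" for z
  have G: "of_real (cmod (evolution a b B c z) ^ 4) = G z" for z
  proof -
    define e where "e k = c k * wave (- ?Q k) k z" for k
    define e' where "e' k = cnj (c k) * wave (?Q k) (- k) z" for k
    have u: "evolution a b B c z = sum e B" "cnj (evolution a b B c z) = sum e' B"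
      by (simp_all add: evolution_def e_def[abs_def] e'_def[abs_def] cnj_wave)
    have "complex_of_real (cmod (evolution a b B c z) ^ 4) = (evolution a b B c z * cnj (evolution a b B c z))\<^sup>2"
      unfolding complex_norm_square[symmetric] by (simp flip: of_real_power power_mult)
    also have "\<dots> = sum e B * (sum e B * (sum e' B * sum e' B))"
      unfolding power2_eq_square u(2) unfolding u(1) by (simp only: mult_ac)
    also have "\<dots> = (\<Sum>k1\<in>B. \<Sum>k2\<in>B. \<Sum>k3\<in>B. \<Sum>k4\<in>B. e k1 * (e k2 * (e' k3 * e' k4)))"
      by (simp only: sum_distrib_left[symmetric] sum_distrib_right[symmetric])
    also have "\<dots> = G z"
      unfolding G_def
    proof (intro sum.cong refl)
      fix k1 k2 k3 k4
      have "e k1 * (e k2 * (e' k3 * e' k4)) = C k1 k2 k3 k4 * (wave (- ?Q k1) k1 z * (wave (- ?Q k2) k2 z * (wave (?Q k3) (- k3) z * wave (?Q k4) (- k4) z)))"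
        by (simp add: e_def e'_def C_def mult_ac)
      then show "e k1 * (e k2 * (e' k3 * e' k4)) = C k1 k2 k3 k4 * w k1 k2 k3 k4 z"
        by (simp only: wave_mult w_def)
    qed
    finally show ?thesis .
  qed
  have iw: "integrable spacetime (w k1 k2 k3 k4)" for k1 k2 k3 k4 by (simp add: w_def integrable_wave)
  have iG: "integrable spacetime G"
    unfolding G_def[abs_def] by (intro Bochner_Integration.integrable_sum integrable_mult_right iw)
  then have "integrable spacetime (\<lambda>z. complex_of_real (cmod (evolution a b B c z) ^ 4))" by (simp only: G)
  then show "integrable spacetime (\<lambda>z. cmod (evolution a b B c z) ^ 4)" unfolding complex_of_real_integrable_eq .
  have "of_real (LINT z|spacetime. cmod (evolution a b B c z) ^ 4) = (LINT z|spacetime. G z)"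
    unfolding integral_complex_of_real[symmetric] G ..
  also have "\<dots> = (\<Sum>k1\<in>B. \<Sum>k2\<in>B. \<Sum>k3\<in>B. \<Sum>k4\<in>B. C k1 k2 k3 k4 * (LINT z|spacetime. w k1 k2 k3 k4 z))"
    unfolding G_def using iw by simp
  also have "\<dots> = (\<Sum>k1\<in>B. \<Sum>k2\<in>B. \<Sum>k3\<in>B. \<Sum>k4\<in>B. if ?Q k1 + ?Q k2 = ?Q k3 + ?Q k4 \<and> k1 + k2 = k3 + k4
        then of_real ((2 * pi) ^ 3) * C k1 k2 k3 k4 else 0)"
  proof (intro sum.cong refl)
    fix k1 k2 k3 k4
    have "- ?Q k1 + (- ?Q k2 + (?Q k3 + ?Q k4)) = 0 \<longleftrightarrow> ?Q k1 + ?Q k2 = ?Q k3 + ?Q k4" by linarith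
    moreover have "k1 + (k2 + (- k3 + - k4)) = 0 \<longleftrightarrow> k1 + k2 = k3 + k4"
      by (auto simp: prod_eq_iff)
    ultimately show "C k1 k2 k3 k4 * (LINT z|spacetime. w k1 k2 k3 k4 z) = (if ?Q k1 + ?Q k2 = ?Q k3 + ?Q k4 \<and> k1 + k2 = k3 + k4
        then of_real ((2 * pi) ^ 3) * C k1 k2 k3 k4 else 0)"
      unfolding w_def integral_wave by simp
  qed
  also have "\<dots> = (\<Sum>(k1, k2, k3, k4)\<in>quads a b B. of_real ((2 * pi) ^ 3) * C k1 k2 k3 k4)"
    by (rule sum_quads[OF assms, symmetric])
  finally show "of_real (LINT z|spacetime. cmod (evolution a b B c z) ^ 4)
       = of_real ((2 * pi) ^ 3) * (\<Sum>(k1, k2, k3, k4)\<in>quads a b B. c k1 * c k2 * (cnj (c k3) * cnj (c k4)))"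
    by (simp add: C_def sum_distrib_left split_def)
qed

lemma evolution_L4_le:
  assumes "finite B"
  shows "(LINT z|spacetime. cmod (evolution a b B c z) ^ 4) \<le> (2 * pi) ^ 3 * energy a b B (\<lambda>k. cmod (c k))"
proof -
  define I where "I = (LINT z|spacetime. cmod (evolution a b B c z) ^ 4)"
  have "I \<le> cmod (of_real I)" by simp
  also have "\<dots> = (2 * pi) ^ 3 * cmod (\<Sum>(k1, k2, k3, k4)\<in>quads a b B. c k1 * c k2 * (cnj (c k3) * cnj (c k4)))"
    unfolding I_def evolution_fourth_power(2)[OF assms] norm_mult norm_of_real by simp
  also have "\<dots> \<le> (2 * pi) ^ 3 * energy a b B (\<lambda>k. cmod (c k))"
    unfolding energy_def
    by (intro mult_left_mono sum_norm_le) (auto simp: norm_mult)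
  finally show ?thesis by (simp add: I_def)
qed

lemma evolution_in_Lp: "finite B \<Longrightarrow> evolution a b B c \<in> Lp 4 spacetime"
  using evolution_measurable evolution_fourth_power(1)[of B a b c] by (simp add: Lp_def powr_numeral)

lemma Lp_norm_evolution:
  "Lp_norm 4 spacetime (evolution a b B c) = (LINT z|spacetime. cmod (evolution a b B c z) ^ 4) powr (1 / 4)"
  by (simp add: Lp_norm_def powr_numeral)

lemma trig_square_norm:
  assumes "finite B"
  shows "integrable torus (\<lambda>x. (cmod (\<Sum>k\<in>B. c k * character k x))\<^sup>2)"
    and "(LINT x|torus. (cmod (\<Sum>k\<in>B. c k * character k x))\<^sup>2) = (2 * pi)\<^sup>2 * (\<Sum>k\<in>B. (cmod (c k))\<^sup>2)"
proof -
  define G where "G x = (\<Sum>k\<in>B. \<Sum>l\<in>B. c k * cnj (c l) * character (k - l) x)" for x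
  have G: "complex_of_real ((cmod (\<Sum>k\<in>B. c k * character k x))\<^sup>2) = G x" for x
    unfolding complex_norm_square G_def
    by (simp add: sum_product cnj_character) (intro sum.cong refl, simp add: character_mult[symmetric] mult_ac diff_conv_add_uminus del: add_uminus_conv_diff)
  have iG: "integrable torus G" unfolding G_def[abs_def]
    by (intro Bochner_Integration.integrable_sum integrable_mult_right integrable_character)
  then have "integrable torus (\<lambda>x. complex_of_real ((cmod (\<Sum>k\<in>B. c k * character k x))\<^sup>2))" by (simp only: G)
  then show "integrable torus (\<lambda>x. (cmod (\<Sum>k\<in>B. c k * character k x))\<^sup>2)" unfolding complex_of_real_integrable_eq .
  have "complex_of_real (LINT x|torus. (cmod (\<Sum>k\<in>B. c k * character k x))\<^sup>2) = (LINT x|torus. G x)"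
    unfolding integral_complex_of_real[symmetric] G ..
  also have "\<dots> = (\<Sum>k\<in>B. \<Sum>l\<in>B. c k * cnj (c l) * (LINT x|torus. character (k - l) x))"
    unfolding G_def by (simp add: integrable_character)
  also have "\<dots> = (\<Sum>k\<in>B. \<Sum>l\<in>B. if l = k then c k * cnj (c k) * of_real ((2 * pi)\<^sup>2) else 0)"
    by (intro sum.cong refl) (auto simp: integral_character)
  also have "\<dots> = of_real ((2 * pi)\<^sup>2 * (\<Sum>k\<in>B. (cmod (c k))\<^sup>2))"
    using assms by (simp add: sum.delta complex_norm_square[symmetric] sum_distrib_left mult_ac del: of_real_power flip: of_real_mult)
  finally show "(LINT x|torus. (cmod (\<Sum>k\<in>B. c k * character k x))\<^sup>2) = (2 * pi)\<^sup>2 * (\<Sum>k\<in>B. (cmod (c k))\<^sup>2)"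
    unfolding of_real_eq_iff .
qed

text \<open>Integrates \<open>2 * Re (\<phi> * cnj S) - (cmod S)\<^sup>2 \<le> (cmod
  \<phi>)\<^sup>2\<close>, where \<open>S\<close> is the partial Fourier sum; both integrals on the
  left are computed from the same \<open>T\<close>.\<close>

lemma Bessel:
  assumes \<phi>: "\<phi> \<in> L2_torus" and B: "finite B"
  shows "(2 * pi)\<^sup>2 * (\<Sum>k\<in>B. (cmod (fourier_coeff \<phi> k))\<^sup>2) \<le> (LINT x|torus. (cmod (\<phi> x))\<^sup>2)"
proof -
  interpret finite_measure torus by (rule finite_measure_torus)
  have m: "\<phi> \<in> borel_measurable torus" and i2: "integrable torus (\<lambda>x. (cmod (\<phi> x))\<^sup>2)"
    using \<phi> by (auto simp: L2_torus_def Lp_def powr_numeral)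
  define c where "c = fourier_coeff \<phi>"
  define S where "S x = (\<Sum>k\<in>B. c k * character k x)" for x
  define T where "T = (2 * pi)\<^sup>2 * (\<Sum>k\<in>B. (cmod (c k))\<^sup>2)"
  have mc: "character k \<in> borel_measurable torus" for k using integrable_character by (rule borel_measurable_integrable)
  have i1: "integrable torus (\<lambda>x. \<phi> x * character k x)" for k
  \<comment> \<open>On a space of finite measure, square integrability and
    \<open>u \<le> 1 + u\<^sup>2\<close> give integrability.\<close>
  proof (rule Bochner_Integration.integrable_bound)
    show "integrable torus (\<lambda>x. 1 + (cmod (\<phi> x))\<^sup>2)" using i2 by simp
    show "(\<lambda>x. \<phi> x * character k x) \<in> borel_measurable torus" using m mc by (rule borel_measurable_times)
    have "u \<le> 1 + u\<^sup>2" for u :: real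
    proof -
      have "0 \<le> (u - 1)\<^sup>2 + u\<^sup>2 + 1" by simp
      then show ?thesis by (simp add: power2_eq_square algebra_simps)
    qed
    then show "AE x in torus. cmod (\<phi> x * character k x) \<le> norm (1 + (cmod (\<phi> x))\<^sup>2)"
      by (simp add: norm_mult)
  qed
  have e: "\<phi> x * cnj (S x) = (\<Sum>k\<in>B. cnj (c k) * (\<phi> x * character (- k) x))" for x
    by (simp add: S_def sum_distrib_left cnj_character mult_ac)
  have iS: "integrable torus (\<lambda>x. \<phi> x * cnj (S x))"
    unfolding e by (intro Bochner_Integration.integrable_sum integrable_mult_right i1)
  have "(LINT x|torus. \<phi> x * cnj (S x)) = (\<Sum>k\<in>B. cnj (c k) * (LINT x|torus. \<phi> x * character (- k) x))"
    unfolding e using i1 by simp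
  also have "\<dots> = (\<Sum>k\<in>B. cnj (c k) * (c k * of_real ((2 * pi)\<^sup>2)))"
    by (simp add: c_def fourier_coeff_def)
  also have "\<dots> = (\<Sum>k\<in>B. of_real ((2 * pi)\<^sup>2) * of_real ((cmod (c k))\<^sup>2))"
    by (simp only: complex_norm_square mult_ac)
  also have "\<dots> = of_real T" unfolding T_def sum_distrib_left of_real_sum of_real_mult ..
  finally have cross: "(LINT x|torus. \<phi> x * cnj (S x)) = of_real T" .
  define r where "r x = Re (\<phi> x * cnj (S x))" for x
  define s where "s x = (cmod (S x))\<^sup>2" for x
  have r: "integrable torus r" "(LINT x|torus. r x) = T"
    using integrable_Re[OF iS] integral_Re[OF iS] cross unfolding r_def[abs_def] by (simp_all only: Re_complex_of_real)
  have s: "integrable torus s" "(LINT x|torus. s x) = T"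
    using trig_square_norm[OF B, of c] unfolding s_def[abs_def] S_def T_def .
  have "T = (LINT x|torus. 2 * r x - s x)" using r s by simp
  also have "\<dots> \<le> (LINT x|torus. (cmod (\<phi> x))\<^sup>2)"
  proof (rule integral_mono)
    show "integrable torus (\<lambda>x. 2 * r x - s x)" using r s by simp
    show "2 * r x - s x \<le> (cmod (\<phi> x))\<^sup>2" for x
    proof -
      have "r x \<le> cmod (\<phi> x) * cmod (S x)"
        using complex_Re_le_cmod[of "\<phi> x * cnj (S x)"] unfolding r_def norm_mult by simp
      moreover have "0 \<le> (cmod (\<phi> x) - cmod (S x))\<^sup>2" by simp
      ultimately show ?thesis by (simp add: power2_diff s_def)
    qed
  qed (rule i2)
  finally show ?thesis by (simp add: T_def c_def)
qed

lemma strichartz_of_energy: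
  assumes C: "C \<ge> 0" and E: "\<And>f. (\<And>k. 0 \<le> f k) \<Longrightarrow> energy a b (freq_box N) f \<le> C * (\<Sum>k\<in>freq_box N. (f k)\<^sup>2)\<^sup>2"
    and \<phi>: "\<phi> \<in> L2_torus"
  shows "Lp_norm 4 spacetime (\<lambda>(t, x). propagator a b t (proj_le N \<phi>) x) \<le> C powr (1 / 4) * Lp_norm 2 torus \<phi>"
proof -
  define c where "c = fourier_coeff \<phi>"
  define T where "T = (\<Sum>k\<in>freq_box N. (cmod (c k))\<^sup>2)"
  define I where "I = (LINT x|torus. (cmod (\<phi> x))\<^sup>2)"
  define J where "J = (LINT z|spacetime. cmod (evolution a b (freq_box N) c z) ^ 4)"
  have I0: "0 \<le> I" and T0: "0 \<le> T" and J0: "0 \<le> J" by (auto simp: I_def T_def J_def sum_nonneg)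
  have bessel: "(2 * pi)\<^sup>2 * T \<le> I" using Bessel[OF \<phi>] by (simp add: T_def c_def I_def)
  have "J \<le> (2 * pi) ^ 3 * energy a b (freq_box N) (\<lambda>k. cmod (c k))"
    unfolding J_def by (rule evolution_L4_le) simp
  also have "\<dots> \<le> (2 * pi) ^ 3 * (C * T\<^sup>2)" unfolding T_def by (intro mult_left_mono E) auto
  \<comment> \<open>One surplus factor \<open>2 * pi \<ge> 1\<close> completes the square of the
    left side of Bessel's inequality, so no extra constant remains beside \<open>C\<close>.\<close>
  also have "\<dots> \<le> (2 * pi) ^ 4 * (C * T\<^sup>2)" using pi_ge_two C by (intro mult_right_mono power_increasing) auto
  also have "\<dots> = C * ((2 * pi)\<^sup>2 * T)\<^sup>2" by (simp add: power_mult_distrib flip: power_mult)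
  also have "\<dots> \<le> C * I\<^sup>2" using bessel C T0 by (intro mult_left_mono power_mono) auto
  finally have "J powr (1 / 4) \<le> (C * I\<^sup>2) powr (1 / 4)" using J0 by (intro powr_mono2) auto
  also have "\<dots> = C powr (1 / 4) * (I powr (1 / 2))"
    using C I0 by (simp add: powr_mult powr_powr flip: powr_numeral)
  finally show ?thesis
    unfolding propagator_proj Lp_norm_evolution by (simp add: J_def c_def I_def Lp_norm_def powr_numeral)
qed

section \<open>Lower bounds\<close>

lemma character_periodic: "torus_periodic (character k)"
proof -
  have c: "cis (u + of_int n * (2 * pi)) = cis u" for u n
    using cis_multiple_2pi[of "of_int n"] by (simp add: cis_mult[symmetric] mult_ac)
  have "character k (x + 2 * pi, y) = character k (x, y)" "character k (x, y + 2 * pi) = character k (x, y)" for x y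
    using c[of "of_int (fst k) * x + of_int (snd k) * y" "fst k"] c[of "of_int (fst k) * x + of_int (snd k) * y" "snd k"]
    by (simp_all add: character_def algebra_simps)
  then show ?thesis by (simp add: torus_periodic_def)
qed

text \<open>The test function has coefficient 1 on \<open>S\<close>, so its energy is the number of
  quadruples. The quotient \<open>c / (2 * pi)\<close> compares the measure of space-time with the
  square of the measure of the torus.\<close>

lemma sharpness_of_quads:
  assumes S: "S \<subseteq> freq_box N" "S \<noteq> {}" and c: "c \<ge> 0" "\<theta> \<ge> 0"
    and Q: "c * \<theta> * (real (card S))\<^sup>2 \<le> real (card (quads a b S))"
  shows "\<exists>\<phi>\<in>L2_torus. \<not> (AE x in torus. \<phi> x = 0) \<and>
     Lp_norm 4 spacetime (\<lambda>(t, x). propagator a b t (proj_le N \<phi>) x) \<ge> (c / (2 * pi)) powr (1 / 4) * \<theta> powr (1 / 4) * Lp_norm 2 torus \<phi>"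
proof -
  have finS: "finite S" using S finite_subset finite_freq_box by blast
  define \<phi> where "\<phi> x = (\<Sum>k\<in>S. 1 * character k x)" for x
  have n: "(LINT x|torus. (cmod (\<phi> x))\<^sup>2) = (2 * pi)\<^sup>2 * real (card S)" and i: "integrable torus (\<lambda>x. (cmod (\<phi> x))\<^sup>2)"
    using trig_square_norm[OF finS, of "\<lambda>_. 1"] unfolding \<phi>_def by simp_all
  have "character k \<in> borel_measurable torus" for k using integrable_character by (rule borel_measurable_integrable)
  then have "\<phi> \<in> borel_measurable torus" unfolding \<phi>_def[abs_def] by (intro borel_measurable_sum borel_measurable_times borel_measurable_const)
  moreover have "torus_periodic \<phi>"
    using character_periodic by (simp add: \<phi>_def torus_periodic_def)
  ultimately have L2: "\<phi> \<in> L2_torus" using i by (simp add: L2_torus_def Lp_def powr_numeral)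
  have "\<not> (AE x in torus. \<phi> x = 0)"
  proof
    assume "AE x in torus. \<phi> x = 0"
    then have "AE x in torus. (cmod (\<phi> x))\<^sup>2 = 0" by eventually_elim simp
    then have "(LINT x|torus. (cmod (\<phi> x))\<^sup>2) = 0" by (rule integral_eq_zero_AE)
    then show False using n S finS by simp
  qed
  have fc: "fourier_coeff \<phi> k = (if k \<in> S then 1 else 0)" for k
    unfolding \<phi>_def[abs_def] by (rule fourier_coeff_trig[OF finS])
  have ev: "evolution a b (freq_box N) (fourier_coeff \<phi>) z = evolution a b S (\<lambda>_. 1) z" for z
    unfolding evolution_def fc by (rule sum.mono_neutral_cong_right) (use S in auto)
  define J where "J = (LINT z|spacetime. cmod (evolution a b S (\<lambda>_. 1) z) ^ 4)"
  have "complex_of_real J = complex_of_real ((2 * pi) ^ 3 * real (card (quads a b S)))"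
    unfolding J_def evolution_fourth_power(2)[OF finS] by (simp add: split_def)
  then have J: "J = (2 * pi) ^ 3 * real (card (quads a b S))" unfolding of_real_eq_iff .
  define T where "T = (2 * pi)\<^sup>2 * real (card S)"
  have T0: "T \<ge> 0" by (simp add: T_def)
  have "c / (2 * pi) * \<theta> * T\<^sup>2 = (2 * pi) ^ 3 * (c * \<theta> * (real (card S))\<^sup>2)"
    by (simp add: T_def power_mult_distrib power2_eq_square power3_eq_cube)
  also have "\<dots> \<le> J" unfolding J using Q by (intro mult_left_mono) auto
  finally have "(c / (2 * pi) * \<theta> * T\<^sup>2) powr (1 / 4) \<le> J powr (1 / 4)"
    using c by (intro powr_mono2) auto
  moreover have "(c / (2 * pi) * \<theta> * T\<^sup>2) powr (1 / 4) = (c / (2 * pi)) powr (1 / 4) * \<theta> powr (1 / 4) * T powr (1 / 2)"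
  proof -
    have "(T\<^sup>2) powr (1 / 4) = T powr (1 / 2)" using T0 by (simp add: powr_powr flip: powr_numeral)
    moreover have "(c / (2 * pi) * \<theta> * T\<^sup>2) powr (1 / 4) = (c / (2 * pi) * \<theta>) powr (1 / 4) * (T\<^sup>2) powr (1 / 4)"
      by (subst powr_mult) (use c T0 in auto)
    moreover have "(c / (2 * pi) * \<theta>) powr (1 / 4) = (c / (2 * pi)) powr (1 / 4) * \<theta> powr (1 / 4)"
      by (subst powr_mult) (use c in auto)
    ultimately show ?thesis by simp
  qed
  moreover have "Lp_norm 2 torus \<phi> = T powr (1 / 2)" using n by (simp add: Lp_norm_def powr_numeral T_def)
  moreover have "Lp_norm 4 spacetime (\<lambda>(t, x). propagator a b t (proj_le N \<phi>) x) = J powr (1 / 4)"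
    unfolding propagator_proj Lp_norm_evolution ev J_def ..
  ultimately have "Lp_norm 4 spacetime (\<lambda>(t, x). propagator a b t (proj_le N \<phi>) x) \<ge> (c / (2 * pi)) powr (1 / 4) * \<theta> powr (1 / 4) * Lp_norm 2 torus \<phi>"
    by simp
  then show ?thesis using L2 \<open>\<not> (AE x in torus. \<phi> x = 0)\<close> by blast
qed

text \<open>The form vanishes on the multiples of \<open>(h, a)\<close>, as
  \<open>a * (h\<^sup>2 + a * b) = 0\<close>. On this line only the additive condition remains, and
  an interval of length \<open>M\<close> has of order \<open>M ^ 3\<close> additive
  quadruples.\<close>

lemma many_quads_on_isotropic_line:
  fixes a b h :: int
  assumes a: "a \<noteq> 0" and h: "- (a * b) = h\<^sup>2"
  shows "\<exists>c>0. \<forall>N\<ge>1. \<exists>S. S \<subseteq> freq_box N \<and> S \<noteq> {} \<and> c * real N * (real (card S))\<^sup>2 \<le> real (card (quads a b S))"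
proof -
  define D where "D = nat (max \<bar>h\<bar> \<bar>a\<bar>)"
  have D: "D \<ge> 1" "\<bar>h\<bar> \<le> int D" "\<bar>a\<bar> \<le> int D" using a by (auto simp: D_def)
  have "\<exists>S. S \<subseteq> freq_box N \<and> S \<noteq> {} \<and> 1 / (8 * real D) * real N * (real (card S))\<^sup>2 \<le> real (card (quads a b S))"
    if N: "N \<ge> 1" for N
  proof -
    \<comment> \<open>Dividing by \<open>D\<close> keeps the multiples inside the box; halving again
      keeps \<open>x + t\<close> and \<open>y + t\<close> within the index range.\<close>
    define M K where "M = N div D" and "K = M div 2"
    define v where "v j = (int j * h, int j * a)" for j :: nat
    define S where "S = v ` {..M}"
    have injv: "inj v" using a by (auto simp: v_def inj_def)
    have q0: "qform a b (v j) = 0" for j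
    proof -
      have "qform a b (v j) = (int j)\<^sup>2 * (a * (h\<^sup>2 + a * b))" by (simp add: qform_def v_def power2_eq_square algebra_simps)
      then show ?thesis by (simp add: h[symmetric])
    qed
    have cS: "card S = M + 1" unfolding S_def using injv by (simp add: card_image inj_on_subset)
    have "S \<subseteq> freq_box N"
    proof
      fix k assume "k \<in> S"
      then obtain j where j: "j \<le> M" "k = v j" by (auto simp: S_def)
      have "int j * int D \<le> int N"
        using j(1) mult_le_mono1[of j M D] div_times_less_eq_dividend[of N D] unfolding M_def of_nat_mult[symmetric] of_nat_le_iff by linarith
      moreover have "\<bar>int j * h\<bar> \<le> int j * int D" "\<bar>int j * a\<bar> \<le> int j * int D"
        using D by (simp_all add: abs_mult mult_left_mono)
      ultimately show "k \<in> freq_box N" by (auto simp: j v_def freq_box_def)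
    qed
    have "card ({..K} \<times> {..K} \<times> {..K}) \<le> card (quads a b S)"
    proof (rule card_inj_on_le)
      show "inj_on (\<lambda>(x, y, t). (v (x + t), v y, v x, v (y + t))) ({..K} \<times> {..K} \<times> {..K})"
        by (auto simp: inj_on_def inj_eq[OF injv])
      have "2 * K \<le> M" by (simp add: K_def)
      then show "(\<lambda>(x, y, t). (v (x + t), v y, v x, v (y + t))) ` ({..K} \<times> {..K} \<times> {..K}) \<subseteq> quads a b S"
        by (auto simp: quads_def S_def q0) (auto simp: v_def algebra_simps)
      show "finite (quads a b S)" by (rule finite_quads) (simp add: S_def)
    qed
    then have "(K + 1) ^ 3 \<le> card (quads a b S)" by (simp only: card_cartesian_product card_atMost power3_eq_cube Suc_eq_plus1 mult.assoc)
    then have 1: "(real K + 1) ^ 3 \<le> real (card (quads a b S))"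
      by (metis of_nat_1 of_nat_add of_nat_le_iff of_nat_power)
    have "M + 1 \<le> 2 * (K + 1)" unfolding K_def by presburger
    then have "real (M + 1) \<le> real (2 * (K + 1))" unfolding of_nat_le_iff .
    then have "(real M + 1) / 2 \<le> real K + 1" by simp
    then have "((real M + 1) / 2) ^ 3 \<le> (real K + 1) ^ 3" by (intro power_mono) auto
    then have 2: "(real M + 1) * (real M + 1)\<^sup>2 / 8 \<le> real (card (quads a b S))"
      using 1 by (simp add: power_divide power2_eq_square power3_eq_cube)
    have "N < (M + 1) * D" unfolding M_def using D by (metis Suc_eq_plus1 dividend_less_div_times less_le_trans mult_Suc add.commute zero_less_one)
    then have "real N \<le> (real M + 1) * real D" by (metis less_imp_le of_nat_1 of_nat_add of_nat_le_iff of_nat_mult)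
    then have "1 / (8 * real D) * real N \<le> (real M + 1) / 8" using D by (simp add: field_simps)
    then have "1 / (8 * real D) * real N * (real M + 1)\<^sup>2 \<le> (real M + 1) / 8 * (real M + 1)\<^sup>2" by (intro mult_right_mono) auto
    also have "\<dots> = (real M + 1) * (real M + 1)\<^sup>2 / 8" by simp
    also note 2
    also have "real M + 1 = real (card S)" by (simp add: cS)
    finally have "1 / (8 * real D) * real N * (real (card S))\<^sup>2 \<le> real (card (quads a b S))" .
    moreover have "S \<noteq> {}" by (simp add: S_def)
    ultimately show ?thesis using \<open>S \<subseteq> freq_box N\<close> by blast
  qed
  then show ?thesis using D by (intro exI[of _ "1 / (8 * real D)"]) auto
qed

section \<open>Directions of sides as coprime pairs\<close>

definition coprime_pairs :: "nat \<Rightarrow> (nat \<times> nat) set" where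
  "coprime_pairs K = {(p, q). 1 \<le> p \<and> p \<le> K \<and> 1 \<le> q \<and> q \<le> K \<and> coprime p q}"

lemma finite_coprime_pairs [simp]: "finite (coprime_pairs K)"
  by (rule finite_subset[of _ "{..K} \<times> {..K}"]) (auto simp: coprime_pairs_def)

text \<open>A pair that is not coprime has both entries divisible by some \<open>d \<ge> 2\<close>,
  and the sum of \<open>1 / d\<^sup>2\<close> over these \<open>d\<close> is at most
  \<open>3 / 4\<close>: a quarter for \<open>d = 2\<close>, the rest by telescoping.\<close>

lemma card_coprime_pairs_ge: "(real K)\<^sup>2 / 4 \<le> real (card (coprime_pairs K))"
proof (cases "K \<ge> 2")
  case True
  define M where "M d = {(p, q). 1 \<le> p \<and> p \<le> K \<and> 1 \<le> q \<and> q \<le> K \<and> d dvd p \<and> d dvd q}" for d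
  have finM: "finite (M d)" for d
    by (rule finite_subset[of _ "{..K} \<times> {..K}"]) (auto simp: M_def)
  have cM: "real (card (M d)) \<le> (real K)\<^sup>2 * (1 / (real d)\<^sup>2)" if "d \<ge> 2" for d
  proof -
    have "M d \<subseteq> (\<lambda>(x, y). (d * x, d * y)) ` ({1..K div d} \<times> {1..K div d})"
    proof
      fix z assume z: "z \<in> M d"
      then obtain x y where "z = (d * x, d * y)" by (auto simp: M_def dvd_def)
      moreover from this have "x \<in> {1..K div d}" "y \<in> {1..K div d}"
        using z that by (auto simp: M_def less_eq_div_iff_mult_less_eq mult.commute Suc_le_eq)
      ultimately show "z \<in> (\<lambda>(x, y). (d * x, d * y)) ` ({1..K div d} \<times> {1..K div d})" by auto
    qed
    then have "card (M d) \<le> card ({1..K div d} \<times> {1..K div d})"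
      by (intro surj_card_le) auto
    then have "real (card (M d)) \<le> real (K div d) * real (K div d)"
      by (simp add: card_cartesian_product flip: of_nat_mult)
    also have "\<dots> \<le> (real K / real d) * (real K / real d)"
    proof -
      have "real (K div d * d) \<le> real K" unfolding of_nat_le_iff by simp
      then have "real (K div d) \<le> real K / real d" using that by (simp add: pos_le_divide_eq)
      then show ?thesis by (intro mult_mono) auto
    qed
    finally show ?thesis by (simp add: power2_eq_square)
  qed
  have zeta: "(\<Sum>d=2..n. 1 / (real d)\<^sup>2) \<le> 3 / 4 - 1 / real n" if "n \<ge> 2" for n :: nat
    using that
  proof (induction n rule: nat_induct_at_least)
    case (Suc n)
    have n: "real n > 0" using Suc(1) by simp
    have "1 / (real n + 1)\<^sup>2 \<le> 1 / (real n * (real n + 1))"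
      unfolding power2_eq_square using n by (intro divide_left_mono mult_right_mono) auto
    also have "\<dots> = 1 / real n - 1 / (real n + 1)" using n by (simp add: field_simps)
    finally have "1 / (real n + 1)\<^sup>2 \<le> 1 / real n - 1 / (real n + 1)" .
    then show ?case using Suc by (simp add: add.commute)
  qed simp
  have sub: "{1..K} \<times> {1..K} \<subseteq> coprime_pairs K \<union> (\<Union>d\<in>{2..K}. M d)"
  proof
    fix z assume z: "z \<in> {1..K} \<times> {1..K}"
    obtain p q where pq: "z = (p, q)" by (cases z)
    show "z \<in> coprime_pairs K \<union> (\<Union>d\<in>{2..K}. M d)"
    proof (cases "coprime p q")
      case False
      have "gcd p q \<noteq> 0" "gcd p q \<noteq> 1" using z pq False by (auto simp: coprime_iff_gcd_eq_1)
      then have g2: "2 \<le> gcd p q" by linarith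
      have "gcd p q \<le> p" using z pq by (intro gcd_le1_nat) auto
      then have "gcd p q \<le> K" by (rule order_trans) (use z pq in simp)
      with g2 have "gcd p q \<in> {2..K}" unfolding atLeastAtMost_iff ..
      moreover have "z \<in> M (gcd p q)" using z pq by (auto simp: M_def)
      ultimately show ?thesis by blast
    qed (use z pq in \<open>auto simp: coprime_pairs_def\<close>)
  qed
  have "K\<^sup>2 = card ({1..K} \<times> {1..K})" by (simp add: card_cartesian_product power2_eq_square)
  also have "\<dots> \<le> card (coprime_pairs K \<union> (\<Union>d\<in>{2..K}. M d))"
    using sub finM by (intro card_mono) auto
  also have "\<dots> \<le> card (coprime_pairs K) + card (\<Union>d\<in>{2..K}. M d)" by (rule card_Un_le)
  also have "card (\<Union>d\<in>{2..K}. M d) \<le> (\<Sum>d=2..K. card (M d))" by (rule card_UN_le) simp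
  finally have "K\<^sup>2 \<le> card (coprime_pairs K) + (\<Sum>d=2..K. card (M d))" by simp
  then have "real (K\<^sup>2) \<le> real (card (coprime_pairs K) + (\<Sum>d=2..K. card (M d)))" unfolding of_nat_le_iff .
  then have "(real K)\<^sup>2 \<le> real (card (coprime_pairs K)) + (\<Sum>d=2..K. real (card (M d)))" by simp
  also have "(\<Sum>d=2..K. real (card (M d))) \<le> (\<Sum>d=2..K. (real K)\<^sup>2 * (1 / (real d)\<^sup>2))"
    using cM by (intro sum_mono) auto
  also have "\<dots> = (real K)\<^sup>2 * (\<Sum>d=2..K. 1 / (real d)\<^sup>2)" by (simp add: sum_distrib_left)
  also have "\<dots> \<le> (real K)\<^sup>2 * (3 / 4)"
  proof (intro mult_left_mono)
    show "(\<Sum>d=2..K. 1 / (real d)\<^sup>2) \<le> 3 / 4" using zeta[OF True] by (rule order_trans) simp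
  qed simp
  finally show ?thesis by simp
next
  case False
  then consider "K = 0" | "K = 1" by linarith
  then show ?thesis
  proof cases
    case 2
    have "coprime_pairs 1 = {(1, 1)}" by (auto simp: coprime_pairs_def)
    then show ?thesis using 2 by simp
  qed simp
qed

text \<open>Each enlargement by the factor 4 adds at least \<open>4 * 16 ^ i - 16 ^ i\<close> pairs
  of weight at least \<open>1 / 16 ^ (i + 1)\<close>. With the density bound \<open>1 / 4\<close>
  and the trivial upper bound for the smaller box, a factor of 2 would give nothing.\<close>

lemma sum_coprime_pairs_ge: "3 / 16 * real i \<le> (\<Sum>(p, q)\<in>coprime_pairs (4 ^ i). 1 / (real (max p q))\<^sup>2)"
proof (induction i)
  case (Suc i)
  define B where "B = coprime_pairs (4 ^ Suc i) - coprime_pairs (4 ^ i)"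
  have sub: "coprime_pairs (4 ^ i) \<subseteq> coprime_pairs (4 ^ Suc i)"
    by (auto simp: coprime_pairs_def intro: order_trans[OF _ power_increasing[of i "Suc i" "4::nat"], simplified])
  have "card (coprime_pairs (4 ^ i)) \<le> card ({1..4 ^ i :: nat} \<times> {1..4 ^ i :: nat})"
    by (intro card_mono) (auto simp: coprime_pairs_def)
  then have "card (coprime_pairs (4 ^ i)) \<le> 4 ^ i * 4 ^ i" by (simp add: card_cartesian_product)
  then have "real (card (coprime_pairs (4 ^ i))) \<le> real (4 ^ i * 4 ^ i)" unfolding of_nat_le_iff .
  then have u: "real (card (coprime_pairs (4 ^ i))) \<le> (4 ^ i)\<^sup>2" by (simp add: power2_eq_square)
  have "card (coprime_pairs (4 ^ Suc i)) = card (coprime_pairs (4 ^ i)) + card B"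
    unfolding B_def using sub by (simp add: card_Diff_subset card_mono)
  then have "3 * (4 ^ i)\<^sup>2 \<le> real (card B)"
    using card_coprime_pairs_ge[of "4 ^ Suc i"] u by (simp add: power_mult_distrib)
  then have "3 * (4 ^ i)\<^sup>2 / (4 ^ Suc i)\<^sup>2 \<le> real (card B) / (4 ^ Suc i)\<^sup>2" by (intro divide_right_mono) auto
  also have "\<dots> = (\<Sum>(p, q)\<in>B. 1 / (4 ^ Suc i)\<^sup>2)" by (simp add: split_def)
  also have "\<dots> \<le> (\<Sum>(p, q)\<in>B. 1 / (real (max p q))\<^sup>2)"
  proof (rule sum_mono, clarify)
    fix p q assume "(p, q) \<in> B"
    then have m: "max p q \<le> 4 ^ Suc i" "0 < max p q" by (auto simp: B_def coprime_pairs_def)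
    have "real (max p q) \<le> real (4 ^ Suc i)" using m(1) unfolding of_nat_le_iff .
    then have "(real (max p q))\<^sup>2 \<le> (4 ^ Suc i)\<^sup>2" by (intro power_mono) auto
    moreover have "0 < real (max p q)" using m(2) unfolding of_nat_0_less_iff .
    ultimately show "1 / (4 ^ Suc i)\<^sup>2 \<le> 1 / (real (max p q))\<^sup>2"
      by (intro divide_left_mono mult_pos_pos zero_less_power) auto
  qed
  finally have "3 / 16 \<le> (\<Sum>(p, q)\<in>B. 1 / (real (max p q))\<^sup>2)" by (simp add: power_mult_distrib)
  moreover have "(\<Sum>(p, q)\<in>coprime_pairs (4 ^ Suc i). 1 / (real (max p q))\<^sup>2)
     = (\<Sum>(p, q)\<in>coprime_pairs (4 ^ i). 1 / (real (max p q))\<^sup>2) + (\<Sum>(p, q)\<in>B. 1 / (real (max p q))\<^sup>2)"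
    unfolding B_def using sub by (subst sum.subset_diff[OF sub]) auto
  ultimately show ?case using Suc by simp
qed (auto intro!: sum_nonneg)

lemma card_quads_ge_square:
  assumes "finite S" shows "(card S)\<^sup>2 \<le> card (quads a b S)"
proof -
  have "card (S \<times> S) \<le> card (quads a b S)"
    by (rule card_inj_on_le[of "\<lambda>(x, y). (x, y, x, y)"])
      (use assms finite_quads in \<open>auto simp: inj_on_def quads_def\<close>)
  then show ?thesis by (simp add: card_cartesian_product power2_eq_square)
qed

lemma in_freq_box: "k \<in> freq_box N \<longleftrightarrow> \<bar>fst k\<bar> \<le> int N \<and> \<bar>snd k\<bar> \<le> int N"
  by (auto simp: freq_box_def mem_Times_iff)

text \<open>Rectangles with sides \<open>j * (p, q)\<close> and \<open>l * (- b * q, a * p)\<close>,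
  which are orthogonal for the form. Coprimality recovers \<open>j\<close> as a greatest common
  divisor of the first side. The corner \<open>k\<close> ranges over half the box, and each side
  moves it by at most a quarter of \<open>N\<close>.\<close>

lemma quads_of_coprime_pairs:
  fixes a b :: int and n N :: nat
  assumes a: "a \<noteq> 0" and c0: "\<bar>a\<bar> \<le> int c0" "\<bar>b\<bar> \<le> int c0" "c0 \<ge> 1" and n: "4 * c0 * n \<le> N"
  shows "N\<^sup>2 * (\<Sum>(p, q)\<in>coprime_pairs n. (n div max p q)\<^sup>2) \<le> card (quads a b (freq_box N))"
proof -
  define H where "H = N div 2"
  define X where "X = ({- int H..int H} \<times> {- int H..int H}) \<times> (SIGMA z:coprime_pairs n. {1..n div max (fst z) (snd z)} \<times> {1..n div max (fst z) (snd z)})"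
  define h where "h p q j = (int j * int p, int j * int q)" for p q j :: nat
  define w where "w p q l = (- (int l * b * int q), int l * a * int p)" for p q l :: nat
  define G where "G = (\<lambda>(k, (p, q), (j, l)). (k, k - h p q j - w p q l, k - h p q j, k - w p q l))"
  define tot where "tot = (\<Sum>(p, q)\<in>coprime_pairs n. (n div max p q)\<^sup>2)"
  have cX: "card X = (2 * H + 1)\<^sup>2 * tot"
  proof -
    have "card {- int H..int H} = 2 * H + 1" by simp
    then show ?thesis unfolding X_def card_cartesian_product tot_def by (simp add: card_SigmaI power2_eq_square split_def)
  qed
  have "N\<^sup>2 \<le> (2 * H + 1)\<^sup>2" by (intro power_mono) (auto simp: H_def)
  then have "N\<^sup>2 * tot \<le> card X" unfolding cX by (rule mult_le_mono1)
  also have "card X \<le> card (quads a b (freq_box N))"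
  proof (rule card_inj_on_le[of G])
    show "finite (quads a b (freq_box N))" by (rule finite_quads) simp
    show "inj_on G X"
    proof (rule inj_onI)
      fix x x' assume x: "x \<in> X" "x' \<in> X" "G x = G x'"
      obtain k p q j l where xx: "x = (k, (p, q), (j, l))" by (metis prod.collapse)
      obtain k' p' q' j' l' where xx': "x' = (k', (p', q'), (j', l'))" by (metis prod.collapse)
      have b1: "coprime p q" "coprime p' q'" "p \<ge> 1" "p' \<ge> 1" "j \<ge> 1" "j' \<ge> 1"
        using x by (auto simp: xx xx' X_def coprime_pairs_def)
      have k: "k = k'" and hh: "h p q j = h p' q' j'" and ww: "w p q l = w p' q' l'"
        using x(3) by (auto simp: xx xx' G_def)
      have e: "j * p = j' * p'" "j * q = j' * q'"
        using hh by (simp_all add: h_def flip: of_nat_mult)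
      have "j = gcd (j * p) (j * q)" using b1 by (simp add: gcd_mult_distrib_nat[symmetric])
      also have "\<dots> = gcd (j' * p') (j' * q')" by (simp only: e)
      also have "\<dots> = j'" using b1 by (simp add: gcd_mult_distrib_nat[symmetric])
      finally have j: "j = j'" .
      then have pq: "p = p'" "q = q'" using e b1 by auto
      have "int l * a * int p = int l' * a * int p" using ww pq by (simp add: w_def)
      then have "l = l'" using a b1 by simp
      then show "x = x'" using k j pq by (simp add: xx xx')
    qed
    show "G ` X \<subseteq> quads a b (freq_box N)"
    proof
      fix y assume "y \<in> G ` X"
      then obtain k p q j l where y: "y = G (k, (p, q), (j, l))" and x: "(k, (p, q), (j, l)) \<in> X" by auto
      have kk: "\<bar>fst k\<bar> \<le> int H" "\<bar>snd k\<bar> \<le> int H" using x by (auto simp: X_def mem_Times_iff)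
      have "t * max p q \<le> n" if "t \<le> n div max p q" for t
        using mult_le_mono1[OF that] div_times_less_eq_dividend by (rule order_trans)
      moreover have "j \<le> n div max p q" "l \<le> n div max p q" using x by (auto simp: X_def)
      ultimately have jl: "j * max p q \<le> n" "l * max p q \<le> n" by blast+
      have *: "int t * int x \<le> int n" if "t * max p q \<le> n" "x \<le> max p q" for t x
      proof -
        have "t * x \<le> n" using mult_le_mono2[OF that(2)] that(1) by (rule order_trans)
        then show ?thesis by (simp flip: of_nat_mult)
      qed
      have bnd: "int j * int p \<le> int n" "int j * int q \<le> int n" "int l * int p \<le> int n" "int l * int q \<le> int n"
        using jl by (auto intro!: *)
      have cn: "int n \<le> int c0 * int n" using c0(3) by (simp flip: of_nat_mult)
      have w1: "\<bar>int l * b * int q\<bar> \<le> int c0 * int n" "\<bar>int l * a * int p\<bar> \<le> int c0 * int n"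
      proof -
        have "\<bar>int l * b * int q\<bar> = \<bar>b\<bar> * (int l * int q)" by (simp add: abs_mult)
        also have "\<dots> \<le> int c0 * int n" using c0 bnd by (intro mult_mono) auto
        finally show "\<bar>int l * b * int q\<bar> \<le> int c0 * int n" .
        have "\<bar>int l * a * int p\<bar> = \<bar>a\<bar> * (int l * int p)" by (simp add: abs_mult)
        also have "\<dots> \<le> int c0 * int n" using c0 bnd by (intro mult_mono) auto
        finally show "\<bar>int l * a * int p\<bar> \<le> int c0 * int n" .
      qed
      have h1: "\<bar>int j * int p\<bar> \<le> int c0 * int n" "\<bar>int j * int q\<bar> \<le> int c0 * int n"
        using bnd cn by auto
      have "int (4 * c0 * n) \<le> int N" using n unfolding of_nat_le_iff .
      then have "4 * (int c0 * int n) \<le> int N" by simp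
      moreover have "2 * int H \<le> int N" by (simp add: H_def)
      ultimately have "k \<in> freq_box N" "k - h p q j - w p q l \<in> freq_box N" "k - h p q j \<in> freq_box N" "k - w p q l \<in> freq_box N"
        using kk w1 h1 unfolding in_freq_box h_def w_def fst_diff snd_diff fst_conv snd_conv by linarith+
      moreover have "qform a b k + qform a b (k - h p q j - w p q l) = qform a b (k - h p q j) + qform a b (k - w p q l)"
        by (simp add: qform_def h_def w_def power2_eq_square algebra_simps)
      moreover have "k + (k - h p q j - w p q l) = (k - h p q j) + (k - w p q l)" by (simp add: algebra_simps)
      ultimately show "y \<in> quads a b (freq_box N)" by (simp add: y G_def quads_def)
    qed
  qed
  finally show ?thesis by (simp only: tot_def)
qed

lemma many_quads_in_box:
  fixes a b :: int
  assumes a: "a \<noteq> 0"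
  shows "\<exists>c>0. \<forall>j\<ge>1. c * real j * (real (card (freq_box (2 ^ j))))\<^sup>2 \<le> real (card (quads a b (freq_box (2 ^ j))))"
proof -
  define c0 where "c0 = nat (max \<bar>a\<bar> \<bar>b\<bar>)"
  have c0: "\<bar>a\<bar> \<le> int c0" "\<bar>b\<bar> \<le> int c0" "c0 \<ge> 1" using a by (auto simp: c0_def)
  \<comment> \<open>A power of two that exceeds \<open>4 * c0\<close>, so that dividing the dyadic
    \<open>N\<close> by it gives an integer \<open>n\<close>.\<close>
  define e where "e = 4 * c0"
  have e: "4 * c0 \<le> 2 ^ e" unfolding e_def by (rule less_imp_le[OF less_exp])
  \<comment> \<open>The factor \<open>2 * e + 2\<close> makes \<open>c * j \<le> 1\<close> for small
    \<open>j\<close>, where the trivial quadruples suffice; \<open>4 ^ e\<close> undoes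
    \<open>N = 2 ^ e * n\<close>, and \<open>10 ^ 5\<close> absorbs the numerical constants.\<close>
  define c :: real where "c = 1 / (10 ^ 5 * 4 ^ e * (2 * real e + 2))"
  have c_pos: "c > 0" by (simp add: c_def)
  have main: "c * real j * (real (card (freq_box (2 ^ j))))\<^sup>2 \<le> real (card (quads a b (freq_box (2 ^ j))))" if j: "j \<ge> 1" for j
  proof (cases "j \<le> 2 * e + 2")
    case True
    have "(1::real) * 1 \<le> 10 ^ 5 * 4 ^ e" by (intro mult_mono) auto
    then have "(1::real) \<le> 10 ^ 5 * 4 ^ e" by simp
    then have *: "1 * (2 * real e + 2) \<le> (10 ^ 5 * 4 ^ e) * (2 * real e + 2)" by (intro mult_right_mono) auto
    have "real j \<le> real (2 * e + 2)" using True unfolding of_nat_le_iff .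
    then have "real j \<le> 1 * (2 * real e + 2)" by simp
    also note *
    finally have "real j \<le> 10 ^ 5 * 4 ^ e * (2 * real e + 2)" .
    then have "real j / (10 ^ 5 * 4 ^ e * (2 * real e + 2)) \<le> 1" by (subst pos_divide_le_eq) auto
    then have "c * real j \<le> 1" by (simp add: c_def)
    then have "c * real j * (real (card (freq_box (2 ^ j))))\<^sup>2 \<le> 1 * (real (card (freq_box (2 ^ j))))\<^sup>2"
      by (intro mult_right_mono) auto
    also have "\<dots> \<le> real (card (quads a b (freq_box (2 ^ j))))"
      using card_quads_ge_square[OF finite_freq_box, of "2 ^ j" a b] by (simp flip: of_nat_power)
    finally show ?thesis .
  next
    case False
    define i where "i = (j - e) div 2"
    define n :: nat where "n = 2 ^ (j - e)"
    define N :: nat where "N = 2 ^ j"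
    have "4 * c0 * n \<le> 2 ^ e * n" using e by simp
    also have "\<dots> = N" using False by (simp add: n_def N_def flip: power_add)
    finally have nN: "4 * c0 * n \<le> N" .
    have Nn: "real N = 2 ^ e * real n" using False by (simp add: n_def N_def flip: power_add)
    have "(4::nat) ^ i = 2 ^ (2 * i)" by (simp add: power_mult)
    also have "\<dots> \<le> n" unfolding n_def i_def by (intro power_increasing) auto
    finally have in4: "4 ^ i \<le> n" .
    have "3 / 16 * real i \<le> (\<Sum>(p, q)\<in>coprime_pairs (4 ^ i). 1 / (real (max p q))\<^sup>2)" by (rule sum_coprime_pairs_ge)
    also have "\<dots> \<le> (\<Sum>(p, q)\<in>coprime_pairs n. 1 / (real (max p q))\<^sup>2)"
    proof (intro sum_mono2)
      show "coprime_pairs (4 ^ i) \<subseteq> coprime_pairs n" using in4 by (auto simp: coprime_pairs_def)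
    qed auto
    finally have S: "3 / 16 * real i \<le> (\<Sum>(p, q)\<in>coprime_pairs n. 1 / (real (max p q))\<^sup>2)" .
    have "(real n)\<^sup>2 / 4 * (\<Sum>(p, q)\<in>coprime_pairs n. 1 / (real (max p q))\<^sup>2) \<le> (\<Sum>(p, q)\<in>coprime_pairs n. (real (n div max p q))\<^sup>2)"
      unfolding sum_distrib_left
    proof (rule sum_mono)
      fix z assume z: "z \<in> coprime_pairs n"
      obtain p q where pq: "z = (p, q)" by (cases z)
      define x where "x = max p q"
      have x: "1 \<le> x" "x \<le> n" using z by (auto simp: pq x_def coprime_pairs_def)
      have d1: "1 \<le> n div x" using x by (simp add: div_greater_zero_iff Suc_le_eq)
      \<comment> \<open>Since \<open>n div x \<ge> 1\<close>, rounding down loses at most a factor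
        of 2.\<close>
      have "n < (n div x + 1) * x" using x dividend_less_div_times[of x n] by (simp add: algebra_simps)
      also have "\<dots> \<le> (2 * (n div x)) * x" using d1 by (intro mult_right_mono) auto
      finally have "real n \<le> real (2 * (n div x) * x)" unfolding of_nat_le_iff by simp
      then have "real n / (2 * real x) \<le> real (n div x)" using x by (simp add: pos_divide_le_eq mult_ac)
      then have "(real n / (2 * real x))\<^sup>2 \<le> (real (n div x))\<^sup>2" by (intro power_mono) auto
      then show "(real n)\<^sup>2 / 4 * (case z of (p, q) \<Rightarrow> 1 / (real (max p q))\<^sup>2) \<le> (case z of (p, q) \<Rightarrow> (real (n div max p q))\<^sup>2)"
        by (simp add: pq x_def power_divide power_mult_distrib)
    qed
    from mult_left_mono[OF S, of "(real n)\<^sup>2 / 4"] this have T: "(real n)\<^sup>2 / 4 * (3 / 16 * real i) \<le> (\<Sum>(p, q)\<in>coprime_pairs n. (real (n div max p q))\<^sup>2)"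
      by (rule order_trans) simp
    have "real (N\<^sup>2 * (\<Sum>(p, q)\<in>coprime_pairs n. (n div max p q)\<^sup>2)) \<le> real (card (quads a b (freq_box N)))"
      unfolding of_nat_le_iff by (rule quads_of_coprime_pairs[OF a c0 nN])
    then have Q: "(real N)\<^sup>2 * (\<Sum>(p, q)\<in>coprime_pairs n. (real (n div max p q))\<^sup>2) \<le> real (card (quads a b (freq_box N)))"
      by (simp add: split_def)
    have "j \<le> 4 * i" using False unfolding i_def by presburger
    then have "real j \<le> real (4 * i)" unfolding of_nat_le_iff .
    then have "real j / 4 \<le> real i" by simp
    then have "(real N)\<^sup>2 * ((real n)\<^sup>2 / 4 * (3 / 16 * (real j / 4))) \<le> (real N)\<^sup>2 * ((real n)\<^sup>2 / 4 * (3 / 16 * real i))"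
      by (intro mult_left_mono) auto
    also have "\<dots> \<le> real (card (quads a b (freq_box N)))"
      by (rule order_trans[OF mult_left_mono[OF T] Q]) simp
    finally have 1: "(real N)\<^sup>2 * ((real n)\<^sup>2 / 4 * (3 / 16 * (real j / 4))) \<le> real (card (quads a b (freq_box N)))" .
    have "real (card (freq_box N)) = (2 * real N + 1)\<^sup>2" by (simp add: card_freq_box)
    also have "\<dots> \<le> (3 * real N)\<^sup>2" by (intro power_mono) (auto simp: N_def)
    finally have "(real (card (freq_box N)))\<^sup>2 \<le> ((3 * real N)\<^sup>2)\<^sup>2" by (intro power_mono) auto
    also have "\<dots> = 81 * (real N)\<^sup>2 * (4 ^ e * (real n)\<^sup>2)"
    proof -
      have "(real N)\<^sup>2 = 4 ^ e * (real n)\<^sup>2" unfolding Nn by (simp add: power_mult_distrib power2_eq_square flip: power_mult_distrib)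
      then show ?thesis by (simp add: power_mult_distrib power2_eq_square)
    qed
    finally have "c * real j * (real (card (freq_box N)))\<^sup>2 \<le> c * real j * (81 * (real N)\<^sup>2 * (4 ^ e * (real n)\<^sup>2))"
      using c_pos by (intro mult_left_mono) auto
    also have "\<dots> = (c * 4 ^ e) * (81 * real j * (real N)\<^sup>2 * (real n)\<^sup>2)" by simp
    also have "\<dots> \<le> (1 / 10 ^ 5) * (81 * real j * (real N)\<^sup>2 * (real n)\<^sup>2)"
    proof (intro mult_right_mono)
      have "c * 4 ^ e = 1 / (10 ^ 5 * (2 * real e + 2))" by (simp add: c_def)
      also have "\<dots> \<le> 1 / 10 ^ 5" by (intro divide_left_mono) auto
      finally show "c * 4 ^ e \<le> 1 / 10 ^ 5" .
    qed auto
    also have "\<dots> \<le> (real N)\<^sup>2 * ((real n)\<^sup>2 / 4 * (3 / 16 * (real j / 4)))"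
    proof -
      have "0 \<le> real j * (real N)\<^sup>2 * (real n)\<^sup>2" by simp
      then show ?thesis by (simp add: mult_ac)
    qed
    finally show ?thesis using 1 by (simp add: N_def)
  qed
  then show ?thesis using c_pos by blast
qed

section \<open>The two cases of \<open>Theta\<close> and the conclusion\<close>

lemma anisotropic_if_not_square:
  fixes a b :: int
  assumes "a \<noteq> 0" "b \<noteq> 0" and nsq: "\<nexists>h. - (a * b) = h\<^sup>2"
  shows "anisotropic a b"
proof
  fix x y :: int assume e: "a * x\<^sup>2 + b * y\<^sup>2 = 0"
  show "x = 0 \<and> y = 0"
  proof (cases "y = 0")
    case True
    then show ?thesis using e assms by simp
  next
    case False
    have "(a * x)\<^sup>2 = a * (a * x\<^sup>2)" by (simp add: power2_eq_square)
    also have "a * x\<^sup>2 = - (b * y\<^sup>2)" using e by simp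
    finally have s: "(a * x)\<^sup>2 = - (a * b) * y\<^sup>2" by simp
    then have "y\<^sup>2 dvd (a * x)\<^sup>2" by simp
    \<comment> \<open>Divisibility of squares passes to the integers themselves, so the quotient of
      \<open>a * x\<close> by \<open>y\<close> is an integer with square
      \<open>- (a * b)\<close>.\<close>
    then have "y dvd a * x" by simp
    then obtain h where "a * x = y * h" by (elim dvdE)
    then have "h\<^sup>2 * y\<^sup>2 = - (a * b) * y\<^sup>2" using s by (simp add: power_mult_distrib mult.commute)
    moreover have "y\<^sup>2 \<noteq> 0" using False by simp
    ultimately have "h\<^sup>2 = - (a * b)" using mult_right_cancel[of "y\<^sup>2" "h\<^sup>2" "- (a * b)"] by blast
    then have "- (a * b) = h\<^sup>2" by (rule sym)
    then show ?thesis using nsq by blast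
  qed
qed (use assms in auto)

lemma energy_le_Theta:
  fixes a b :: int
  assumes "a \<noteq> 0" "b \<noteq> 0" and N: "dyadic N" "N \<ge> 2" and f: "\<And>k. 0 \<le> f k"
  shows "energy a b (freq_box N) f \<le> 10 ^ 14 * Theta a b N * (\<Sum>k\<in>freq_box N. (f k)\<^sup>2)\<^sup>2"
proof (cases "\<exists>h. - (a * b) = h\<^sup>2")
  case True
  have "energy a b (freq_box N) f \<le> 6 * real N * (\<Sum>k\<in>freq_box N. (f k)\<^sup>2)\<^sup>2"
    using energy_le_linear[of b N a f] assms by simp
  also have "\<dots> \<le> 10 ^ 14 * real N * (\<Sum>k\<in>freq_box N. (f k)\<^sup>2)\<^sup>2" by (intro mult_right_mono) auto
  finally show ?thesis using True by (simp add: Theta_def)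
next
  case False
  interpret anisotropic a b by (rule anisotropic_if_not_square) (use assms False in auto)
  obtain j where j: "N = 2 ^ j" using N by (auto simp: dyadic_def)
  have j1: "j \<ge> 1" using N j by (cases j) auto
  have "card (freq_box N) < 2 ^ (2 * j + 3 + 1)"
  proof -
    \<comment> \<open>This fixes the number of levels as \<open>2 * j + 4\<close>. Together with
      \<open>2 * j + 4 \<le> 6 * j\<close> and \<open>ln 2 \<ge> 2 / 3\<close> it explains the step
      from \<open>10 ^ 13\<close> to \<open>10 ^ 14\<close>.\<close>
    have "(2 * N + 1)\<^sup>2 < (4 * N)\<^sup>2" using N by (intro power_strict_mono) auto
    also have "\<dots> = 2 ^ (2 * j + 3 + 1)" by (simp add: j power_add power_mult power2_eq_square flip: power_mult_distrib)
    finally show ?thesis by (simp add: card_freq_box)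
  qed
  then have "energy a b (freq_box N) f \<le> 10 ^ 13 * real (2 * j + 3 + 1) * (\<Sum>k\<in>freq_box N. (f k)\<^sup>2)\<^sup>2"
    using f by (intro energy_le_log) auto
  also have "\<dots> \<le> 10 ^ 14 * ln (real N) * (\<Sum>k\<in>freq_box N. (f k)\<^sup>2)\<^sup>2"
  proof (intro mult_right_mono)
    have "ln (real N) = real j * ln 2" by (simp add: j ln_realpow)
    moreover have "10 ^ 14 * (real j * (2 / 3)) \<le> 10 ^ 14 * (real j * ln 2)" using ln2_ge_two_thirds by (intro mult_left_mono) auto
    moreover have "10 ^ 13 * real (2 * j + 3 + 1) \<le> 10 ^ 14 * (real j * (2 / 3))" using j1 by simp
    ultimately show "10 ^ 13 * real (2 * j + 3 + 1) \<le> 10 ^ 14 * ln (real N)" by (simp only:)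
  qed simp
  finally show ?thesis using False by (simp add: Theta_def)
qed

lemma Theta_nonneg: "N \<ge> 2 \<Longrightarrow> 0 \<le> Theta a b N"
  by (simp add: Theta_def)

lemma many_quads:
  fixes a b :: int
  assumes "a \<noteq> 0"
  shows "\<exists>c>0. \<forall>N. dyadic N \<and> N \<ge> 2 \<longrightarrow> (\<exists>S. S \<subseteq> freq_box N \<and> S \<noteq> {} \<and> c * Theta a b N * (real (card S))\<^sup>2 \<le> real (card (quads a b S)))"
proof (cases "\<exists>h. - (a * b) = h\<^sup>2")
  case True
  then obtain h where "- (a * b) = h\<^sup>2" by blast
  from many_quads_on_isotropic_line[OF assms this] obtain c where c: "c > 0"
    "\<And>N. N \<ge> 1 \<Longrightarrow> \<exists>S. S \<subseteq> freq_box N \<and> S \<noteq> {} \<and> c * real N * (real (card S))\<^sup>2 \<le> real (card (quads a b S))"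
    by blast
  have "Theta a b N = real N" for N using True by (simp add: Theta_def)
  then have "\<exists>S. S \<subseteq> freq_box N \<and> S \<noteq> {} \<and> c * Theta a b N * (real (card S))\<^sup>2 \<le> real (card (quads a b S))"
    if "dyadic N \<and> N \<ge> 2" for N using c(2)[of N] that by simp
  then show ?thesis using c(1) by blast
next
  case False
  obtain c where c: "c > 0" "\<And>j. j \<ge> 1 \<Longrightarrow> c * real j * (real (card (freq_box (2 ^ j))))\<^sup>2 \<le> real (card (quads a b (freq_box (2 ^ j))))"
    using many_quads_in_box[OF assms] by blast
  have "\<exists>S. S \<subseteq> freq_box N \<and> S \<noteq> {} \<and> c * Theta a b N * (real (card S))\<^sup>2 \<le> real (card (quads a b S))"
    if N: "dyadic N" "N \<ge> 2" for N
  proof -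
    obtain j where j: "N = 2 ^ j" using N by (auto simp: dyadic_def)
    have j1: "j \<ge> 1" using N j by (cases j) auto
    have "Theta a b N = real j * ln 2" using False by (simp add: Theta_def j ln_realpow)
    also have "\<dots> \<le> real j * 1" using ln_2_less_1 by (intro mult_left_mono) auto
    finally have "c * Theta a b N * (real (card (freq_box N)))\<^sup>2 \<le> c * real j * (real (card (freq_box N)))\<^sup>2"
      using c(1) by (intro mult_right_mono mult_left_mono) auto
    also have "\<dots> \<le> real (card (quads a b (freq_box N)))" using c(2)[OF j1] by (simp add: j)
    finally have "c * Theta a b N * (real (card (freq_box N)))\<^sup>2 \<le> real (card (quads a b (freq_box N)))" .
    moreover have "(0, 0) \<in> freq_box N" by (simp add: in_freq_box)
    ultimately show ?thesis by (intro exI[of _ "freq_box N"]) blast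
  qed
  then show ?thesis using c(1) by blast
qed

theorem theorem1p3:
  fixes a b :: int
  assumes "a \<noteq> 0" and "b \<noteq> 0"
  shows "(\<exists>K>0. \<forall>N::nat. dyadic N \<and> N \<ge> 2 \<longrightarrow> (\<forall>\<phi>\<in>L2_torus.
            (\<lambda>(t, x). propagator a b t (proj_le N \<phi>) x) \<in> Lp 4 spacetime \<and>
            Lp_norm 4 spacetime (\<lambda>(t, x). propagator a b t (proj_le N \<phi>) x)
              \<le> K * Theta a b N powr (1 / 4) * Lp_norm 2 torus \<phi>)) \<and>
         (\<exists>\<kappa>>0. \<forall>N::nat. dyadic N \<and> N \<ge> 2 \<longrightarrow> (\<exists>\<phi>\<in>L2_torus.
            \<not> (AE x in torus. \<phi> x = 0) \<and>
            Lp_norm 4 spacetime (\<lambda>(t, x). propagator a b t (proj_le N \<phi>) x)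
              \<ge> \<kappa> * Theta a b N powr (1 / 4) * Lp_norm 2 torus \<phi>))"
proof (rule conjI)
  define K :: real where "K = (10 ^ 14) powr (1 / 4)"
  have "Lp_norm 4 spacetime (\<lambda>(t, x). propagator a b t (proj_le N \<phi>) x) \<le> K * Theta a b N powr (1 / 4) * Lp_norm 2 torus \<phi>"
    if N: "dyadic N" "N \<ge> 2" and \<phi>: "\<phi> \<in> L2_torus" for N \<phi>
  proof -
    have "Lp_norm 4 spacetime (\<lambda>(t, x). propagator a b t (proj_le N \<phi>) x) \<le> (10 ^ 14 * Theta a b N) powr (1 / 4) * Lp_norm 2 torus \<phi>"
      using energy_le_Theta[OF assms N] Theta_nonneg[OF N(2)] \<phi> by (intro strichartz_of_energy) auto
    also have "(10 ^ 14 * Theta a b N) powr (1 / 4) = K * Theta a b N powr (1 / 4)"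
      unfolding K_def by (subst powr_mult) (use Theta_nonneg[OF N(2)] in auto)
    finally show ?thesis .
  qed
  moreover have "(\<lambda>(t, x). propagator a b t (proj_le N \<phi>) x) \<in> Lp 4 spacetime" for N \<phi>
    unfolding propagator_proj by (rule evolution_in_Lp) simp
  moreover have "K > 0" by (simp add: K_def)
  ultimately show "\<exists>K>0. \<forall>N::nat. dyadic N \<and> N \<ge> 2 \<longrightarrow> (\<forall>\<phi>\<in>L2_torus.
            (\<lambda>(t, x). propagator a b t (proj_le N \<phi>) x) \<in> Lp 4 spacetime \<and>
            Lp_norm 4 spacetime (\<lambda>(t, x). propagator a b t (proj_le N \<phi>) x)
              \<le> K * Theta a b N powr (1 / 4) * Lp_norm 2 torus \<phi>)" by blast
next
  obtain c where c: "c > 0" "\<And>N. dyadic N \<and> N \<ge> 2 \<Longrightarrow> \<exists>S. S \<subseteq> freq_box N \<and> S \<noteq> {} \<and> c * Theta a b N * (real (card S))\<^sup>2 \<le> real (card (quads a b S))"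
    using many_quads[OF assms(1)] by blast
  define \<kappa> where "\<kappa> = (c / (2 * pi)) powr (1 / 4)"
  have "\<kappa> > 0" using c by (simp add: \<kappa>_def)
  moreover have "\<exists>\<phi>\<in>L2_torus. \<not> (AE x in torus. \<phi> x = 0) \<and>
            Lp_norm 4 spacetime (\<lambda>(t, x). propagator a b t (proj_le N \<phi>) x) \<ge> \<kappa> * Theta a b N powr (1 / 4) * Lp_norm 2 torus \<phi>"
    if N: "dyadic N \<and> N \<ge> 2" for N
  proof -
    obtain S where "S \<subseteq> freq_box N" "S \<noteq> {}" "c * Theta a b N * (real (card S))\<^sup>2 \<le> real (card (quads a b S))"
      using c(2)[OF N] by blast
    then show ?thesis unfolding \<kappa>_def using c(1) Theta_nonneg N by (intro sharpness_of_quads) auto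
  qed
  ultimately show "\<exists>\<kappa>>0. \<forall>N::nat. dyadic N \<and> N \<ge> 2 \<longrightarrow> (\<exists>\<phi>\<in>L2_torus.
            \<not> (AE x in torus. \<phi> x = 0) \<and>
            Lp_norm 4 spacetime (\<lambda>(t, x). propagator a b t (proj_le N \<phi>) x)
              \<ge> \<kappa> * Theta a b N powr (1 / 4) * Lp_norm 2 torus \<phi>)" by blast
qed

end
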